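(* The map $$p(t)=\sum_{l\ge0}c_lt^l\ \mapsto\ \vartheta_p=\eta^{2c_0}\prod_{l\ge1}\bigl(\vartheta_l/\eta\bigr)^{c_l}$$ defines an isomorphism from the additive group $\frac12\mathbb Z+t\mathbb Z[t]$ (polynomials with constant term in $\frac12\mathbb Z$ and all other coefficients in $\mathbb Z$) onto the multiplicative group $\mathrm{TQ}$ of theta quotients. The theta quotient $\vartheta_p$ is a meromorphic Jacobi form of weight $k=p(0)$, index $m=\frac12\bigl(p'(1)+p''(1)\bigr)$ and character $\varepsilon^h$ with $h=2p(1)$. It is weakly holomorphic (i.e. holomorphic on $\mathbb H\times\mathbb C$) if and only if for all positive integers $N$ $$\frac1N\sum_{\zeta^N=1}p(\zeta)\ \ge\ c_0,$$ the sum running over all $N$-th roots of unity. Its order at infinity is $$\operatorname{ord}(\vartheta_p,x)=\frac1{4\pi^2}\sum_{n\in\mathbb Z,\,n\ne0}\frac{p(e^{2\pi ixn})}{n^2}.$$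
   Context: Let $\eta(\tau)=q^{1/24}\prod_{n\ge1}(1-q^n)$, $\vartheta(\tau,z)=\sum_{r\in\mathbb Z}\left(\frac{-4}{r}\right)q^{r^2/8}\zeta^{r/2}$, $q=e^{2\pi i\tau}$, $\zeta=e^{2\pi iz}$, $\vartheta_a(\tau,z)=\vartheta(\tau,az)$. Theta quotients are functions $\eta^n\vartheta_{a_1}\cdots\vartheta_{a_r}/(\vartheta_{b_1}\cdots\vartheta_{b_s})$ with $n\in\mathbb Z$, nonzero integers $a_j,b_j$; they form a group $\mathrm{TQ}$. $\varepsilon^h$ denotes the multiplier system of $\eta^h$; $\vartheta_a$ has weight $\frac12$, index $\frac{a^2}2$ and character $\varepsilon^3$, $\eta$ has weight $\frac12$, index $0$, character $\varepsilon$, and weights, indices and characters are additive under multiplication. With $B(x)=\min_{k\in\mathbb Z}\frac12(x-\frac12+k)^2$, the order at infinity of $\eta^n\prod\vartheta_{a_i}/\prod\vartheta_{b_j}$ is $\sum_iB(a_ix)-\sum_jB(b_jx)+\frac n{24}$.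
   Formalization: Since ϑ_{-a} = −ϑ_a, TQ contains −1 = ϑ_{-1}/ϑ_1, which is no ϑ_p; the isomorphism is therefore stated onto the theta quotients with positive indices a_j, b_j, and also onto TQ (all nonzero indices) modulo {1, −1}. *)

theory Defs
  imports
    "HOL-Analysis.Analysis"
    "HOL-Computational_Algebra.Polynomial"
    "HOL-Library.Complex_Order"
    "HOL-Algebra.Coset"
begin

abbreviation cexp2pi :: "complex \<Rightarrow> complex" where
  "cexp2pi w \<equiv> exp (2 * of_real pi * \<i> * w)"

definition upper_half :: "complex set" where
  "upper_half = {\<tau>. Im \<tau> > 0}"

definition HC :: "(complex \<times> complex) set" where
  "HC = upper_half \<times> UNIV"


section \<open>Meromorphic functions of two complex variables\<close>

text \<open>
  Holomorphy in two variables is complex differentiability: the real Frechet derivative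
  exists and is complex linear.
\<close>

definition holomorphic2_on ::
    "(complex \<times> complex \<Rightarrow> complex) \<Rightarrow> (complex \<times> complex) set \<Rightarrow> bool" where
  "holomorphic2_on f S \<longleftrightarrow>
     (\<forall>w\<in>S. \<exists>a b. (f has_derivative (\<lambda>(u, v). a * u + b * v)) (at w within S))"

text \<open>
  A meromorphic function on \<open>HC\<close> is represented by a total function: its holomorphic
  value wherever it is holomorphic (removable singularities being removed), and \<open>0\<close> on the
  remaining polar set and outside \<open>HC\<close>. \<open>mero_nf f\<close> is this representative for
  a function \<open>f\<close> that is only significant on an open dense set, such as a pointwise
  quotient with Isabelle's \<open>x / 0 = 0\<close>. With this convention two meromorphic functions are
  equal iff their representatives are, and a meromorphic function is holomorphic on \<open>HC\<close> iff
  its representative is.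
\<close>

definition regular_value ::
    "(complex \<times> complex \<Rightarrow> complex) \<Rightarrow> complex \<times> complex \<Rightarrow> complex \<Rightarrow> bool" where
  "regular_value f w v \<longleftrightarrow>
     (\<exists>U V g. open U \<and> w \<in> U \<and> U \<subseteq> HC \<and> holomorphic2_on g U \<and> g w = v \<and>
        open V \<and> V \<subseteq> U \<and> U \<subseteq> closure V \<and> (\<forall>y\<in>V. f y = g y))"

definition mero_nf ::
    "(complex \<times> complex \<Rightarrow> complex) \<Rightarrow> complex \<times> complex \<Rightarrow> complex" where
  "mero_nf f w = (if \<exists>v. regular_value f w v then THE v. regular_value f w v else 0)"

text \<open>Locally a quotient of holomorphic functions, the denominator vanishing on no open set.\<close>

definition meromorphic_HC :: "(complex \<times> complex \<Rightarrow> complex) \<Rightarrow> bool" where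
  "meromorphic_HC F \<longleftrightarrow> mero_nf F = F \<and>
     (\<forall>w\<in>HC. \<exists>U g h. open U \<and> w \<in> U \<and> U \<subseteq> HC \<and>
        holomorphic2_on g U \<and> holomorphic2_on h U \<and>
        U \<subseteq> closure {y\<in>U. h y \<noteq> 0} \<and>
        (\<forall>y\<in>U. h y \<noteq> 0 \<longrightarrow> F y = g y / h y))"


section \<open>The functions eta and theta, and theta quotients\<close>

definition eta :: "complex \<Rightarrow> complex" where
  "eta \<tau> = cexp2pi (\<tau> / 24) * (\<Prod>n. 1 - cexp2pi \<tau> ^ Suc n)"

text \<open>The Kronecker symbol (-4/r).\<close>

definition kronecker_m4 :: "int \<Rightarrow> int" where
  "kronecker_m4 r = (if r mod 4 = 1 then 1 else if r mod 4 = 3 then -1 else 0)"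

definition theta :: "complex \<Rightarrow> complex \<Rightarrow> complex" where
  "theta \<tau> z = (\<Sum>\<^sub>\<infinity>r::int. of_int (kronecker_m4 r) *
                  cexp2pi (\<tau> * of_int (r\<^sup>2) / 8) * cexp2pi (z * of_int r / 2))"

definition theta_a :: "int \<Rightarrow> complex \<Rightarrow> complex \<Rightarrow> complex" where
  "theta_a a \<tau> z = theta \<tau> (of_int a * z)"

definition theta_quotient ::
    "int \<Rightarrow> int list \<Rightarrow> int list \<Rightarrow> complex \<times> complex \<Rightarrow> complex" where
  "theta_quotient n as bs = mero_nf (\<lambda>(\<tau>, z).
     eta \<tau> powi n * (\<Prod>a\<leftarrow>as. theta_a a \<tau> z) / (\<Prod>b\<leftarrow>bs. theta_a b \<tau> z))"

text \<open>
  The multiplicative group of theta quotients with all indices \<open>a\<^sub>i\<close>, \<open>b\<^sub>j\<close> in \<open>A\<close>. Since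
  \<open>theta_a (-a) = - theta_a a\<close>, the group \<open>TQ (- {0})\<close> contains the constant
  \<open>-1\<close>, whereas \<open>TQ {0<..}\<close> does not.
\<close>

definition TQ :: "int set \<Rightarrow> (complex \<times> complex \<Rightarrow> complex) monoid" where
  "TQ A = \<lparr> carrier = {theta_quotient n as bs | n as bs. set as \<subseteq> A \<and> set bs \<subseteq> A},
            mult = (\<lambda>F G. mero_nf (\<lambda>w. F w * G w)),
            one = mero_nf (\<lambda>_. 1) \<rparr>"

definition signs :: "(complex \<times> complex \<Rightarrow> complex) set" where
  "signs = {mero_nf (\<lambda>_. 1), mero_nf (\<lambda>_. -1)}"

text \<open>The additive group of polynomials with constant term in (1/2)Z and all other
  coefficients in Z.\<close>

definition half_int_poly_group :: "real poly monoid" where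
  "half_int_poly_group =
     \<lparr> carrier = {p. 2 * coeff p 0 \<in> \<int> \<and> (\<forall>l\<ge>1. coeff p l \<in> \<int>)}, mult = (+), one = 0 \<rparr>"

text \<open>On the carrier of \<open>half_int_poly_group\<close> the floors below are exact.\<close>

definition theta_poly :: "real poly \<Rightarrow> complex \<times> complex \<Rightarrow> complex" where
  "theta_poly p = mero_nf (\<lambda>(\<tau>, z).
     eta \<tau> powi \<lfloor>2 * coeff p 0\<rfloor> *
     (\<Prod>l=1..degree p. (theta_a (int l) \<tau> z / eta \<tau>) powi \<lfloor>coeff p l\<rfloor>))"


section \<open>Meromorphic Jacobi forms\<close>

text \<open>
  The multiplier system of eta, with the principal branch of the square root. Below,
  \<open>(c\<tau> + d) powr k\<close> for half-integral \<open>k\<close> is the \<open>2k\<close>-th power of that same square root.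
\<close>

definition eta_mult :: "int \<Rightarrow> int \<Rightarrow> int \<Rightarrow> int \<Rightarrow> complex" where
  "eta_mult a b c d = (THE v. \<forall>\<tau>\<in>upper_half.
     eta ((of_int a * \<tau> + of_int b) / (of_int c * \<tau> + of_int d)) =
       v * csqrt (of_int c * \<tau> + of_int d) * eta \<tau>)"

abbreviation at_i_inf :: "complex filter" where
  "at_i_inf \<equiv> filtercomap Im at_top"

text \<open>
  Weight \<open>k\<close> and index \<open>m\<close> are half-integral, \<open>h\<close> is the exponent of the
  character \<open>eta_mult\<^sup>h\<close>. In the law for lattice translations,
  \<open>cexp2pi (m (\<lambda> + \<mu>))\<close> is the sign \<open>(-1)\<close> to the power \<open>2m(\<lambda> + \<mu>)\<close>. The last clause says that
  \<open>F\<close> has at most a pole at infinity; the countable set of \<open>y\<close> is there because a line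
  \<open>z = x\<tau> + y\<close> may meet the polar set of \<open>F\<close>.
\<close>

definition meromorphic_jacobi_form ::
    "real \<Rightarrow> real \<Rightarrow> int \<Rightarrow> (complex \<times> complex \<Rightarrow> complex) \<Rightarrow> bool" where
  "meromorphic_jacobi_form k m h F \<longleftrightarrow>
     2 * k \<in> \<int> \<and> 2 * m \<in> \<int> \<and> meromorphic_HC F \<and>
     (\<forall>a b c d. \<forall>\<tau>\<in>upper_half. \<forall>z. a * d - b * c = 1 \<longrightarrow>
        F ((of_int a * \<tau> + of_int b) / (of_int c * \<tau> + of_int d), z / (of_int c * \<tau> + of_int d)) =
          eta_mult a b c d powi h * (of_int c * \<tau> + of_int d) powr of_real k *
          cexp2pi (of_real m * of_int c * z\<^sup>2 / (of_int c * \<tau> + of_int d)) * F (\<tau>, z)) \<and>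
     (\<forall>l u :: int. \<forall>\<tau>\<in>upper_half. \<forall>z.
        F (\<tau>, z + of_int l * \<tau> + of_int u) =
          cexp2pi (of_real m * of_int (l + u)) *
          cexp2pi (- of_real m * (of_int (l\<^sup>2) * \<tau> + 2 * of_int l * z)) * F (\<tau>, z)) \<and>
     (\<forall>x::real. \<exists>(N::real) Y. countable Y \<and> (\<forall>y. y \<notin> Y \<longrightarrow>
        (\<lambda>\<tau>. F (\<tau>, of_real x * \<tau> + of_real y)) \<in> O[at_i_inf](\<lambda>\<tau>. of_real (exp (N * Im \<tau>)))))"

definition weakly_holomorphic :: "(complex \<times> complex \<Rightarrow> complex) \<Rightarrow> bool" where
  "weakly_holomorphic F \<longleftrightarrow> holomorphic2_on F HC"


section \<open>The order at infinity\<close>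

text \<open>
  The order of \<open>F\<close> (of index \<open>m\<close>) at infinity at \<open>x\<close> is the order in \<open>q\<close> of
  \<open>cexp2pi (m x\<^sup>2 \<tau>) F(\<tau>, x\<tau> + y)\<close> for generic real \<open>y\<close>. For a Fourier series with terms
  \<open>c(n,r) q\<^sup>n \<zeta>\<^sup>r\<close> it is the minimum of \<open>n + r x + m x\<^sup>2\<close> over the terms that occur.
\<close>

definition has_ord_at_infinity ::
    "real \<Rightarrow> (complex \<times> complex \<Rightarrow> complex) \<Rightarrow> real \<Rightarrow> real \<Rightarrow> bool" where
  "has_ord_at_infinity m F x v \<longleftrightarrow> (\<exists>Y. countable Y \<and> (\<forall>y::real. y \<notin> Y \<longrightarrow>
     (\<exists>L. L \<noteq> 0 \<and>
        ((\<lambda>\<tau>. cexp2pi (- of_real v * \<tau>) *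
              (cexp2pi (of_real (m * x\<^sup>2) * \<tau>) * F (\<tau>, of_real x * \<tau> + of_real y)))
           \<longlongrightarrow> L) at_i_inf)))"

definition ord_at_infinity ::
    "real \<Rightarrow> (complex \<times> complex \<Rightarrow> complex) \<Rightarrow> real \<Rightarrow> real" where
  "ord_at_infinity m F x = (THE v. has_ord_at_infinity m F x v)"

definition theta_B :: "real \<Rightarrow> real" where
  "theta_B x = (INF k::int. (x - 1/2 + of_int k)\<^sup>2 / 2)"

end

theory Submission
  imports Defs "HOL-Complex_Analysis.Complex_Analysis"
begin

text \<open>
  The triple product exhibits \<open>theta \<tau> z\<close> as a function whose zeros are simple and lie exactly
  on the lattice generated by \<open>1\<close> and \<open>\<tau>\<close>. By Liouville's theorem it is therefore determined up to a factor depending only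
  on \<open>\<tau>\<close> by its quasi-periods; this gives the transformation law under the modular group with
  factor \<open>eta (\<gamma>\<tau>)\<^sup>3 / ((c\<tau> + d) eta \<tau>\<^sup>3)\<close>, and the heat equation shows that this factor is a
  constant times the square root of \<open>c\<tau> + d\<close>. Taking a cube root on the connected upper half-plane gives
  the law for \<open>eta\<close>.

  Along the points of exact torsion order \<open>N\<close> the quotient of \<open>p = \<Sum> c\<^sub>l t\<^sup>l\<close> vanishes to order
  the sum of the \<open>c\<^sub>l\<close> with \<open>l \<ge> 1\<close> divisible by \<open>N\<close>, which is the mean of \<open>p\<close> over the
  \<open>N\<close>-th roots of unity minus \<open>c\<^sub>0\<close>. These divisors determine the \<open>c\<^sub>l\<close> with \<open>l \<ge> 1\<close>, the
  order at infinity determines \<open>c\<^sub>0\<close>, and neither sees a sign, so the map is injective even modulo \<open>\<plusminus>1\<close>.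
  The formula for the order at infinity is the Fourier series of the second Bernoulli polynomial.
\<close>


section \<open>Complex differentiability in two variables\<close>

text \<open>All objects are total functions of (\<tau>, z), so every law must also hold at poles,
  where the representative is 0 by convention. Two devices handle this. Algebraic identities are
  checked only off the zeros of finitely many theta factors; that set is open and dense, and normal
  forms do not see the rest. Transformation laws, on the other hand, hold for the raw product at
  every point, and a biholomorphic change of variables with a nonvanishing factor sends regular
  points to regular points and poles to poles.

  The triple product is obtained from the finite q-binomial theorem by dominated convergence. Joint
  holomorphy of the infinite products, on which the local analysis along torsion points rests, is
  reduced to one variable at a time by Osgood's lemma.

  The cube in the law for \<open>eta\<close> arises because the derivative of theta at z = 0 is 2 pi
  i eta^3. The Bernoulli Fourier series is an Abel limit: differentiated term by term it need not
  converge absolutely on the unit circle, but inside the disc it is the imaginary part of a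
  logarithm.\<close>

definition cdiff2 :: "(complex \<times> complex \<Rightarrow> complex) \<Rightarrow> complex \<times> complex \<Rightarrow> bool" where
  "cdiff2 f w \<longleftrightarrow> (\<exists>a b. (f has_derivative (\<lambda>p. a * fst p + b * snd p)) (at w))"

lemma cdiff2I: "(f has_derivative (\<lambda>p. a * fst p + b * snd p)) (at w) \<Longrightarrow> cdiff2 f w"
  unfolding cdiff2_def by blast

lemma holomorphic2_on_open:
  assumes "open S"
  shows "holomorphic2_on f S \<longleftrightarrow> (\<forall>w\<in>S. cdiff2 f w)"
  unfolding holomorphic2_on_def cdiff2_def case_prod_unfold
  by (intro ball_cong refl) (simp only: at_within_open[OF _ assms])

lemma cdiff2_const [simp]: "cdiff2 (\<lambda>w. c) w"
  unfolding cdiff2_def by (rule exI[of _ 0], rule exI[of _ 0]) simp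

lemma cdiff2_fst [simp]: "cdiff2 (\<lambda>w. fst w) w"
  unfolding cdiff2_def
  by (rule exI[of _ 1], rule exI[of _ 0]) (auto intro!: derivative_eq_intros)

lemma cdiff2_snd [simp]: "cdiff2 (\<lambda>w. snd w) w"
  unfolding cdiff2_def
  by (rule exI[of _ 0], rule exI[of _ 1]) (auto intro!: derivative_eq_intros)

text \<open>The chain rule preserves complex linear differentials. Sums, products and all
  substitutions into \<open>q_poch\<close>, \<open>theta\<close> and \<open>theta_cof\<close> are
  instances.\<close>

lemma cdiff2_compose2:
  assumes "cdiff2 f w" "cdiff2 g w" "cdiff2 h (f w, g w)"
  shows "cdiff2 (\<lambda>w. h (f w, g w)) w"
proof -
  obtain a b where f: "(f has_derivative (\<lambda>p. a * fst p + b * snd p)) (at w)"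
    using assms by (auto simp: cdiff2_def)
  obtain c d where g: "(g has_derivative (\<lambda>p. c * fst p + d * snd p)) (at w)"
    using assms by (auto simp: cdiff2_def)
  obtain e k where h: "(h has_derivative (\<lambda>p. e * fst p + k * snd p)) (at (f w, g w))"
    using assms by (auto simp: cdiff2_def)
  have "((\<lambda>w. h ((\<lambda>w. (f w, g w)) w)) has_derivative
     (\<lambda>p. (\<lambda>p. e * fst p + k * snd p) (a * fst p + b * snd p, c * fst p + d * snd p))) (at w)"
    using has_derivative_compose[OF has_derivative_Pair[OF f g] h] by simp
  also have "(\<lambda>p. (\<lambda>p. e * fst p + k * snd p) (a * fst p + b * snd p, c * fst p + d * snd p)) =
    (\<lambda>p. (e * a + k * c) * fst p + (e * b + k * d) * snd p)"
    by (auto simp: algebra_simps)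
  finally show ?thesis by (rule cdiff2I)
qed

lemma cdiff2_compose1:
  assumes "cdiff2 f w" "g field_differentiable at (f w)"
  shows "cdiff2 (\<lambda>w. g (f w)) w"
proof -
  obtain a b where f: "(f has_derivative (\<lambda>p. a * fst p + b * snd p)) (at w)"
    using assms by (auto simp: cdiff2_def)
  obtain c where g: "(g has_derivative (*) c) (at (f w))"
    using assms by (auto simp: field_differentiable_def has_field_derivative_def)
  have "((\<lambda>w. g (f w)) has_derivative (\<lambda>p. c * (a * fst p + b * snd p))) (at w)"
    using has_derivative_compose[OF f g] .
  also have "(\<lambda>p. c * (a * fst p + b * snd p)) = (\<lambda>p. (c * a) * fst p + (c * b) * snd p)"
    by (auto simp: algebra_simps)
  finally show ?thesis by (rule cdiff2I)
qed

lemma cdiff2_add: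
  assumes "cdiff2 f w" "cdiff2 g w"
  shows "cdiff2 (\<lambda>w. f w + g w) w"
proof -
  have "cdiff2 (\<lambda>p. fst p + snd p) (f w, g w)"
    by (rule cdiff2I[of _ 1 1]) (auto intro!: derivative_eq_intros)
  from cdiff2_compose2[OF assms this] show ?thesis by simp
qed

lemma cdiff2_mult:
  assumes "cdiff2 f w" "cdiff2 g w"
  shows "cdiff2 (\<lambda>w. f w * g w) w"
proof -
  have "cdiff2 (\<lambda>p. fst p * snd p) (f w, g w)"
    unfolding cdiff2_def
    by (rule exI[of _ "g w"], rule exI[of _ "f w"])
       (auto intro!: derivative_eq_intros simp: algebra_simps)
  from cdiff2_compose2[OF assms this] show ?thesis by simp
qed

lemma cdiff2_uminus: "cdiff2 f w \<Longrightarrow> cdiff2 (\<lambda>w. - f w) w"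
  by (rule cdiff2_compose1[of f w uminus]) (auto intro!: derivative_intros)

lemma cdiff2_diff: "cdiff2 f w \<Longrightarrow> cdiff2 g w \<Longrightarrow> cdiff2 (\<lambda>w. f w - g w) w"
  using cdiff2_add[of f w "\<lambda>w. - g w"] cdiff2_uminus[of g w] by simp

lemma cdiff2_inverse: "cdiff2 f w \<Longrightarrow> f w \<noteq> 0 \<Longrightarrow> cdiff2 (\<lambda>w. inverse (f w)) w"
  by (rule cdiff2_compose1[of f w inverse]) (auto intro!: derivative_intros)

lemma cdiff2_divide:
  "cdiff2 f w \<Longrightarrow> cdiff2 g w \<Longrightarrow> g w \<noteq> 0 \<Longrightarrow> cdiff2 (\<lambda>w. f w / g w) w"
  unfolding divide_inverse by (intro cdiff2_mult cdiff2_inverse)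

lemma cdiff2_power: "cdiff2 f w \<Longrightarrow> cdiff2 (\<lambda>w. f w ^ n) w"
  by (induction n) (auto intro!: cdiff2_mult)

lemma cdiff2_powi:
  assumes "cdiff2 f w" "n \<ge> 0 \<or> f w \<noteq> 0"
  shows "cdiff2 (\<lambda>w. f w powi n) w"
proof (cases "n \<ge> 0")
  case True
  thus ?thesis using assms by (simp add: power_int_def cdiff2_power)
next
  case False
  hence "cdiff2 (\<lambda>w. inverse (f w) ^ nat (- n)) w"
    using assms by (intro cdiff2_power cdiff2_inverse) auto
  thus ?thesis using False by (simp add: power_int_def)
qed

lemma cdiff2_prod: "(\<And>i. i \<in> A \<Longrightarrow> cdiff2 (f i) w) \<Longrightarrow> cdiff2 (\<lambda>w. \<Prod>i\<in>A. f i w) w"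
  by (induction A rule: infinite_finite_induct) (auto intro!: cdiff2_mult)

lemma cdiff2_exp: "cdiff2 f w \<Longrightarrow> cdiff2 (\<lambda>w. exp (f w)) w"
  by (rule cdiff2_compose1[of f w exp]) (auto intro!: field_differentiable_within_exp)

lemmas cdiff2_intros = cdiff2_const cdiff2_fst cdiff2_snd cdiff2_add cdiff2_mult cdiff2_uminus
  cdiff2_diff cdiff2_divide cdiff2_power cdiff2_powi cdiff2_prod cdiff2_exp

lemma cdiff2_isCont: "cdiff2 f w \<Longrightarrow> isCont f w"
  unfolding cdiff2_def by (elim exE, rule has_derivative_continuous)

lemma cdiff2_transform:
  assumes "cdiff2 f w" "open U" "w \<in> U" "\<And>y. y \<in> U \<Longrightarrow> f y = g y"
  shows "cdiff2 g w"
proof -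
  obtain a b where "(f has_derivative (\<lambda>p. a * fst p + b * snd p)) (at w)"
    using assms(1) by (auto simp: cdiff2_def)
  hence "(g has_derivative (\<lambda>p. a * fst p + b * snd p)) (at w)"
    by (rule has_derivative_transform_within_open[where s = U]) (use assms in auto)
  thus ?thesis by (rule cdiff2I)
qed

lemma cdiff2_slice:
  assumes "(f has_derivative (\<lambda>p. a * fst p + b * snd p)) (at (s, z))"
  shows "((\<lambda>z. f (s, z)) has_field_derivative b) (at z)"
    and "((\<lambda>s. f (s, z)) has_field_derivative a) (at s)"
proof -
  have 1: "((\<lambda>z. (s, z)) has_derivative (\<lambda>v. (0, v))) (at z)"
    by (auto intro!: derivative_eq_intros)
  have 2: "((\<lambda>s. (s, z)) has_derivative (\<lambda>v. (v, 0))) (at s)"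
    by (auto intro!: derivative_eq_intros)
  show "((\<lambda>z. f (s, z)) has_field_derivative b) (at z)"
    using has_derivative_compose[OF 1, of f] assms
    by (force simp: has_field_derivative_def)
  show "((\<lambda>s. f (s, z)) has_field_derivative a) (at s)"
    using has_derivative_compose[OF 2, of f] assms
    by (force simp: has_field_derivative_def)
qed

text \<open>For differentiating \<open>theta\<close> along a curve on which both arguments move, as
  happens when the modular law is differentiated in \<tau>.\<close>

lemma cdiff2_partials:
  assumes "cdiff2 f (s, z)"
  shows "(f has_derivative (\<lambda>p. deriv (\<lambda>s. f (s, z)) s * fst p + deriv (\<lambda>z. f (s, z)) z * snd p))
           (at (s, z))"
proof -
  obtain a b where ab: "(f has_derivative (\<lambda>p. a * fst p + b * snd p)) (at (s, z))"
    using assms by (auto simp: cdiff2_def)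
  from cdiff2_slice[OF this] have "deriv (\<lambda>s. f (s, z)) s = a" "deriv (\<lambda>z. f (s, z)) z = b"
    by (auto intro: DERIV_imp_deriv)
  thus ?thesis using ab by simp
qed

lemma cdiff2_field_differentiable:
  assumes "cdiff2 f (s, z)"
  shows "(\<lambda>z. f (s, z)) field_differentiable at z" "(\<lambda>s. f (s, z)) field_differentiable at s"
proof -
  obtain a b where ab: "(f has_derivative (\<lambda>p. a * fst p + b * snd p)) (at (s, z))"
    using assms by (auto simp: cdiff2_def)
  from cdiff2_slice[OF this]
  show "(\<lambda>z. f (s, z)) field_differentiable at z" "(\<lambda>s. f (s, z)) field_differentiable at s"
    unfolding field_differentiable_def by blast+
qed

text \<open>Osgood's lemma. By Cauchy's inequality the partial derivative in the second variable is
  continuous, so the total derivative exists.\<close>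

lemma osgood:
  assumes S: "open S" and cont: "continuous_on S f"
    and h1: "\<And>s z. (s, z) \<in> S \<Longrightarrow> (\<lambda>s. f (s, z)) field_differentiable at s"
    and h2: "\<And>s z. (s, z) \<in> S \<Longrightarrow> (\<lambda>z. f (s, z)) field_differentiable at z"
    and w: "(s0, z0) \<in> S"
  shows "cdiff2 f (s0, z0)"
proof -
  obtain r where r: "r > 0" "cball s0 r \<times> cball z0 r \<subseteq> S"
  proof -
    obtain A B where AB: "open A" "open B" "(s0, z0) \<in> A \<times> B" "A \<times> B \<subseteq> S"
      using open_prod_elim[OF S w] by metis
    obtain e1 where e1: "e1 > 0" "cball s0 e1 \<subseteq> A"
      using AB open_contains_cball by blast
    obtain e2 where e2: "e2 > 0" "cball z0 e2 \<subseteq> B"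
      using AB open_contains_cball by blast
    have "cball s0 (min e1 e2) \<times> cball z0 (min e1 e2) \<subseteq> S"
      using e1 e2 AB(4) by fastforce
    thus ?thesis using that[of "min e1 e2"] e1 e2 by auto
  qed
  define K where "K = cball s0 r \<times> cball z0 r"
  have K: "compact K" "K \<subseteq> S" using r by (auto simp: K_def compact_Times)
  have uc: "uniformly_continuous_on K f"
    using K cont compact_uniformly_continuous continuous_on_subset by blast
  define D where "D = (\<lambda>s z. deriv (\<lambda>z. f (s, z)) z)"
  have hol: "(\<lambda>z. f (s, z)) holomorphic_on cball z0 r" if "s \<in> cball s0 r" for s
    unfolding holomorphic_on_def using h2 r that
    by (meson field_differentiable_at_within mem_Sigma_iff subsetD)
  \<comment> \<open>Cauchy's inequality for the difference of two slices on the disc of radius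
    \<open>r / 2\<close> around \<open>z\<close>: a bound \<open>e * r / 2\<close> there gives the
    bound \<open>e\<close> for the derivatives.\<close>
  have D_diff: "dist (D s z) (D s0 z) \<le> e"
    if e: "e > 0" and d: "\<forall>x\<in>K. \<forall>x'\<in>K. dist x' x < d \<longrightarrow> dist (f x') (f x) < e * r / 2"
      and s: "s \<in> cball s0 r" "dist s s0 < d" and z: "z \<in> ball z0 (r / 2)" for e d s z
  proof -
    have sub: "cball z (r/2) \<subseteq> cball z0 r"
    proof
      fix x assume "x \<in> cball z (r/2)"
      thus "x \<in> cball z0 r"
        using z dist_triangle[of z0 x z] by auto
    qed
    have hs: "(\<lambda>z. f (s, z)) holomorphic_on cball z (r/2)" "(\<lambda>z. f (s0, z)) holomorphic_on cball z (r/2)"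
      using hol[OF s(1)] hol[of s0] r(1) sub holomorphic_on_subset by fastforce+
    have "norm ((deriv ^^ 1) (\<lambda>z. f (s, z) - f (s0, z)) z) \<le> fact 1 * (e * r / 2) / (r/2) ^ 1"
    proof (rule Cauchy_inequality)
      show "(\<lambda>z. f (s, z) - f (s0, z)) holomorphic_on ball z (r/2)"
        using hs by (intro holomorphic_on_diff) (auto intro: holomorphic_on_subset)
      show "continuous_on (cball z (r/2)) (\<lambda>z. f (s, z) - f (s0, z))"
        using hs by (intro continuous_on_diff holomorphic_on_imp_continuous_on)
      show "r/2 > 0" using r by simp
      fix x assume "norm (z - x) = r/2"
      hence x: "x \<in> cball z0 r" using sub by (auto simp: dist_norm)
      have "(s, x) \<in> K" "(s0, x) \<in> K" using x s r(1) by (auto simp: K_def)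
      moreover have "dist (s, x) (s0, x) < d" using s by (simp add: dist_Pair_Pair)
      ultimately have "dist (f (s, x)) (f (s0, x)) < e * r / 2" using d by blast
      thus "norm (f (s, x) - f (s0, x)) \<le> e * r / 2" by (simp add: dist_norm)
    qed
    moreover have "deriv (\<lambda>z. f (s, z) - f (s0, z)) z = D s z - D s0 z"
    proof -
      have "(s, z) \<in> S" "(s0, z) \<in> S" using sub z r s by auto
      thus ?thesis unfolding D_def by (intro deriv_diff h2)
    qed
    ultimately show ?thesis using r e by (simp add: dist_norm)
  qed
  define X Y where "X = ball s0 r" and "Y = ball z0 (r/2)"
  have cont0: "continuous (at z0) (\<lambda>z. D s0 z)"
  proof -
    have "(\<lambda>z. f (s0, z)) holomorphic_on ball z0 r"
      using hol[of s0] r(1) holomorphic_on_subset by fastforce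
    hence "deriv (\<lambda>z. f (s0, z)) holomorphic_on ball z0 r" by (intro holomorphic_deriv) auto
    hence "continuous_on (ball z0 r) (\<lambda>z. D s0 z)"
      unfolding D_def by (rule holomorphic_on_imp_continuous_on)
    thus ?thesis using r(1) by (simp add: continuous_on_eq_continuous_at)
  qed
  have contD: "continuous (at (s0, z0) within X \<times> Y) (\<lambda>(s, z). D s z)"
    unfolding continuous_within_eps_delta
  proof safe
    fix e :: real assume e: "e > 0"
    obtain d1 where d1: "d1 > 0" "\<forall>x\<in>K. \<forall>x'\<in>K. dist x' x < d1 \<longrightarrow> dist (f x') (f x) < (e/2) * r / 2"
      using uc e r(1) unfolding uniformly_continuous_on_def
      by (metis half_gt_zero mult_pos_pos)
    obtain d2 where d2: "d2 > 0" "\<And>z. dist z z0 < d2 \<Longrightarrow> dist (D s0 z) (D s0 z0) < e/2"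
      using cont0 e unfolding continuous_at_eps_delta by (metis half_gt_zero)
    show "\<exists>d>0. \<forall>x'\<in>X \<times> Y. dist x' (s0, z0) < d \<longrightarrow> dist (case x' of (s, z) \<Rightarrow> D s z) (D s0 z0) < e"
    proof (intro exI[of _ "min d1 d2"] conjI ballI impI)
      fix x' assume x': "x' \<in> X \<times> Y" "dist x' (s0, z0) < min d1 d2"
      obtain s z where sz: "x' = (s, z)" by force
      have "dist s s0 < d1" "dist z z0 < d2"
        using x' dist_fst_le[of x' "(s0, z0)"] dist_snd_le[of x' "(s0, z0)"] sz by auto
      hence "dist (D s z) (D s0 z) \<le> e/2" "dist (D s0 z) (D s0 z0) < e/2"
        using D_diff[of "e/2" d1 s z] d1 d2 e x'(1) sz by (auto simp: X_def Y_def)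
      thus "dist (case x' of (s, z) \<Rightarrow> D s z) (D s0 z0) < e"
        using dist_triangle[of "D s z" "D s0 z0" "D s0 z"] sz by simp
    qed (use d1 d2 in auto)
  qed
  obtain a where a: "((\<lambda>s. f (s, z0)) has_field_derivative a) (at s0)"
    using h1[OF w] by (auto simp: field_differentiable_def)
  \<comment> \<open>Only the partial derivative in the second variable has to be jointly continuous;
    in the first variable differentiability along \<open>z0\<close> is enough.\<close>
  have "((\<lambda>(x, y). f (x, y)) has_derivative
     (\<lambda>(tx, ty). a * tx + blinfun_apply (blinfun_mult_right (D s0 z0)) ty)) (at (s0, z0) within X \<times> Y)"
  proof (rule has_derivative_partialsI)
    show "((\<lambda>x. f (x, z0)) has_derivative (*) a) (at s0 within X)"
      using a by (simp add: has_field_derivative_def has_derivative_at_withinI)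
    show "((\<lambda>y. f (x, y)) has_derivative blinfun_apply (blinfun_mult_right (D x y))) (at y within Y)"
      if "x \<in> X" "y \<in> Y" for x y
    proof -
      have "(x, y) \<in> S" using that r by (auto simp: X_def Y_def)
      hence "((\<lambda>y. f (x, y)) has_field_derivative D x y) (at y)"
        using h2 by (simp add: D_def field_differentiable_derivI)
      thus ?thesis
        by (simp add: has_field_derivative_def has_derivative_at_withinI)
    qed
    have "((\<lambda>p. blinfun_mult_right (D (fst p) (snd p))) \<longlongrightarrow> blinfun_mult_right (D s0 z0)) (at (s0, z0) within X \<times> Y)"
      using contD unfolding continuous_within case_prod_unfold fst_conv snd_conv
      by (rule bounded_linear.tendsto[OF bounded_linear_blinfun_mult_right])
    thus "continuous (at (s0, z0) within X \<times> Y) (\<lambda>(x, y). blinfun_mult_right (D x y))"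
      by (simp add: continuous_within case_prod_unfold)
  qed (use r in \<open>auto simp: Y_def\<close>)
  moreover have "at (s0, z0) within X \<times> Y = at (s0, z0)"
    using r by (intro at_within_open) (auto simp: X_def Y_def open_Times)
  ultimately show ?thesis
    unfolding cdiff2_def
    by (intro exI[of _ a] exI[of _ "D s0 z0"]) (simp add: case_prod_unfold)
qed

text \<open>Locally uniform convergence makes the limit continuous and, by Weierstrass in each
  variable separately, its slices holomorphic; this is what Osgood's lemma asks for.\<close>

lemma cdiff2_uniform_limit:
  assumes S: "open S"
    and f: "\<And>n w. w \<in> S \<Longrightarrow> cdiff2 (f n) w"
    and lim: "\<And>w. w \<in> S \<Longrightarrow> \<exists>e>0. ball w e \<subseteq> S \<and> uniform_limit (ball w e) f g F"
    and F: "F \<noteq> bot" and w: "w \<in> S"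
  shows "cdiff2 g w"
proof -
  have contf: "continuous_on S (f n)" for n
    using f cdiff2_isCont continuous_at_imp_continuous_on by blast
  have cont: "continuous_on S g"
    unfolding continuous_on_eq_continuous_at[OF S]
  proof
    fix w assume "w \<in> S"
    then obtain e where e: "e > 0" "ball w e \<subseteq> S" "uniform_limit (ball w e) f g F" using lim by blast
    have "continuous_on (ball w e) g"
      using contf e(2) by (intro uniform_limit_theorem[OF _ e(3) F] always_eventually allI)
        (rule continuous_on_subset)
    thus "isCont g w" using e by (simp add: continuous_on_eq_continuous_at)
  qed
  have sl: "\<exists>e>0. (\<forall>x\<in>cball z e. (s, x) \<in> S) \<and> uniform_limit (cball z e) (\<lambda>n z. f n (s, z)) (\<lambda>z. g (s, z)) F \<and>
       (\<forall>x\<in>cball s e. (x, z) \<in> S) \<and> uniform_limit (cball s e) (\<lambda>n s. f n (s, z)) (\<lambda>s. g (s, z)) F"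
    if sz: "(s, z) \<in> S" for s z
  proof -
    obtain e where e: "e > 0" "ball (s, z) e \<subseteq> S" "uniform_limit (ball (s, z) e) f g F" using lim sz by blast
    have *: "(s, x) \<in> ball (s, z) e" if "x \<in> cball z (e/2)" for x
      using that e(1) by (auto simp: dist_Pair_Pair)
    have **: "(x, z) \<in> ball (s, z) e" if "x \<in> cball s (e/2)" for x
      using that e(1) by (auto simp: dist_Pair_Pair)
    have "uniform_limit (cball z (e/2)) (\<lambda>n z. f n (s, z)) (\<lambda>z. g (s, z)) F"
      using e(3) * unfolding uniform_limit_iff by (fast elim: eventually_mono)
    moreover have "uniform_limit (cball s (e/2)) (\<lambda>n s. f n (s, z)) (\<lambda>s. g (s, z)) F"
      using e(3) ** unfolding uniform_limit_iff by (fast elim: eventually_mono)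
    ultimately show ?thesis using e * ** by (intro exI[of _ "e/2"]) auto
  qed
  obtain s0 z0 where "w = (s0, z0)" by force
  moreover have "cdiff2 g (s0, z0)" if "(s0, z0) \<in> S"
  proof (rule osgood[OF S cont _ _ that])
    fix s z assume "(s, z) \<in> S"
    from sl[OF this] obtain e where e: "e > 0" "\<forall>x\<in>cball z e. (s, x) \<in> S"
      "uniform_limit (cball z e) (\<lambda>n z. f n (s, z)) (\<lambda>z. g (s, z)) F"
      "\<forall>x\<in>cball s e. (x, z) \<in> S" "uniform_limit (cball s e) (\<lambda>n s. f n (s, z)) (\<lambda>s. g (s, z)) F"
      by blast
    have 1: "(\<lambda>z. f n (s, z)) holomorphic_on cball z e" for n
      unfolding holomorphic_on_def using f e(2) cdiff2_field_differentiable(1)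
      by (blast intro: field_differentiable_at_within)
    have 2: "(\<lambda>s. f n (s, z)) holomorphic_on cball s e" for n
      unfolding holomorphic_on_def using f e(4) cdiff2_field_differentiable(2)
      by (blast intro: field_differentiable_at_within)
    have "\<forall>\<^sub>F n in F. continuous_on (cball s e) (\<lambda>s. f n (s, z)) \<and> (\<lambda>s. f n (s, z)) holomorphic_on ball s e"
      using 2 holomorphic_on_imp_continuous_on holomorphic_on_subset[OF _ ball_subset_cball]
      by (intro always_eventually) blast
    then have "(\<lambda>s. g (s, z)) holomorphic_on ball s e"
      using holomorphic_uniform_limit[OF _ e(5) F] by blast
    thus "(\<lambda>s. g (s, z)) field_differentiable at s"
      using e(1) holomorphic_on_imp_differentiable_at by fastforce
    have "\<forall>\<^sub>F n in F. continuous_on (cball z e) (\<lambda>z. f n (s, z)) \<and> (\<lambda>z. f n (s, z)) holomorphic_on ball z e"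
      using 1 holomorphic_on_imp_continuous_on holomorphic_on_subset[OF _ ball_subset_cball]
      by (intro always_eventually) blast
    then have "(\<lambda>z. g (s, z)) holomorphic_on ball z e"
      using holomorphic_uniform_limit[OF _ e(3) F] by blast
    thus "(\<lambda>z. g (s, z)) field_differentiable at z"
      using e(1) holomorphic_on_imp_differentiable_at by fastforce
  qed
  ultimately show ?thesis using w by blast
qed


section \<open>Normal forms of meromorphic functions\<close>

lemma open_HC: "open HC"
proof -
  have "open {w :: complex \<times> complex. 0 < Im (fst w)}"
    by (intro open_Collect_less continuous_intros)
  moreover have "HC = {w. 0 < Im (fst w)}" by (auto simp: HC_def upper_half_def)
  ultimately show ?thesis by simp
qed

lemma HC_iff: "(\<tau>, z) \<in> HC \<longleftrightarrow> Im \<tau> > 0"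
  by (auto simp: HC_def upper_half_def)

definition dense_open_HC :: "(complex \<times> complex) set \<Rightarrow> bool" where
  "dense_open_HC V \<longleftrightarrow> open V \<and> V \<subseteq> HC \<and> HC \<subseteq> closure V"

lemma dense_Int_open:
  assumes "open V" "open U" "U \<subseteq> closure V"
  shows "U \<subseteq> closure (V \<inter> U)"
  using assms open_Int_closure_subset[of U V] by (auto simp: Int_commute)

lemma cont_eq_on_closure:
  fixes f g :: "'a::topological_space \<Rightarrow> 'b::t2_space"
  assumes "open U" "continuous_on U f" "continuous_on U g" "U \<subseteq> closure V"
    "\<And>y. y \<in> V \<inter> U \<Longrightarrow> f y = g y" "w \<in> U"
  shows "f w = g w"
proof (rule ccontr)
  assume ne: "f w \<noteq> g w"
  obtain A B where AB: "open A" "open B" "f w \<in> A" "g w \<in> B" "A \<inter> B = {}"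
    using hausdorff[OF ne] by auto
  have "open (f -` A \<inter> U)" "open (g -` B \<inter> U)"
    using AB(1,2) assms(2,3) continuous_on_open_vimage[OF assms(1)] by blast+
  hence "open (U \<inter> f -` A \<inter> (U \<inter> g -` B))"
    by (simp add: Int_commute open_Int)
  from open_Int_closure_eq_empty[OF this, of V]
  obtain y where "y \<in> V" "y \<in> U \<inter> f -` A \<inter> (U \<inter> g -` B)"
    using AB assms by auto
  thus False using AB assms(5)[of y] by auto
qed

text \<open>Two local extensions agree on the intersection of their dense parts. Because both parts
  are open, the intersection is still dense near \<open>w\<close>, and continuity does the
  rest.\<close>

lemma regular_value_unique:
  assumes "regular_value f w v" "regular_value f w v'"
  shows "v = v'"
proof -
  obtain U V g where 1: "open U" "w \<in> U" "U \<subseteq> HC" "holomorphic2_on g U" "g w = v"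
      "open V" "V \<subseteq> U" "U \<subseteq> closure V" "\<forall>y\<in>V. f y = g y"
    using assms(1) unfolding regular_value_def by blast
  obtain U' V' g' where 2: "open U'" "w \<in> U'" "U' \<subseteq> HC" "holomorphic2_on g' U'" "g' w = v'"
      "open V'" "V' \<subseteq> U'" "U' \<subseteq> closure V'" "\<forall>y\<in>V'. f y = g' y"
    using assms(2) unfolding regular_value_def by blast
  have c: "continuous_on U g" "continuous_on U' g'"
    using 1(4) 2(4) unfolding holomorphic2_on_open[OF 1(1)] holomorphic2_on_open[OF 2(1)]
    by (auto intro!: continuous_at_imp_continuous_on cdiff2_isCont)
  have "U \<inter> U' \<subseteq> closure (V \<inter> V')"
  proof -
    have "V \<inter> U' \<subseteq> closure (V' \<inter> (V \<inter> U'))"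
      using 1 2 by (intro dense_Int_open) auto
    also have "V' \<inter> (V \<inter> U') = V \<inter> V'" using 2 by auto
    finally have "closure (V \<inter> U') \<subseteq> closure (V \<inter> V')" by (simp add: closure_minimal)
    moreover have "U \<inter> U' \<subseteq> closure (V \<inter> (U \<inter> U'))"
      using 1 2 by (intro dense_Int_open) auto
    moreover have "V \<inter> (U \<inter> U') = V \<inter> U'" using 1 by auto
    ultimately show ?thesis by auto
  qed
  have "g w = g' w"
  proof (rule cont_eq_on_closure[of "U \<inter> U'" g g' "V \<inter> V'"])
    show "open (U \<inter> U')" using 1(1) 2(1) by (rule open_Int)
    show "continuous_on (U \<inter> U') g" "continuous_on (U \<inter> U') g'"
      using c by (auto intro: continuous_on_subset)
    show "U \<inter> U' \<subseteq> closure (V \<inter> V')" by fact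
    show "w \<in> U \<inter> U'" using 1(2) 2(2) by simp
    fix y assume "y \<in> V \<inter> V' \<inter> (U \<inter> U')"
    thus "g y = g' y" using 1(9) 2(9) by (metis IntD1 IntD2)
  qed
  thus ?thesis using 1(5) 2(5) by simp
qed

lemma mero_nf_eqI: "regular_value f w v \<Longrightarrow> mero_nf f w = v"
  unfolding mero_nf_def by (metis regular_value_unique theI)

text \<open>The way to evaluate at a removable singularity: \<open>g\<close> extends
  \<open>f\<close> holomorphically from the dense part \<open>V\<close> of \<open>U\<close>.\<close>

lemma mero_nf_regular:
  assumes "open U" "U \<subseteq> HC" "w \<in> U" "\<And>y. y \<in> U \<Longrightarrow> cdiff2 g y"
    "open V" "V \<subseteq> U" "U \<subseteq> closure V" "\<And>y. y \<in> V \<Longrightarrow> f y = g y"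
  shows "mero_nf f w = g w"
proof (rule mero_nf_eqI)
  have h: "holomorphic2_on g U" using assms(4) by (simp only: holomorphic2_on_open[OF assms(1)]) blast
  show "regular_value f w (g w)"
    unfolding regular_value_def
    by (rule exI[of _ U], rule exI[of _ V], rule exI[of _ g]) (intro conjI ballI assms refl h)
qed

lemma mero_nf_holo:
  assumes "open U" "U \<subseteq> HC" "w \<in> U" "\<And>y. y \<in> U \<Longrightarrow> cdiff2 f y"
  shows "mero_nf f w = f w"
  using assms by (intro mero_nf_regular[of U w f U f]) (auto simp: closure_subset)

lemma mero_nf_cong_regular:
  assumes "dense_open_HC W" "\<And>y. y \<in> W \<Longrightarrow> f y = f' y" "regular_value f w v"
  shows "regular_value f' w v"
proof -
  obtain U V g where 1: "open U" "w \<in> U" "U \<subseteq> HC" "holomorphic2_on g U" "g w = v"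
      "open V" "V \<subseteq> U" "U \<subseteq> closure V" "\<forall>y\<in>V. f y = g y"
    using assms(3) unfolding regular_value_def by blast
  have "V \<subseteq> closure (W \<inter> V)"
    using assms(1) 1 by (intro dense_Int_open) (auto simp: dense_open_HC_def)
  hence "closure V \<subseteq> closure (W \<inter> V)" by (simp add: closure_minimal)
  hence "U \<subseteq> closure (V \<inter> W)" using 1 by (auto simp: Int_commute)
  moreover have "\<forall>y\<in>V \<inter> W. f' y = g y" using 1 assms(2) by auto
  moreover have "open (V \<inter> W)" "V \<inter> W \<subseteq> U" using 1 assms(1) by (auto simp: dense_open_HC_def)
  ultimately show ?thesis unfolding regular_value_def using 1 by blast
qed

text \<open>This is what allows all computations in the group of theta quotients to be carried out
  off the divisors.\<close>

lemma mero_nf_cong: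
  assumes "dense_open_HC W" "\<And>y. y \<in> W \<Longrightarrow> f y = f' y"
  shows "mero_nf f = mero_nf f'"
proof -
  have "regular_value f = regular_value f'"
    using mero_nf_cong_regular[of W f f'] mero_nf_cong_regular[of W f' f] assms by (intro ext) metis
  thus ?thesis by (intro ext) (simp add: mero_nf_def)
qed

lemma mero_nf_dense_eq:
  assumes "dense_open_HC W" "\<And>y. y \<in> W \<Longrightarrow> cdiff2 f y" "w \<in> W"
  shows "mero_nf f w = f w"
  using assms by (intro mero_nf_holo[of W]) (auto simp: dense_open_HC_def)

text \<open>This carries the transformation laws across polar sets.\<close>

lemma regular_value_transport:
  assumes phi: "\<And>w. w \<in> HC \<Longrightarrow> cdiff2 (\<lambda>w. fst (phi w)) w" "\<And>w. w \<in> HC \<Longrightarrow> cdiff2 (\<lambda>w. snd (phi w)) w"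
    "\<And>w. w \<in> HC \<Longrightarrow> phi w \<in> HC"
    and psi: "\<And>w. w \<in> HC \<Longrightarrow> cdiff2 (\<lambda>w. fst (psi w)) w" "\<And>w. w \<in> HC \<Longrightarrow> cdiff2 (\<lambda>w. snd (psi w)) w"
    "\<And>w. w \<in> HC \<Longrightarrow> psi w \<in> HC"
    and inv: "\<And>w. w \<in> HC \<Longrightarrow> phi (psi w) = w" "\<And>w. w \<in> HC \<Longrightarrow> psi (phi w) = w"
    and u: "\<And>w. w \<in> HC \<Longrightarrow> cdiff2 u w"
    and f: "\<And>w. w \<in> HC \<Longrightarrow> f' (phi w) = u w * f w"
    and w: "w \<in> HC" and r: "regular_value f w v"
  shows "regular_value f' (phi w) (u w * v)"
proof -
  obtain U V g where 1: "open U" "w \<in> U" "U \<subseteq> HC" "holomorphic2_on g U" "g w = v"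
      "open V" "V \<subseteq> U" "U \<subseteq> closure V" "\<forall>y\<in>V. f y = g y"
    using r unfolding regular_value_def by blast
  have cpsi: "continuous_on HC psi"
  proof -
    have "continuous_on HC (\<lambda>w. (fst (psi w), snd (psi w)))"
      using psi(1,2) cdiff2_isCont continuous_at_imp_continuous_on by (intro continuous_on_Pair) blast+
    thus ?thesis by simp
  qed
  have cphi: "continuous_on HC phi"
  proof -
    have "continuous_on HC (\<lambda>w. (fst (phi w), snd (phi w)))"
      using phi(1,2) cdiff2_isCont continuous_at_imp_continuous_on by (intro continuous_on_Pair) blast+
    thus ?thesis by simp
  qed
  \<comment> \<open>The image under \<open>phi\<close> is a preimage under the continuous inverse
    \<open>psi\<close>, hence open for open \<open>A\<close>.\<close>
  have im: "phi ` A = HC \<inter> psi -` A" if "A \<subseteq> HC" for A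
  proof
    show "phi ` A \<subseteq> HC \<inter> psi -` A" using that phi inv by auto
    show "HC \<inter> psi -` A \<subseteq> phi ` A"
    proof
      fix y assume "y \<in> HC \<inter> psi -` A"
      thus "y \<in> phi ` A" using inv(1)[of y] by (intro image_eqI[of _ _ "psi y"]) auto
    qed
  qed
  have op: "open (phi ` A)" if "A \<subseteq> HC" "open A" for A
    using im[OF that(1)] continuous_on_open_vimage[OF open_HC, of psi] cpsi that(2)
    by (simp add: Int_commute)
  show ?thesis
    unfolding regular_value_def
  proof (rule exI[of _ "phi ` U"], rule exI[of _ "phi ` V"],
      rule exI[of _ "\<lambda>y. u (psi y) * g (psi y)"], intro conjI)
    show "open (phi ` U)" "open (phi ` V)" using op 1(1,3,6,7) by (meson subset_trans)+
    show "phi w \<in> phi ` U" "phi ` U \<subseteq> HC" "phi ` V \<subseteq> phi ` U" using 1(2,3,7) phi(3) by auto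
    show "phi ` U \<subseteq> closure (phi ` V)"
    proof (rule image_subsetI)
      fix x assume ab: "x \<in> U"
      show "phi x \<in> closure (phi ` V)"
      proof (rule ccontr)
        define A where "A = - closure (phi ` V)"
        assume "phi x \<notin> closure (phi ` V)"
        hence A: "open A" "phi x \<in> A" by (auto simp: A_def)
        have op2: "open (HC \<inter> phi -` A)"
          using cphi continuous_on_open_vimage[OF open_HC, of phi] A by (simp add: Int_commute)
        have "x \<in> closure V" "x \<in> HC \<inter> phi -` A" using ab 1(3,8) A by auto
        with open_Int_closure_eq_empty[OF op2, of V] have "HC \<inter> phi -` A \<inter> V \<noteq> {}"
          by blast
        moreover have "phi ` V \<inter> A = {}" using closure_subset[of "phi ` V"] by (auto simp: A_def)
        ultimately show False by blast
      qed
    qed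
    show "holomorphic2_on (\<lambda>y. u (psi y) * g (psi y)) (phi ` U)"
      unfolding holomorphic2_on_open[OF op[OF 1(3,1)]]
    proof
      fix y assume y: "y \<in> phi ` U"
      hence yH: "y \<in> HC" "psi y \<in> U" using im[OF 1(3)] by auto
      have g: "cdiff2 g (psi y)" using 1(4) yH unfolding holomorphic2_on_open[OF 1(1)] by simp
      have "cdiff2 (\<lambda>y. u (fst (psi y), snd (psi y))) y"
        by (intro cdiff2_compose2 psi(1,2) yH) (use u psi(3) yH in simp)
      moreover have "cdiff2 (\<lambda>y. g (fst (psi y), snd (psi y))) y"
        by (intro cdiff2_compose2 psi(1,2) yH) (use g in simp)
      ultimately show "cdiff2 (\<lambda>y. u (psi y) * g (psi y)) y"
        by (intro cdiff2_mult) simp_all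
    qed
    show "u (psi (phi w)) * g (psi (phi w)) = u w * v" using inv w 1 by simp
    show "\<forall>y\<in>phi ` V. f' y = u (psi y) * g (psi y)"
    proof
      fix y assume "y \<in> phi ` V"
      then obtain x where x: "x \<in> V" "y = phi x" by blast
      hence "x \<in> HC" "f x = g x" using 1(3,7,9) by auto
      thus "f' y = u (psi y) * g (psi y)"
        using inv(2)[of x] f[of x] x by simp
    qed  qed
qed

text \<open>If \<open>w\<close> has no regular value, neither has \<open>phi w\<close>: otherwise
  the inverse map with the inverse factor would carry it back. So both sides are 0 at such
  points.\<close>

lemma mero_nf_transport:
  assumes phi: "\<And>w. w \<in> HC \<Longrightarrow> cdiff2 (\<lambda>w. fst (phi w)) w" "\<And>w. w \<in> HC \<Longrightarrow> cdiff2 (\<lambda>w. snd (phi w)) w"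
    "\<And>w. w \<in> HC \<Longrightarrow> phi w \<in> HC"
    and psi: "\<And>w. w \<in> HC \<Longrightarrow> cdiff2 (\<lambda>w. fst (psi w)) w" "\<And>w. w \<in> HC \<Longrightarrow> cdiff2 (\<lambda>w. snd (psi w)) w"
    "\<And>w. w \<in> HC \<Longrightarrow> psi w \<in> HC"
    and inv: "\<And>w. w \<in> HC \<Longrightarrow> phi (psi w) = w" "\<And>w. w \<in> HC \<Longrightarrow> psi (phi w) = w"
    and u: "\<And>w. w \<in> HC \<Longrightarrow> cdiff2 u w" "\<And>w. w \<in> HC \<Longrightarrow> u w \<noteq> 0"
    and f: "\<And>w. w \<in> HC \<Longrightarrow> f (phi w) = u w * f w"
    and w: "w \<in> HC"
  shows "mero_nf f (phi w) = u w * mero_nf f w"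
proof (cases "\<exists>v. regular_value f w v")
  case True
  then obtain v where v: "regular_value f w v" by blast
  have "regular_value f (phi w) (u w * v)"
    by (rule regular_value_transport[of phi psi u]) (use assms v in auto)
  thus ?thesis using v mero_nf_eqI by metis
next
  case False
  have "\<not> (\<exists>v. regular_value f (phi w) v)"
  proof
    assume "\<exists>v. regular_value f (phi w) v"
    then obtain v where v: "regular_value f (phi w) v" by blast
    have "regular_value f (psi (phi w)) (inverse (u (psi (phi w))) * v)"
    proof (rule regular_value_transport[of psi phi "\<lambda>y. inverse (u (psi y))"])
      show "cdiff2 (\<lambda>y. inverse (u (psi y))) y" if "y \<in> HC" for y
      proof (rule cdiff2_inverse)
        have "cdiff2 (\<lambda>y. u (fst (psi y), snd (psi y))) y"
          by (intro cdiff2_compose2 psi(1,2) that) (use u psi(3) that in simp)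
        thus "cdiff2 (\<lambda>y. u (psi y)) y" by simp
      qed (use u psi that in auto)
      show "f (psi y) = inverse (u (psi y)) * f y" if "y \<in> HC" for y
        using f[of "psi y"] psi(3)[OF that] inv(1)[OF that] u(2)[of "psi y"] by simp
    qed (use assms v in auto)
    thus False using False inv(2)[OF w] by auto
  qed
  thus ?thesis using False by (simp add: mero_nf_def)
qed


section \<open>Infinite q-products and the q-binomial theorem\<close>

text \<open>The infinite q-Pochhammer symbol (a; q)_oo.\<close>

definition q_poch :: "complex \<Rightarrow> complex \<Rightarrow> complex" where
  "q_poch a q = (\<Prod>n. 1 - a * q ^ n)"

lemma q_poch_convergent:
  fixes a q :: complex
  assumes "norm q < 1"
  shows "convergent_prod (\<lambda>n. 1 - a * q ^ n)"
proof -
  have "summable (\<lambda>n. norm a * norm q ^ n)"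
    using assms by (intro summable_mult summable_geometric) simp
  also have "(\<lambda>n. norm a * norm q ^ n) = (\<lambda>n. norm ((1 - a * q ^ n) - 1))"
    by (simp add: norm_mult norm_power)
  finally show ?thesis
    by (intro abs_convergent_prod_imp_convergent_prod summable_imp_abs_convergent_prod)
qed

lemma q_poch_LIMSEQ:
  fixes a q :: complex
  assumes "norm q < 1"
  shows "(\<lambda>n. \<Prod>k<n. 1 - a * q ^ k) \<longlonglongrightarrow> q_poch a q"
  using convergent_prod_LIMSEQ[OF q_poch_convergent[OF assms]]
  unfolding q_poch_def by (simp add: LIMSEQ_lessThan_iff_atMost)

lemma q_poch_0 [simp]: "q_poch 0 q = 1"
  by (simp add: q_poch_def)

lemma q_poch_rec:
  assumes "norm q < 1"
  shows "q_poch a q = (1 - a) * q_poch (a * q) q"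
proof -
  have "(\<lambda>n. (1 - a) * (\<Prod>k<n. 1 - (a * q) * q ^ k)) \<longlonglongrightarrow> (1 - a) * q_poch (a * q) q"
    by (intro tendsto_mult tendsto_const q_poch_LIMSEQ assms)
  also have "(\<lambda>n. (1 - a) * (\<Prod>k<n. 1 - (a * q) * q ^ k)) = (\<lambda>n. \<Prod>k<Suc n. 1 - a * q ^ k)"
    by (subst prod.lessThan_Suc_shift) (simp add: mult_ac)
  finally have "(\<lambda>n. \<Prod>k<n. 1 - a * q ^ k) \<longlonglongrightarrow> (1 - a) * q_poch (a * q) q"
    by (rule LIMSEQ_imp_Suc)
  thus ?thesis using LIMSEQ_unique q_poch_LIMSEQ[OF assms] by blast
qed

text \<open>A convergent infinite product vanishes only through one of its factors.\<close>

lemma q_poch_eq_0_iff: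
  assumes "norm q < 1"
  shows "q_poch a q = 0 \<longleftrightarrow> (\<exists>n. a * q ^ n = 1)"
proof
  assume "q_poch a q = 0"
  thus "\<exists>n. a * q ^ n = 1"
    using prodinf_nonzero[OF q_poch_convergent[OF assms, of a]] unfolding q_poch_def by auto
next
  assume "\<exists>n. a * q ^ n = 1"
  then obtain n where n: "a * q ^ n = 1" by blast
  have "(\<lambda>n. \<Prod>k<n. 1 - a * q ^ k) \<longlonglongrightarrow> 0"
  proof (rule tendsto_eventually)
    show "\<forall>\<^sub>F m in sequentially. (\<Prod>k<m. 1 - a * q ^ k) = 0"
      using eventually_gt_at_top[of n]
      by eventually_elim (use n in \<open>auto intro!: prod_zero bexI[of _ n]\<close>)
  qed
  thus "q_poch a q = 0" using LIMSEQ_unique q_poch_LIMSEQ[OF assms] by blast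
qed

text \<open>The domain includes q = 0: continuity at \<open>(0, 0)\<close> is what later evaluates
  limits at the cusp.\<close>

lemma cdiff2_q_poch:
  assumes "norm (snd w) < 1"
  shows "cdiff2 (\<lambda>w. q_poch (fst w) (snd w)) w"
proof -
  define S where "S = (UNIV :: complex set) \<times> ball (0::complex) 1"
  show ?thesis
  proof (rule cdiff2_uniform_limit)
    show "open S" by (auto simp: S_def intro!: open_Times)
    show "w \<in> S" using assms by (auto simp: S_def mem_Times_iff)
    show "cdiff2 (\<lambda>w. \<Prod>k<n. 1 - fst w * snd w ^ k) w" for n w
      by (intro cdiff2_intros)
    fix w assume w: "w \<in> S"
    \<comment> \<open>Halfway between the modulus of q and 1. On the compact polydisc with radii
      \<open>A\<close> and \<open>r\<close> the factors differ from 1 by at most A r^n.\<close>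
    define r where "r = (1 + norm (snd w)) / 2"
    define A where "A = norm (fst w) + 1"
    define e where "e = min 1 (r - norm (snd w))"
    have r: "norm (snd w) < r" "r < 1" "r > 0" using w
      by (auto simp: r_def S_def mem_Times_iff add_pos_nonneg)
    have e: "e > 0" using r by (auto simp: e_def)
    define K where "K = cball (0::complex) A \<times> cball (0::complex) r"
    have sub: "ball w e \<subseteq> K"
    proof
      fix x assume "x \<in> ball w e"
      hence "dist w x < e" by simp
      hence "dist (fst w) (fst x) < e" "dist (snd w) (snd x) < e"
        using dist_fst_le[of w x] dist_snd_le[of w x] by linarith+
      hence "norm (fst x) \<le> A" "norm (snd x) \<le> r"
        using norm_triangle_ineq[of "fst w" "fst x - fst w"] norm_triangle_ineq[of "snd w" "snd x - snd w"]
        by (auto simp: e_def A_def dist_norm norm_minus_commute)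
      thus "x \<in> K" by (simp add: K_def mem_Times_iff)
    qed
    have "uniformly_convergent_on K (\<lambda>N x. \<Prod>n<N. 1 + (- (fst x * snd x ^ n)))"
    proof (rule uniformly_convergent_on_prod)
      show "compact K" by (simp add: K_def compact_Times)
      show "continuous_on K (\<lambda>x. - (fst x * snd x ^ n))" for n
        by (intro continuous_intros)
      show "uniformly_convergent_on K (\<lambda>N x. \<Sum>n<N. norm (- (fst x * snd x ^ n)))"
      proof (rule Weierstrass_m_test')
        show "summable (\<lambda>n. A * r ^ n)"
          using r by (intro summable_mult summable_geometric) simp
        show "norm (norm (- (fst x * snd x ^ n))) \<le> A * r ^ n" if "x \<in> K" for x n
          using that by (auto simp: K_def A_def norm_mult norm_power add_nonneg_nonneg intro!: mult_mono power_mono)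
      qed
    qed
    then obtain l where l: "uniform_limit K (\<lambda>N x. \<Prod>n<N. 1 - fst x * snd x ^ n) l sequentially"
      unfolding uniformly_convergent_on_def by auto
    have "l x = q_poch (fst x) (snd x)" if "x \<in> K" for x
    proof -
      have "norm (snd x) < 1" using that r by (auto simp: K_def)
      thus ?thesis using tendsto_uniform_limitI[OF l that] q_poch_LIMSEQ LIMSEQ_unique by blast
    qed
    hence "uniform_limit K (\<lambda>N x. \<Prod>n<N. 1 - fst x * snd x ^ n) (\<lambda>x. q_poch (fst x) (snd x)) sequentially"
      using l by (simp cong: uniform_limit_cong')
    hence "uniform_limit (ball w e) (\<lambda>N x. \<Prod>n<N. 1 - fst x * snd x ^ n) (\<lambda>x. q_poch (fst x) (snd x)) sequentially"
      using sub uniform_limit_on_subset by blast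
    moreover have "ball w e \<subseteq> S" using sub r by (force simp: S_def K_def)
    ultimately show "\<exists>e>0. ball w e \<subseteq> S \<and>
      uniform_limit (ball w e) (\<lambda>N x. \<Prod>n<N. 1 - fst x * snd x ^ n) (\<lambda>x. q_poch (fst x) (snd x)) sequentially"
      using e by blast
  qed simp
qed

lemma cdiff2_q_poch_comp:
  assumes "cdiff2 f w" "cdiff2 g w" "norm (g w) < 1"
  shows "cdiff2 (\<lambda>w. q_poch (f w) (g w)) w"
proof -
  have "cdiff2 (\<lambda>w. q_poch (fst w) (snd w)) (f w, g w)" using assms by (intro cdiff2_q_poch) simp
  from cdiff2_compose2[OF assms(1,2) this] show ?thesis by simp
qed

text \<open>The product (q; q)_n, that is, the q-factorial without its denominators 1 - q.\<close>

definition q_fact :: "complex \<Rightarrow> nat \<Rightarrow> complex" where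
  "q_fact q n = (\<Prod>k<n. 1 - q * q ^ k)"

lemma q_fact_nonzero: "norm q < 1 \<Longrightarrow> q_fact q n \<noteq> 0"
proof
  assume q: "norm q < 1" and "q_fact q n = 0"
  then obtain k where "q ^ Suc k = 1" by (auto simp: q_fact_def)
  hence "norm q ^ Suc k = 1" by (metis norm_one norm_power)
  moreover have "norm q ^ Suc k < 1 ^ Suc k" using q by (intro power_strict_mono) auto
  ultimately show False by simp
qed

text \<open>The Gaussian binomial coefficient. For \<open>norm q < 1\<close> the denominators do not
  vanish.\<close>

definition q_bin :: "complex \<Rightarrow> nat \<Rightarrow> nat \<Rightarrow> complex" where
  "q_bin q N k = (if k \<le> N then q_fact q N / (q_fact q k * q_fact q (N - k)) else 0)"

lemma q_bin_0 [simp]: "norm q < 1 \<Longrightarrow> q_bin q N 0 = 1"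
  using q_fact_nonzero[of q N] by (simp add: q_bin_def q_fact_def)

text \<open>One of the two q-Pascal rules, namely the one that matches multiplication by a new last
  factor \<open>1 + x * q ^ N\<close>.\<close>

lemma q_bin_Suc:
  assumes q: "norm q < 1" and k: "k \<le> N"
  shows "q_bin q (Suc N) (Suc k) = q_bin q N (Suc k) + q ^ (N - k) * q_bin q N k"
proof (cases "N - k")
  case 0
  hence "N = k" using k by simp
  thus ?thesis using q_fact_nonzero[OF q] by (simp add: q_bin_def)
next
  case (Suc M)
  define a where "a = q_fact q N"
  define b where "b = q_fact q k"
  define c where "c = q_fact q M"
  have N: "N = k + Suc M" using Suc k by simp
  have nz: "a \<noteq> 0" "b \<noteq> 0" "c \<noteq> 0" using q_fact_nonzero[OF q] by (auto simp: a_def b_def c_def)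
  have S: "q_fact q (Suc n) = q_fact q n * (1 - q * q ^ n)" for n by (simp add: q_fact_def)
  have nz': "1 - q * q ^ k \<noteq> 0" "1 - q * q ^ M \<noteq> 0"
    using q_fact_nonzero[OF q, of "Suc k"] q_fact_nonzero[OF q, of "Suc M"] by (auto simp: S)
  have "q_bin q (Suc N) (Suc k) = a * (1 - q * q ^ N) / (b * (1 - q * q ^ k) * (c * (1 - q * q ^ M)))"
    unfolding a_def b_def c_def S[symmetric] using k Suc by (simp add: q_bin_def)
  moreover have "q_bin q N (Suc k) = a / (b * (1 - q * q ^ k) * c)"
    unfolding a_def b_def c_def S[symmetric] using N by (simp add: q_bin_def)
  moreover have "q_bin q N k = a / (b * (c * (1 - q * q ^ M)))"
    unfolding a_def b_def c_def S[symmetric] using k Suc by (simp add: q_bin_def)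
  moreover have "a * (1 - q * q ^ N) / (b * (1 - q * q ^ k) * (c * (1 - q * q ^ M))) =
     a / (b * (1 - q * q ^ k) * c) + q ^ Suc M * (a / (b * (c * (1 - q * q ^ M))))"
    using nz nz' unfolding N by (simp add: divide_simps) (simp add: algebra_simps power_add)
  ultimately show ?thesis using Suc by simp
qed

text \<open>The exponent n (n - 1) / 2, written as a sum so that no division of natural numbers
  enters.\<close>

definition tri :: "nat \<Rightarrow> nat" where
  "tri n = (\<Sum>i<n. i)"

lemma tri_0 [simp]: "tri 0 = 0"
  by (simp add: tri_def)

lemma tri_Suc [simp]: "tri (Suc k) = tri k + k"
  by (simp add: tri_def)

text \<open>Rothe's finite q-binomial theorem: split off the last factor and compare coefficients by
  \<open>q_bin_Suc\<close>.\<close>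

lemma qbinomial:
  assumes q: "norm q < 1"
  shows "(\<Prod>j<N. 1 + x * q ^ j) = (\<Sum>k\<le>N. q ^ (tri (k)) * q_bin q N k * x ^ k)"
proof (induction N)
  case 0
  show ?case using q by simp
next
  case (Suc N)
  define t where "t = (\<lambda>N k. q ^ (tri (k)) * q_bin q N k)"
  have t0: "t n 0 = 1" for n using q by (simp add: t_def)
  have tS: "t (Suc N) (Suc k) = t N (Suc k) + q ^ N * t N k" if "k \<le> N" for k
  proof -
    have e: "q ^ (tri (Suc k)) * q ^ (N - k) = q ^ N * q ^ (tri (k))"
      using that by (simp add: add.commute flip: power_add)
    have "t (Suc N) (Suc k) = t N (Suc k) + q ^ (tri (Suc k)) * q ^ (N - k) * q_bin q N k"
      unfolding t_def q_bin_Suc[OF q that] by (simp add: algebra_simps)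
    thus ?thesis unfolding e by (simp add: t_def)
  qed
  have tz: "t N (Suc N) = 0" by (simp add: t_def q_bin_def)
  have "(\<Prod>j<Suc N. 1 + x * q ^ j) = (1 + x * q ^ N) * (\<Sum>k\<le>N. t N k * x ^ k)"
    using Suc by (simp add: t_def mult.commute)
  also have "\<dots> = (\<Sum>k\<le>N. t N k * x ^ k) + (\<Sum>k\<le>N. q ^ N * t N k * x ^ Suc k)"
    by (simp add: algebra_simps sum_distrib_left sum.distrib)
  also have "(\<Sum>k\<le>N. t N k * x ^ k) = (\<Sum>k\<le>Suc N. t N k * x ^ k)"
    by (simp add: tz)
  also have "\<dots> = 1 + (\<Sum>k\<le>N. t N (Suc k) * x ^ Suc k)"
    by (subst sum.atMost_Suc_shift) (simp add: t0)
  also have "\<dots> + (\<Sum>k\<le>N. q ^ N * t N k * x ^ Suc k) =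
      1 + (\<Sum>k\<le>N. t (Suc N) (Suc k) * x ^ Suc k)"
    by (simp add: tS algebra_simps sum.distrib)
  also have "\<dots> = (\<Sum>k\<le>Suc N. t (Suc N) k * x ^ k)"
    by (subst sum.atMost_Suc_shift) (simp add: t0)
  finally show ?case by (simp add: t_def)
qed

lemma double_tri: "2 * int (tri (k)) = int k * (int k - 1)"
  by (induction k) (auto simp: algebra_simps)

text \<open>The q-binomial theorem with 2n factors and argument x = -z q^(1-n). The first n factors,
  read backwards, are monomials times 1 - q^i / z; the last n are 1 - z q^(e+1). Writing k = n + j
  makes the sum symmetric.\<close>

lemma finite_triple_product:
  assumes q: "norm q < 1" "q \<noteq> 0" and z: "z \<noteq> 0"
  shows "(\<Prod>e<n. 1 - z * q * q ^ e) * (\<Prod>i<n. 1 - inverse z * q ^ i) =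
    (\<Sum>j=-int n..int n. (-z) powi j * q powi (j * (j + 1) div 2) * q_bin q (2 * n) (nat (int n + j)))"
proof -
  define x where "x = - z * q powi (1 - int n)"
  have first: "1 + x * q ^ (n - Suc i) = (- z) * inverse (q ^ i) * (1 - inverse z * q ^ i)" if "i < n" for i
  proof -
    have "q powi (1 - int n) * q ^ (n - Suc i) = q powi (1 - int n + int (n - Suc i))"
      using q by (simp add: power_int_add)
    also have "1 - int n + int (n - Suc i) = - int i" using that by auto
    finally have "q powi (1 - int n) * q ^ (n - Suc i) = inverse (q ^ i)"
      by (simp add: power_int_minus)
    hence "1 + x * q ^ (n - Suc i) = 1 - z * inverse (q ^ i)" by (simp add: x_def mult.assoc)
    moreover have "(- z) * inverse (q ^ i) * (1 - inverse z * q ^ i) = 1 - z * inverse (q ^ i)"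
      using q z by (simp add: field_simps)
    ultimately show ?thesis by simp
  qed
  have second: "x * q ^ (n + e) = - (z * q * q ^ e)" for e
  proof -
    have "q powi (1 - int n) * q ^ (n + e) = q powi (1 - int n + int (n + e))"
      using q by (subst power_int_add) (simp_all only: power_int_of_nat, simp)
    also have "1 - int n + int (n + e) = int (Suc e)" by simp
    finally show ?thesis by (simp only: power_int_of_nat x_def) simp
  qed
  have "(\<Prod>j<2*n. 1 + x * q ^ j) = (\<Prod>j<n. 1 + x * q ^ j) * (\<Prod>j<n. 1 + x * q ^ (n + j))"
  proof -
    have "(\<Prod>j<n + n. 1 + x * q ^ j) = (\<Prod>j<n. 1 + x * q ^ j) * (\<Prod>j=n..<n+n. 1 + x * q ^ j)"
      by (metis le_add1 lessThan_atLeast0 prod.atLeastLessThan_concat zero_le)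
    also have "(\<Prod>j=n..<n+n. 1 + x * q ^ j) = (\<Prod>j<n. 1 + x * q ^ (n + j))"
      using prod.shift_bounds_nat_ivl[of "\<lambda>j. 1 + x * q ^ j" 0 n n]
      by (simp add: lessThan_atLeast0 add.commute)
    finally show ?thesis by (simp add: mult_2)
  qed
  also have "(\<Prod>j<n. 1 + x * q ^ j) = (\<Prod>i<n. 1 + x * q ^ (n - Suc i))"
    by (rule prod.nat_diff_reindex[symmetric])
  also have "\<dots> = (\<Prod>i<n. (- z) * inverse (q ^ i) * (1 - inverse z * q ^ i))"
    by (rule prod.cong) (auto simp: first)
  also have "\<dots> = (\<Prod>i<n. (-z) * inverse (q ^ i)) * (\<Prod>i<n. 1 - inverse z * q ^ i)"
    by (rule prod.distrib)
  also have "(\<Prod>i<n. (-z) * inverse (q ^ i)) = (-z) ^ n * inverse (q ^ (tri (n)))"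
    by (induction n) (auto simp: power_add)
  also have "(\<Prod>j<n. 1 + x * q ^ (n + j)) = (\<Prod>e<n. 1 - z * q * q ^ e)"
    by (simp add: second)
  finally have L: "(\<Prod>e<n. 1 - z * q * q ^ e) * (\<Prod>i<n. 1 - inverse z * q ^ i) =
      q ^ (tri (n)) * inverse ((-z) ^ n) * (\<Prod>j<2*n. 1 + x * q ^ j)"
    using q z by (simp add: field_simps)
  also have "\<dots> = (\<Sum>k\<le>2*n. q ^ (tri (n)) * inverse ((-z) ^ n) * (q ^ (tri (k)) * q_bin q (2*n) k * x ^ k))"
    by (simp add: qbinomial[OF q(1)] sum_distrib_left)
  also have "\<dots> = (\<Sum>k\<le>2*n. (-z) powi (int k - int n) *
      q powi ((int k - int n) * (int k - int n + 1) div 2) * q_bin q (2 * n) k)"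
  proof (rule sum.cong)
    fix k
    have E: "int (tri (n)) + int (tri (k)) + (1 - int n) * int k = (int k - int n) * (int k - int n + 1) div 2"
    proof -
      have "2 * (int (tri (n)) + int (tri (k)) + (1 - int n) * int k) = (int k - int n) * (int k - int n + 1)"
        using double_tri[of n] double_tri[of k] by (simp add: algebra_simps)
      thus ?thesis by simp
    qed
    have "x ^ k = (-z) ^ k * q powi ((1 - int n) * int k)"
      by (simp only: x_def power_mult_distrib power_int_mult power_int_of_nat)
    hence "q ^ (tri (n)) * inverse ((-z) ^ n) * (q ^ (tri (k)) * q_bin q (2*n) k * x ^ k) =
      (inverse ((-z) ^ n) * (-z) ^ k) * (q ^ (tri (n)) * q ^ (tri (k)) * q powi ((1 - int n) * int k)) * q_bin q (2*n) k"
      by (simp only: mult_ac)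
    also have "q ^ (tri (n)) * q ^ (tri (k)) * q powi ((1 - int n) * int k) =
       q powi ((int k - int n) * (int k - int n + 1) div 2)"
      unfolding E[symmetric] using q by (simp add: power_int_add)
    also have "inverse ((-z) ^ n) * (-z) ^ k = (-z) powi (int k - int n)"
      using z by (simp add: power_int_diff divide_inverse)
    finally show "q ^ (tri (n)) * inverse ((-z) ^ n) * (q ^ (tri (k)) * q_bin q (2*n) k * x ^ k) =
       (-z) powi (int k - int n) * q powi ((int k - int n) * (int k - int n + 1) div 2) * q_bin q (2 * n) k" .
  qed simp
  also have "\<dots> = (\<Sum>j=-int n..int n. (-z) powi j * q powi (j * (j + 1) div 2) * q_bin q (2 * n) (nat (int n + j)))"
    by (rule sum.reindex_bij_witness[of _ "\<lambda>j. nat (int n + j)" "\<lambda>k. int k - int n"]) auto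
  finally show ?thesis .
qed

section \<open>Gaussian majorants and dominated convergence\<close>

lemma summable_gaussian:
  assumes "\<alpha> > 0"
  shows "(\<lambda>j::int. exp (- \<alpha> * of_int j ^ 2 + \<beta> * \<bar>of_int j\<bar>) :: real) summable_on UNIV"
proof (rule summable_on_comparison_test)
  \<comment> \<open>Completing the square gives -\<alpha> y^2 + (|\<beta>| + 1) y \<le> (|\<beta>| +
    1)^2 / (4 \<alpha>); the additional 1 leaves the summable factor exp (-|j|).\<close>
  define K where "K = exp ((\<bar>\<beta>\<bar> + 1)\<^sup>2 / (4 * \<alpha>))"
  have nat: "(\<lambda>n::nat. K * exp (- real n)) summable_on UNIV"
  proof -
    have "summable (\<lambda>n::nat. exp (-1 :: real) ^ n)" by (rule summable_geometric) simp
    also have "(\<lambda>n::nat. exp (-1 :: real) ^ n) = (\<lambda>n. exp (- real n))"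
      by (auto simp: exp_of_nat_mult[symmetric])
    finally show ?thesis
      by (subst summable_on_UNIV_nonneg_real_iff) (auto simp: K_def intro!: summable_mult)
  qed
  have "(\<lambda>j::int. K * exp (- \<bar>of_int j\<bar>)) summable_on range int"
    using nat by (subst summable_on_reindex) (auto simp: o_def)
  moreover have "(\<lambda>j::int. K * exp (- \<bar>of_int j\<bar>)) summable_on range (\<lambda>n. - int n)"
    using nat by (subst summable_on_reindex) (auto simp: o_def inj_on_def)
  moreover have "range int \<union> range (\<lambda>n. - int n) = UNIV"
    by (auto simp: image_iff) (metis nonneg_int_cases linear neg_0_le_iff_le equation_minus_iff)
  ultimately show "(\<lambda>j::int. K * exp (- \<bar>of_int j\<bar>)) summable_on UNIV"
    by (metis summable_on_union)
  fix j :: int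
  define y where "y = \<bar>of_int j :: real\<bar>"
  have y: "y \<ge> 0" "(of_int j)\<^sup>2 = y\<^sup>2" by (auto simp: y_def)
  have "0 \<le> (2 * \<alpha> * y - (\<bar>\<beta>\<bar> + 1))\<^sup>2 / (4 * \<alpha>)" using assms by simp
  also have "\<dots> = \<alpha> * y\<^sup>2 - (\<bar>\<beta>\<bar> + 1) * y + (\<bar>\<beta>\<bar> + 1)\<^sup>2 / (4 * \<alpha>)"
    using assms by (simp add: field_simps power2_eq_square)
  finally have "- \<alpha> * y\<^sup>2 + \<bar>\<beta>\<bar> * y \<le> (\<bar>\<beta>\<bar> + 1)\<^sup>2 / (4 * \<alpha>) - y" by (simp add: algebra_simps)
  moreover have "\<beta> * y \<le> \<bar>\<beta>\<bar> * y" using y by (intro mult_right_mono) auto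
  ultimately have "- \<alpha> * of_int j ^ 2 + \<beta> * \<bar>of_int j\<bar> \<le> (\<bar>\<beta>\<bar> + 1)\<^sup>2 / (4 * \<alpha>) - y"
    unfolding y(2) y_def[symmetric] by linarith
  hence "exp (- \<alpha> * of_int j ^ 2 + \<beta> * \<bar>of_int j\<bar>) \<le> exp ((\<bar>\<beta>\<bar> + 1)\<^sup>2 / (4 * \<alpha>) - y)" by simp
  also have "\<dots> = K * exp (- \<bar>of_int j\<bar>)" by (simp add: K_def y_def exp_diff exp_minus field_simps)
  finally show "exp (- \<alpha> * of_int j ^ 2 + \<beta> * \<bar>of_int j\<bar>) \<le> K * exp (- \<bar>of_int j\<bar>)" .
qed simp

text \<open>By the M-test the finite partial sums converge uniformly in the parameter, so the limit
  along \<open>F\<close> and the limit over finite subsets may be interchanged.\<close>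

lemma tendsto_infsum_dominated:
  fixes f :: "'a \<Rightarrow> 'b \<Rightarrow> 'c::banach"
  assumes lim: "\<And>k. k \<in> X \<Longrightarrow> ((\<lambda>n. f k n) \<longlongrightarrow> g k) F"
    and bound: "\<forall>\<^sub>F n in F. \<forall>k\<in>X. norm (f k n) \<le> M k"
    and M: "M summable_on X" and F: "F \<noteq> bot"
  shows "((\<lambda>n. \<Sum>\<^sub>\<infinity>k\<in>X. f k n) \<longlongrightarrow> (\<Sum>\<^sub>\<infinity>k\<in>X. g k)) F"
proof -
  define S where "S = {n. \<forall>k\<in>X. norm (f k n) \<le> M k}"
  have gM: "norm (g k) \<le> M k" if "k \<in> X" for k
  proof (rule tendsto_le[OF F])
    show "((\<lambda>n. norm (f k n)) \<longlongrightarrow> norm (g k)) F" by (intro tendsto_norm lim that)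
    show "\<forall>\<^sub>F n in F. norm (f k n) \<le> M k" using bound by eventually_elim (use that in auto)
  qed (rule tendsto_const)
  have "(\<lambda>k. norm (g k)) summable_on X"
    by (rule summable_on_comparison_test[OF M]) (use gM in auto)
  hence "g summable_on X" by (rule abs_summable_summable)
  hence g: "((\<lambda>A. \<Sum>k\<in>A. g k) \<longlongrightarrow> (\<Sum>\<^sub>\<infinity>k\<in>X. g k)) (finite_subsets_at_top X)"
    using has_sum_def has_sum_infsum by blast
  have ul: "uniform_limit S (\<lambda>A n. \<Sum>k\<in>A. f k n) (\<lambda>n. \<Sum>\<^sub>\<infinity>k\<in>X. f k n) (finite_subsets_at_top X)"
    by (rule Weierstrass_m_test_general[OF _ M]) (auto simp: S_def)
  show ?thesis
  proof (rule swap_uniform_limit'[OF _ g ul])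
    show "\<forall>\<^sub>F A in finite_subsets_at_top X. ((\<lambda>n. \<Sum>k\<in>A. f k n) \<longlongrightarrow> (\<Sum>k\<in>A. g k)) F"
      by (rule eventually_finite_subsets_at_top_weakI) (auto intro!: tendsto_sum lim)
    show "\<forall>\<^sub>F n in F. n \<in> S" using bound by (simp add: S_def)
  qed simp
qed


section \<open>Jacobi's triple product\<close>

lemma norm_term_bound:
  assumes q: "norm q < 1" "q \<noteq> 0" and z: "z \<noteq> (0::complex)"
  defines "\<alpha> \<equiv> - ln (norm q) / 2"
  shows "norm ((-z) powi j * q powi (j * (j + 1) div 2)) \<le>
     exp (- \<alpha> * of_int j ^ 2 + (\<bar>ln (norm z)\<bar> + \<alpha>) * \<bar>of_int j\<bar>)"
proof -
  have a: "\<alpha> > 0" using q by (simp add: \<alpha>_def)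
  have e: "norm w powi n = exp (of_int n * ln (norm w))" if "w \<noteq> 0" for w :: complex and n
    using that by (simp add: exp_power_int[symmetric])
  have d: "real_of_int (j * (j + 1) div 2) = of_int j * (of_int j + 1) / 2"
    by (subst real_of_int_div) auto
  have "norm ((-z) powi j * q powi (j * (j + 1) div 2)) =
     exp (of_int j * ln (norm z) + of_int (j * (j + 1) div 2) * ln (norm q))"
    using q z by (simp add: norm_mult norm_power_int e exp_add)
  also have "of_int j * ln (norm z) + of_int (j * (j + 1) div 2) * ln (norm q) =
     - \<alpha> * of_int j ^ 2 + (of_int j * ln (norm z) - \<alpha> * of_int j)"
    unfolding d \<alpha>_def by (simp add: field_simps power2_eq_square)
  also have "of_int j * ln (norm z) - \<alpha> * of_int j \<le> (\<bar>ln (norm z)\<bar> + \<alpha>) * \<bar>of_int j\<bar>"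
  proof -
    have "of_int j * ln (norm z) \<le> \<bar>of_int j\<bar> * \<bar>ln (norm z)\<bar>"
      by (metis abs_ge_self abs_mult)
    moreover have "- \<alpha> * of_int j \<le> \<alpha> * \<bar>of_int j\<bar>"
      using a by (metis abs_ge_minus_self minus_mult_commute mult_left_mono less_imp_le)
    ultimately show ?thesis by (simp add: algebra_simps)
  qed
  finally show ?thesis by simp
qed

lemma q_poch_q_nonzero: "norm q < 1 \<Longrightarrow> q_poch q q \<noteq> 0"
proof -
  assume q: "norm q < 1"
  have "norm (q * q ^ n) < 1" for n
  proof -
    have "norm q ^ Suc n < 1 ^ Suc n" using q by (intro power_strict_mono) auto
    thus ?thesis by (simp add: norm_mult norm_power)
  qed
  hence "q * q ^ n \<noteq> 1" for n by (metis norm_one order_less_irrefl)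
  thus "q_poch q q \<noteq> 0" using q_poch_eq_0_iff[OF q] by blast
qed

lemma q_fact_LIMSEQ: "norm q < 1 \<Longrightarrow> q_fact q \<longlonglongrightarrow> q_poch q q"
  using q_poch_LIMSEQ[of q q] by (simp add: q_fact_def[abs_def])

text \<open>Let n tend to infinity in \<open>finite_triple_product\<close>. The Gaussian
  coefficients tend to 1 / (q; q)_oo and are uniformly bounded, because \<open>q_fact q\<close> and
  its inverse are convergent sequences; the remaining terms have a Gaussian majorant.\<close>

theorem triple_product:
  assumes q: "norm q < 1" "q \<noteq> 0" and z: "z \<noteq> 0"
  shows "(\<Sum>\<^sub>\<infinity>j::int. (-z) powi j * q powi (j * (j + 1) div 2)) =
     q_poch q q * q_poch (z * q) q * q_poch (inverse z) q"
proof -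
  define L where "L = q_poch q q"
  have L: "q_fact q \<longlonglongrightarrow> L" "L \<noteq> 0"
    using q_fact_LIMSEQ q_poch_q_nonzero q by (auto simp: L_def)
  obtain A where A: "A > 0" "\<And>n. norm (q_fact q n) \<le> A"
    using convergent_imp_Bseq[of "q_fact q"] L unfolding Bseq_def convergent_def by blast
  have "(\<lambda>n. inverse (q_fact q n)) \<longlonglongrightarrow> inverse L" by (intro tendsto_inverse L)
  then obtain B where B: "B > 0" "\<And>n. norm (inverse (q_fact q n)) \<le> B"
    using convergent_imp_Bseq[of "\<lambda>n. inverse (q_fact q n)"] unfolding Bseq_def convergent_def by blast
  define \<alpha> where "\<alpha> = - ln (norm q) / 2"
  have \<alpha>: "\<alpha> > 0" using q by (simp add: \<alpha>_def)
  define t where "t = (\<lambda>j::int. (-z) powi j * q powi (j * (j + 1) div 2))"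
  \<comment> \<open>Extended by 0 outside |j| \<le> n, so that the finite sums become sums over all
    integers with one common majorant.\<close>
  define f where "f = (\<lambda>j n. if j \<in> {-int n..int n} then t j * q_bin q (2 * n) (nat (int n + j)) else 0)"
  define M where "M = (\<lambda>j::int. (A * B * B) * exp (- \<alpha> * of_int j ^ 2 + (\<bar>ln (norm z)\<bar> + \<alpha>) * \<bar>of_int j\<bar>))"
  have qb: "q_bin q (2 * n) (nat (int n + j)) = q_fact q (2 * n) * inverse (q_fact q (nat (int n + j))) * inverse (q_fact q (nat (int n - j)))"
    if "j \<in> {-int n..int n}" for j n
  proof -
    have "nat (int n + j) \<le> 2 * n" "2 * n - nat (int n + j) = nat (int n - j)" using that by auto
    thus ?thesis by (simp add: q_bin_def divide_simps)
  qed
  have "((\<lambda>n. \<Sum>\<^sub>\<infinity>j\<in>UNIV. f j n) \<longlonglongrightarrow> (\<Sum>\<^sub>\<infinity>j\<in>UNIV. t j * (L * inverse L * inverse L)))"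
  proof (rule tendsto_infsum_dominated)
    show "M summable_on UNIV"
      unfolding M_def by (intro summable_on_cmult_right summable_gaussian \<alpha>)
    show "\<forall>\<^sub>F n in sequentially. \<forall>j\<in>UNIV. norm (f j n) \<le> M j"
    proof (intro always_eventually allI ballI)
      fix n j
      show "norm (f j n) \<le> M j"
      proof (cases "j \<in> {-int n..int n}")
        case True
        have qbn: "norm (q_bin q (2 * n) (nat (int n + j))) \<le> A * B * B"
          unfolding qb[OF True] norm_mult using A B by (intro mult_mono) (auto intro: less_imp_le mult_nonneg_nonneg)
        have tb: "norm (t j) \<le> exp (- \<alpha> * of_int j ^ 2 + (\<bar>ln (norm z)\<bar> + \<alpha>) * \<bar>of_int j\<bar>)"
          unfolding t_def \<alpha>_def by (rule norm_term_bound[OF q z])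
        have "norm (t j * q_bin q (2 * n) (nat (int n + j))) = norm (q_bin q (2 * n) (nat (int n + j))) * norm (t j)"
          by (simp only: norm_mult mult.commute)
        also have "\<dots> \<le> M j"
          unfolding M_def by (rule mult_mono[OF qbn tb]) (use A B in auto)
        finally have "norm (t j * q_bin q (2 * n) (nat (int n + j))) \<le> M j" .
        thus ?thesis using True by (simp add: f_def)
      next
        case False
        thus ?thesis using A B by (auto simp: f_def M_def)
      qed
    qed
    fix j :: int
    have inf: "filterlim (\<lambda>n. nat (int n + j)) at_top sequentially" "filterlim (\<lambda>n. nat (int n - j)) at_top sequentially"
      "filterlim (\<lambda>n::nat. 2 * n) at_top sequentially"
    proof -
      show "filterlim (\<lambda>n. nat (int n + j)) at_top sequentially"
        unfolding filterlim_at_top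
      proof
        fix Z show "\<forall>\<^sub>F n in sequentially. Z \<le> nat (int n + j)"
          using eventually_ge_at_top[of "Z + nat \<bar>j\<bar>"] by eventually_elim auto
      qed
      show "filterlim (\<lambda>n. nat (int n - j)) at_top sequentially"
        unfolding filterlim_at_top
      proof
        fix Z show "\<forall>\<^sub>F n in sequentially. Z \<le> nat (int n - j)"
          using eventually_ge_at_top[of "Z + nat \<bar>j\<bar>"] by eventually_elim auto
      qed
      show "filterlim (\<lambda>n::nat. 2 * n) at_top sequentially"
        unfolding filterlim_at_top
      proof
        fix Z :: nat show "\<forall>\<^sub>F n in sequentially. Z \<le> 2 * n"
          using eventually_ge_at_top[of Z] by eventually_elim auto
      qed
    qed
    have "(\<lambda>n. t j * (q_fact q (2 * n) * inverse (q_fact q (nat (int n + j))) * inverse (q_fact q (nat (int n - j)))))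
        \<longlonglongrightarrow> t j * (L * inverse L * inverse L)"
      by (intro tendsto_mult tendsto_const tendsto_inverse L(2) filterlim_compose[OF L(1)] inf)
    moreover have "\<forall>\<^sub>F n in sequentially. f j n = t j * (q_fact q (2 * n) * inverse (q_fact q (nat (int n + j))) * inverse (q_fact q (nat (int n - j))))"
      using eventually_ge_at_top[of "nat \<bar>j\<bar>"]
    proof eventually_elim
      case (elim n)
      hence "j \<in> {-int n..int n}" by auto
      thus ?case using qb by (simp add: f_def)
    qed
    ultimately show "f j \<longlonglongrightarrow> t j * (L * inverse L * inverse L)"
      by (simp add: tendsto_cong)
  qed simp
  moreover have "(\<Sum>\<^sub>\<infinity>j\<in>UNIV. f j n) = (\<Prod>e<n. 1 - (z * q) * q ^ e) * (\<Prod>i<n. 1 - inverse z * q ^ i)" for n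
  proof -
    have "(\<Sum>\<^sub>\<infinity>j\<in>UNIV. f j n) = (\<Sum>\<^sub>\<infinity>j\<in>{-int n..int n}. t j * q_bin q (2 * n) (nat (int n + j)))"
      by (rule infsum_cong_neutral) (auto simp: f_def)
    thus ?thesis unfolding finite_triple_product[OF q z] t_def by simp
  qed
  ultimately have "(\<lambda>n. (\<Prod>e<n. 1 - (z * q) * q ^ e) * (\<Prod>i<n. 1 - inverse z * q ^ i)) \<longlonglongrightarrow>
      (\<Sum>\<^sub>\<infinity>j\<in>UNIV. t j * (L * inverse L * inverse L))" by simp
  moreover have "(\<lambda>n. (\<Prod>e<n. 1 - (z * q) * q ^ e) * (\<Prod>i<n. 1 - inverse z * q ^ i)) \<longlonglongrightarrow>
      q_poch (z * q) q * q_poch (inverse z) q"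
    by (intro tendsto_mult q_poch_LIMSEQ q)
  ultimately have "(\<Sum>\<^sub>\<infinity>j\<in>UNIV. t j * (L * inverse L * inverse L)) = q_poch (z * q) q * q_poch (inverse z) q"
    using LIMSEQ_unique by blast
  moreover have "(\<Sum>\<^sub>\<infinity>j\<in>UNIV. t j * (L * inverse L * inverse L)) = (\<Sum>\<^sub>\<infinity>j\<in>UNIV. t j) * (L * inverse L * inverse L)"
    by (rule infsum_cmult_left')
  ultimately show ?thesis using L(2) by (simp add: t_def L_def field_simps)
qed

section \<open>Product formula, quasi-periods and parity of theta\<close>

lemma cexp2pi_add: "cexp2pi (a + b) = cexp2pi a * cexp2pi b"
  by (simp add: distrib_left exp_add)

lemma cexp2pi_minus: "cexp2pi (- a) = inverse (cexp2pi a)"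
  by (simp add: exp_minus)

lemma cexp2pi_powi: "cexp2pi a powi n = cexp2pi (of_int n * a)"
  by (simp add: exp_power_int mult_ac)

lemma cexp2pi_power: "cexp2pi a ^ n = cexp2pi (of_nat n * a)"
  by (simp add: exp_of_nat_mult[symmetric] mult_ac)

lemma norm_cexp2pi: "norm (cexp2pi a) = exp (- 2 * pi * Im a)"
  by simp

lemma norm_cexp2pi_less_1: "Im t > 0 \<Longrightarrow> norm (cexp2pi t) < 1"
  by simp

lemma cexp2pi_eq_1_iff: "cexp2pi a = 1 \<longleftrightarrow> (\<exists>n::int. a = of_int n)"
proof
  assume "cexp2pi a = 1"
  then obtain n :: int where "Re (2 * of_real pi * \<i> * a) = 0" "Im (2 * of_real pi * \<i> * a) = of_int (2 * n) * pi"
    unfolding exp_eq_1 by blast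
  hence "Im a = 0" "Re a = of_int n" by auto
  thus "\<exists>n::int. a = of_int n" by (intro exI[of _ n]) (simp add: complex_eq_iff)
next
  assume "\<exists>n::int. a = of_int n"
  then obtain n :: int where "a = of_int n" by blast
  thus "cexp2pi a = 1" unfolding exp_eq_1 by (auto intro!: exI[of _ n])
qed

lemma cexp2pi_int: "cexp2pi (of_int n) = 1"
  using cexp2pi_eq_1_iff by blast

lemma cexp2pi_half_int: "cexp2pi (of_int n / 2) = (-1) powi n"
proof -
  have "cexp2pi (1 / 2) = -1" by simp
  hence "cexp2pi (1 / 2) powi n = (-1) powi n" by simp
  thus ?thesis unfolding cexp2pi_powi by simp
qed

lemma minus_one_powi: "(-1 :: 'a :: field) powi n = (if even n then 1 else -1)"
  by (auto simp: power_int_minus_left elim!: oddE)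

lemma kronecker_m4_odd: "of_int (kronecker_m4 (2 * k + 1)) = ((-1) powi k :: complex)"
proof (cases "even k")
  case True
  then obtain j where "k = 2 * j" by blast
  thus ?thesis by (simp add: kronecker_m4_def minus_one_powi) presburger?
next
  case False
  then obtain j where "k = 2 * j + 1" by (elim oddE)
  thus ?thesis by (simp add: kronecker_m4_def minus_one_powi) presburger?
qed

lemma kronecker_m4_even: "even r \<Longrightarrow> kronecker_m4 r = 0"
  unfolding kronecker_m4_def by presburger

lemma infsum_odd:
  fixes f :: "int \<Rightarrow> 'a :: {comm_monoid_add, t2_space}"
  assumes "\<And>r. even r \<Longrightarrow> f r = 0"
  shows "infsum f UNIV = (\<Sum>\<^sub>\<infinity>k. f (2 * k + 1))"
proof -
  have "infsum f UNIV = infsum f (range (\<lambda>k. 2 * k + 1))"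
    by (rule infsum_cong_neutral) (use assms in \<open>auto elim!: oddE\<close>)
  also have "\<dots> = (\<Sum>\<^sub>\<infinity>k. f (2 * k + 1))"
    by (subst infsum_reindex) (auto simp: inj_on_def o_def)
  finally show ?thesis .
qed

text \<open>With r = 2k + 1 the exponents are r^2 / 8 = 1/8 + k (k + 1) / 2 and r / 2 = 1/2 + k, and
  the Kronecker symbol is (-1)^k; what remains is the triple product at \<zeta>.\<close>

lemma theta_product:
  assumes "Im t > 0"
  defines "q \<equiv> cexp2pi t"
  shows "theta t z = cexp2pi (t / 8) * cexp2pi (z / 2) *
     (q_poch q q * q_poch (cexp2pi z * q) q * q_poch (inverse (cexp2pi z)) q)"
proof -
  have q: "norm q < 1" "q \<noteq> 0" using assms(1) norm_cexp2pi_less_1 by (auto simp: q_def)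
  have "theta t z = (\<Sum>\<^sub>\<infinity>k::int. of_int (kronecker_m4 (2 * k + 1)) *
                  cexp2pi (t * of_int ((2 * k + 1)\<^sup>2) / 8) * cexp2pi (z * of_int (2 * k + 1) / 2))"
    unfolding theta_def by (rule infsum_odd) (simp add: kronecker_m4_even)
  also have "\<dots> = (\<Sum>\<^sub>\<infinity>k::int. (cexp2pi (t / 8) * cexp2pi (z / 2)) *
       ((- cexp2pi z) powi k * q powi (k * (k + 1) div 2)))"
  proof (rule infsum_cong)
    fix k :: int
    have d: "complex_of_int (k * (k + 1) div 2) = of_int k * (of_int k + 1) / 2"
    proof -
      have "2 * (k * (k + 1) div 2) = k * (k + 1)" by simp
      hence "2 * complex_of_int (k * (k + 1) div 2) = of_int k * (of_int k + 1)"
        by (metis of_int_1 of_int_add of_int_mult of_int_numeral)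
      thus ?thesis by (metis nonzero_mult_div_cancel_left zero_neq_numeral)
    qed
    have 1: "cexp2pi (t * of_int ((2 * k + 1)\<^sup>2) / 8) = cexp2pi (t / 8) * q powi (k * (k + 1) div 2)"
      unfolding q_def cexp2pi_powi cexp2pi_add[symmetric] d
      by (rule arg_cong[of _ _ cexp2pi]) (simp add: field_simps power2_eq_square)
    have 2: "cexp2pi (z * of_int (2 * k + 1) / 2) = cexp2pi (z / 2) * cexp2pi z powi k"
      unfolding cexp2pi_powi cexp2pi_add[symmetric]
      by (rule arg_cong[of _ _ cexp2pi]) (simp add: field_simps)
    have 3: "(- cexp2pi z) powi k = (-1) powi k * cexp2pi z powi k"
      by (metis mult_minus1 power_int_mult_distrib)
    show "of_int (kronecker_m4 (2 * k + 1)) *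
                  cexp2pi (t * of_int ((2 * k + 1)\<^sup>2) / 8) * cexp2pi (z * of_int (2 * k + 1) / 2) =
        (cexp2pi (t / 8) * cexp2pi (z / 2)) * ((- cexp2pi z) powi k * q powi (k * (k + 1) div 2))"
      unfolding 1 2 3 kronecker_m4_odd by (simp only: mult_ac)
  qed
  also have "\<dots> = (cexp2pi (t / 8) * cexp2pi (z / 2)) *
     (\<Sum>\<^sub>\<infinity>k::int. (- cexp2pi z) powi k * q powi (k * (k + 1) div 2))"
    by (rule infsum_cmult_right')
  finally show ?thesis by (simp add: triple_product[OF q])
qed

text \<open>Completing the square in the exponent turns the shift of z by l \<tau> into the shift of
  the summation index k by l. The signs come from the Kronecker symbol and from the half-integral
  powers of \<zeta>.\<close>

lemma theta_translate:
  "theta t (z + of_int l * t + of_int u) =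
     (-1) powi (l + u) * cexp2pi (- (of_int l ^ 2 * t / 2) - of_int l * z) * theta t z"
proof -
  define c where "c = (-1) powi (l + u) * cexp2pi (- (of_int l ^ 2 * t / 2) - of_int l * z)"
  define g where "g = (\<lambda>z r. of_int (kronecker_m4 r) * cexp2pi (t * of_int (r\<^sup>2) / 8) * cexp2pi (z * of_int r / 2))"
  have "g (z + of_int l * t + of_int u) (2 * k + 1) = c * g z (2 * (k + l) + 1)" for k
  proof -
    have A: "cexp2pi (t * of_int ((2 * k + 1)\<^sup>2) / 8) * cexp2pi ((z + of_int l * t + of_int u) * of_int (2 * k + 1) / 2)
       = cexp2pi (of_int u / 2) * cexp2pi (of_int (u * k)) * cexp2pi (- (of_int l ^ 2 * t / 2) - of_int l * z) *
          (cexp2pi (t * of_int ((2 * (k + l) + 1)\<^sup>2) / 8) * cexp2pi (z * of_int (2 * (k + l) + 1) / 2))"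
      unfolding cexp2pi_add[symmetric]
      by (rule arg_cong[of _ _ cexp2pi]) (simp add: field_simps power2_eq_square)
    have B: "(-1::complex) powi k = (-1) powi l * (-1) powi (k + l)"
      by (simp add: minus_one_powi)
    have C: "(-1::complex) powi (l + u) = (-1) powi l * (-1) powi u"
      by (simp add: minus_one_powi)
    have "g (z + of_int l * t + of_int u) (2 * k + 1) = (-1) powi k * (cexp2pi (t * of_int ((2 * k + 1)\<^sup>2) / 8) * cexp2pi ((z + of_int l * t + of_int u) * of_int (2 * k + 1) / 2))"
      by (simp only: g_def kronecker_m4_odd mult.assoc)
    also have "\<dots> = c * g z (2 * (k + l) + 1)"
      unfolding A B c_def C g_def kronecker_m4_odd cexp2pi_half_int cexp2pi_int by (simp only: mult_ac mult_1_left)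
    finally show ?thesis .
  qed
  hence "(\<Sum>\<^sub>\<infinity>k. g (z + of_int l * t + of_int u) (2 * k + 1)) = c * (\<Sum>\<^sub>\<infinity>k. g z (2 * (k + l) + 1))"
    by (simp add: infsum_cmult_right')
  also have "(\<Sum>\<^sub>\<infinity>k. g z (2 * (k + l) + 1)) = (\<Sum>\<^sub>\<infinity>k. g z (2 * k + 1))"
    by (rule infsum_reindex_bij_witness[of _ "\<lambda>k. k - l" "\<lambda>k. k + l"]) auto
  finally have "(\<Sum>\<^sub>\<infinity>r. g (z + of_int l * t + of_int u) r) = c * (\<Sum>\<^sub>\<infinity>r. g z r)"
    by (subst (1 2) infsum_odd) (auto simp: g_def kronecker_m4_even)
  thus ?thesis by (simp add: theta_def g_def c_def)
qed

lemma kronecker_m4_minus: "kronecker_m4 (- r) = - kronecker_m4 r"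
  unfolding kronecker_m4_def by presburger

lemma theta_minus: "theta t (- z) = - theta t z"
proof -
  have "theta t (- z) = (\<Sum>\<^sub>\<infinity>r. - (of_int (kronecker_m4 r) * cexp2pi (t * of_int (r\<^sup>2) / 8) * cexp2pi (z * of_int r / 2)))"
    unfolding theta_def
    by (rule infsum_reindex_bij_witness[of _ uminus uminus]) (auto simp: kronecker_m4_minus)
  thus ?thesis by (simp add: theta_def infsum_uminus)
qed


section \<open>Zeros of theta and the heat equation\<close>

text \<open>The entire function 2 i sin (pi z) / z; its value at 0 is the derivative of the
  numerator there.\<close>

definition sinq :: "complex \<Rightarrow> complex" where
  "sinq z = (if z = 0 then 2 * of_real pi * \<i> else (cexp2pi (z / 2) - cexp2pi (- (z / 2))) / z)"

lemma sinq_holomorphic: "sinq holomorphic_on UNIV"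
proof -
  define f where "f = (\<lambda>z. cexp2pi (z / 2) - cexp2pi (- (z / 2)))"
  have "f holomorphic_on UNIV" unfolding f_def by (intro holomorphic_intros) auto
  hence h: "(\<lambda>z. if z = 0 then deriv f 0 else (f z - f 0) / (z - 0)) holomorphic_on UNIV"
    by (rule pole_lemma) simp
  have "(f has_field_derivative 2 * of_real pi * \<i>) (at 0)"
    unfolding f_def by (auto intro!: derivative_eq_intros)
  hence "deriv f 0 = 2 * of_real pi * \<i>" by (rule DERIV_imp_deriv)
  hence "(\<lambda>z. if z = 0 then deriv f 0 else (f z - f 0) / (z - 0)) = sinq"
    by (auto simp: sinq_def f_def fun_eq_iff)
  thus ?thesis using h by simp
qed

lemma sinq_mult: "z * sinq z = cexp2pi (z / 2) - cexp2pi (- (z / 2))"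
  by (simp add: sinq_def)

text \<open>The cofactor of the simple zero of \<open>theta\<close> at \<open>z = 0\<close>.\<close>

definition theta_cof :: "complex \<Rightarrow> complex \<Rightarrow> complex" where
  "theta_cof t z = cexp2pi (t / 8) * sinq z * (q_poch (cexp2pi t) (cexp2pi t) *
     q_poch (cexp2pi z * cexp2pi t) (cexp2pi t) * q_poch (inverse (cexp2pi z) * cexp2pi t) (cexp2pi t))"

text \<open>The first factor 1 - 1/\<zeta> of the last product, multiplied by \<zeta>^(1/2), is 2 i
  sin (pi z) and carries the zero at z = 0.\<close>

lemma theta_eq_cof:
  assumes "Im t > 0"
  shows "theta t z = z * theta_cof t z"
proof -
  have q: "norm (cexp2pi t) < 1" by (rule norm_cexp2pi_less_1[OF assms])
  have e: "cexp2pi (z / 2) * (1 - inverse (cexp2pi z)) = z * sinq z"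
  proof -
    have "cexp2pi (z / 2) * inverse (cexp2pi z) = cexp2pi (- (z / 2))"
      unfolding cexp2pi_minus[symmetric] cexp2pi_add[symmetric] by simp
    thus ?thesis by (simp only: sinq_mult right_diff_distrib mult_1_right)
  qed
  have "theta t z = cexp2pi (t / 8) * (cexp2pi (z / 2) * (1 - inverse (cexp2pi z))) * (q_poch (cexp2pi t) (cexp2pi t) *
     q_poch (cexp2pi z * cexp2pi t) (cexp2pi t) * q_poch (inverse (cexp2pi z) * cexp2pi t) (cexp2pi t))"
    unfolding theta_product[OF assms] q_poch_rec[OF q, of "inverse (cexp2pi z)"] by (simp only: mult_ac)
  thus ?thesis unfolding e theta_cof_def by (simp only: mult_ac)
qed

lemma eta_eq: "eta t = cexp2pi (t / 24) * q_poch (cexp2pi t) (cexp2pi t)"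
  by (simp add: eta_def q_poch_def)

lemma eta_nonzero: "Im t > 0 \<Longrightarrow> eta t \<noteq> 0"
  using q_poch_q_nonzero[OF norm_cexp2pi_less_1[of t]] by (simp add: eta_eq)

text \<open>As \<open>theta_cof t 0\<close> is the z-derivative of theta at 0, this is Jacobi's
  derivative formula. It is the link through which the law for theta yields one for
  \<open>eta\<close>.\<close>

lemma theta_cof_0: 
  assumes "Im t > 0"
  shows "theta_cof t 0 = 2 * of_real pi * \<i> * eta t ^ 3"
proof -
  have "eta t ^ 3 = cexp2pi (t / 24) ^ 3 * q_poch (cexp2pi t) (cexp2pi t) ^ 3"
    by (simp only: eta_eq power_mult_distrib)
  also have "cexp2pi (t / 24) ^ 3 = cexp2pi (t / 8)"
    unfolding cexp2pi_power by (rule arg_cong[of _ _ cexp2pi]) simp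
  finally show ?thesis by (simp add: theta_cof_def sinq_def power3_eq_cube)
qed

text \<open>The two z-dependent products in \<open>theta_product\<close> supply the lattice points
  with l < 0 and with l \<ge> 0; conversely the zero at the origin is moved around by
  \<open>theta_translate\<close>.\<close>

lemma theta_eq_0_iff:
  assumes "Im t > 0"
  shows "theta t z = 0 \<longleftrightarrow> (\<exists>l u :: int. z = of_int l * t + of_int u)"
proof
  define q where "q = cexp2pi t"
  have q: "norm q < 1" using norm_cexp2pi_less_1[OF assms] by (simp add: q_def)
  assume "theta t z = 0"
  hence "q_poch (cexp2pi z * q) q = 0 \<or> q_poch (inverse (cexp2pi z)) q = 0"
    using q_poch_q_nonzero[OF q] unfolding theta_product[OF assms] q_def by simp
  hence "(\<exists>n. cexp2pi (z + of_nat (Suc n) * t) = 1) \<or> (\<exists>n. cexp2pi (- z + of_nat n * t) = 1)"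
  proof
    assume "q_poch (cexp2pi z * q) q = 0"
    then obtain n where "cexp2pi z * q * q ^ n = 1" unfolding q_poch_eq_0_iff[OF q] by blast
    hence "cexp2pi z * q ^ Suc n = 1" by (simp add: mult_ac)
    thus ?thesis unfolding q_def cexp2pi_power cexp2pi_add[symmetric] by blast
  next
    assume "q_poch (inverse (cexp2pi z)) q = 0"
    then obtain n where "inverse (cexp2pi z) * q ^ n = 1" unfolding q_poch_eq_0_iff[OF q] by blast
    thus ?thesis unfolding q_def cexp2pi_power cexp2pi_add[symmetric] cexp2pi_minus[symmetric] by blast
  qed
  thus "\<exists>l u :: int. z = of_int l * t + of_int u"
  proof
    assume "\<exists>n. cexp2pi (z + of_nat (Suc n) * t) = 1"
    then obtain n and u :: int where "z + of_nat (Suc n) * t = of_int u" unfolding cexp2pi_eq_1_iff by blast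
    hence "z = of_int (- int (Suc n)) * t + of_int u" by (simp add: algebra_simps)
    thus ?thesis by blast
  next
    assume "\<exists>n. cexp2pi (- z + of_nat n * t) = 1"
    then obtain n and u :: int where "- z + of_nat n * t = of_int u" unfolding cexp2pi_eq_1_iff by blast
    hence "z = of_int (int n) * t + of_int (- u)" by (simp add: algebra_simps)
    thus ?thesis by blast
  qed
next
  assume "\<exists>l u :: int. z = of_int l * t + of_int u"
  then obtain l u :: int where z: "z = 0 + of_int l * t + of_int u" by auto
  have "theta t 0 = 0" using theta_eq_cof[OF assms, of 0] by simp
  thus "theta t z = 0" unfolding z theta_translate by simp
qed

lemma lattice_unique:
  assumes "Im t > 0" "of_real a * t + of_real b = of_real c * t + of_real d"
  shows "a = c" "b = d"
proof -
  have "a * Im t = c * Im t" using arg_cong[OF assms(2), of Im] by simp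
  thus "a = c" using assms(1) by simp
  thus "b = d" using assms(2) by simp
qed

lemma theta_cof_nonzero:
  assumes "Im t > 0" "z = 0 \<or> (\<forall>l u :: int. z \<noteq> of_int l * t + of_int u)"
  shows "theta_cof t z \<noteq> 0"
proof (cases "z = 0")
  case True
  thus ?thesis using eta_nonzero[OF assms(1)] by (simp add: theta_cof_0 assms)
next
  case False
  thus ?thesis using theta_eq_0_iff[OF assms(1), of z] theta_eq_cof[OF assms(1), of z] assms(2) by auto
qed

lemma cdiff2_HC_norm: "w \<in> HC \<Longrightarrow> norm (cexp2pi (fst w)) < 1"
  by (rule norm_cexp2pi_less_1) (simp add: HC_def upper_half_def mem_Times_iff)

lemma cdiff2_theta_cof:
  assumes "w \<in> HC"
  shows "cdiff2 (\<lambda>w. theta_cof (fst w) (snd w)) w"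
proof -
  have s: "cdiff2 (\<lambda>w. sinq (snd w)) w"
    by (rule cdiff2_compose1) (auto intro: holomorphic_on_imp_differentiable_at[OF sinq_holomorphic])
  show ?thesis
    unfolding theta_cof_def divide_inverse cexp2pi_minus[symmetric]
    by (intro cdiff2_intros cdiff2_q_poch_comp s cdiff2_HC_norm[OF assms])
qed

lemma cdiff2_theta:
  assumes "w \<in> HC"
  shows "cdiff2 (\<lambda>w. theta (fst w) (snd w)) w"
proof (rule cdiff2_transform)
  show "cdiff2 (\<lambda>w. snd w * theta_cof (fst w) (snd w)) w"
    by (intro cdiff2_intros cdiff2_theta_cof assms)
  show "open HC" "w \<in> HC" by (fact open_HC assms)+
  show "snd y * theta_cof (fst y) (snd y) = theta (fst y) (snd y)" if "y \<in> HC" for y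
    using theta_eq_cof[of "fst y" "snd y"] that by (simp add: HC_def upper_half_def mem_Times_iff)
qed

lemma cdiff2_theta_comp:
  assumes "cdiff2 f w" "cdiff2 g w" "Im (f w) > 0"
  shows "cdiff2 (\<lambda>w. theta (f w) (g w)) w"
proof -
  have "cdiff2 (\<lambda>w. theta (fst w) (snd w)) (f w, g w)"
    using assms by (intro cdiff2_theta) (simp add: HC_iff)
  from cdiff2_compose2[OF assms(1,2) this] show ?thesis by simp
qed

lemma cdiff2_theta_cof_comp:
  assumes "cdiff2 f w" "cdiff2 g w" "Im (f w) > 0"
  shows "cdiff2 (\<lambda>w. theta_cof (f w) (g w)) w"
proof -
  have "cdiff2 (\<lambda>w. theta_cof (fst w) (snd w)) (f w, g w)"
    using assms by (intro cdiff2_theta_cof) (simp add: HC_iff)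
  from cdiff2_compose2[OF assms(1,2) this] show ?thesis by simp
qed

lemma cdiff2_eta_comp:
  assumes "cdiff2 f w" "Im (f w) > 0"
  shows "cdiff2 (\<lambda>w. eta (f w)) w"
  unfolding eta_eq divide_inverse
  by (intro cdiff2_intros cdiff2_q_poch_comp assms(1) norm_cexp2pi_less_1 assms)

lemma theta_field_differentiable: "Im t > 0 \<Longrightarrow> theta t field_differentiable at z"
  using cdiff2_field_differentiable(1)[of "\<lambda>w. theta (fst w) (snd w)" t z] cdiff2_theta[of "(t, z)"]
  by (simp add: HC_iff)

lemma theta_holomorphic: "Im t > 0 \<Longrightarrow> theta t holomorphic_on UNIV"
  using theta_field_differentiable by (simp add: holomorphic_on_def)

lemma theta_cof_holomorphic: "Im t > 0 \<Longrightarrow> theta_cof t holomorphic_on UNIV"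
  using cdiff2_field_differentiable(1)[of "\<lambda>w. theta_cof (fst w) (snd w)" t] cdiff2_theta_cof[of "(t, _)"]
  by (simp add: HC_iff holomorphic_on_def)

lemma eta_holomorphic: "eta holomorphic_on {t. Im t > 0}"
proof -
  have "cdiff2 (\<lambda>w. eta (fst w)) (t, 0)" if "Im t > 0" for t
    using that by (intro cdiff2_eta_comp) auto
  hence "eta field_differentiable at t" if "Im t > 0" for t
    using cdiff2_field_differentiable(2)[of "\<lambda>w. eta (fst w)" t 0] that by simp
  thus ?thesis unfolding holomorphic_on_def by (auto intro: field_differentiable_at_within)
qed

text \<open>The equation is immediate for the finite partial sums of the theta series, and second derivatives
  converge along with the sums.\<close>

lemma theta_heat:
  assumes t: "Im t > 0"
  shows "(deriv ^^ 2) (theta t) z = 4 * of_real pi * \<i> * deriv (\<lambda>t. theta t z) t"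
proof -
  define g where "g = (\<lambda>t z (r::int). of_int (kronecker_m4 r) * cexp2pi (t * of_int (r\<^sup>2) / 8) * cexp2pi (z * of_int r / 2))"
  define F where "F = finite_subsets_at_top (UNIV :: int set)"
  \<comment> \<open>A term has modulus at most exp (-pi Im s r^2 / 4 + pi |Im y| |r|). The two
    constants make this a majorant for all s with \<open>Im s > Im t / 2\<close> and all y with
    \<open>norm y < norm z + 1\<close>.\<close>
  define M where "M = (\<lambda>r::int. exp (- (pi * Im t / 8) * of_int r ^ 2 + (pi * (norm z + 1)) * \<bar>of_int r\<bar>))"
  have M: "M summable_on UNIV" unfolding M_def by (rule summable_gaussian) (use t in simp)
  have bound: "norm (g s y r) \<le> M r" if "Im s > Im t / 2" "norm y < norm z + 1" for s y r
  proof -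
    have "norm (g s y r) \<le> norm (cexp2pi (s * of_int (r\<^sup>2) / 8)) * norm (cexp2pi (y * of_int r / 2))"
      unfolding g_def norm_mult by (intro mult_right_mono) (auto simp: kronecker_m4_def)
    also have "\<dots> = exp (- (pi * Im s / 4) * of_int r ^ 2 - pi * Im y * of_int r)"
      unfolding norm_cexp2pi exp_add[symmetric] by (rule arg_cong[of _ _ exp]) simp
    also have "\<dots> \<le> M r"
    proof -
      have h1: "(pi * Im t / 8) * of_int r ^ 2 \<le> (pi * Im s / 4) * of_int r ^ 2"
        using that(1) by (intro mult_right_mono) (simp_all add: field_simps)
      have "- (Im y * of_int r) \<le> (norm z + 1) * \<bar>of_int r\<bar>"
      proof -
        have "- (Im y * of_int r) \<le> \<bar>Im y\<bar> * \<bar>of_int r\<bar>" by (metis abs_ge_minus_self abs_mult)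
        also have "\<dots> \<le> (norm z + 1) * \<bar>of_int r\<bar>"
          using abs_Im_le_cmod[of y] that(2) by (intro mult_right_mono) auto
        finally show ?thesis .
      qed
      hence h2: "pi * - (Im y * of_int r) \<le> pi * ((norm z + 1) * \<bar>of_int r\<bar>)" by (intro mult_left_mono) auto
      have "- (pi * Im s / 4) * of_int r ^ 2 - pi * Im y * of_int r =
          - ((pi * Im s / 4) * of_int r ^ 2) + pi * - (Im y * of_int r)" by simp
      also have "\<dots> \<le> - ((pi * Im t / 8) * of_int r ^ 2) + pi * ((norm z + 1) * \<bar>of_int r\<bar>)"
        by (intro add_mono le_imp_neg_le h1 h2)
      also have "\<dots> = - (pi * Im t / 8) * of_int r ^ 2 + (pi * (norm z + 1)) * \<bar>of_int r\<bar>" by simp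
      finally show ?thesis unfolding M_def exp_le_cancel_iff .
    qed
    finally show ?thesis .
  qed
  have U: "uniform_limit (ball 0 (norm z + 1)) (\<lambda>A y. \<Sum>r\<in>A. g t y r) (theta t) F"
    using Weierstrass_m_test_general[of UNIV "ball 0 (norm z + 1)" "\<lambda>r y. g t y r" M] bound M t
    by (simp add: theta_def[abs_def] g_def F_def)
  have V: "uniform_limit {s. Im s > Im t / 2} (\<lambda>A s. \<Sum>r\<in>A. g s z r) (\<lambda>s. theta s z) F"
    using Weierstrass_m_test_general[of UNIV "{s. Im s > Im t / 2}" "\<lambda>r s. g s z r" M] bound M t
    by (simp add: theta_def[abs_def] g_def F_def)
  \<comment> \<open>Two z-derivatives multiply the term of index r by (pi i r)^2, one
    \<tau>-derivative by 2 pi i r^2 / 8; the ratio is 4 pi i for every r.\<close>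
  define c where "c = (\<lambda>r::int. (of_real pi * \<i> * of_int r)\<^sup>2)"
  have dz: "(deriv ^^ 2) (\<lambda>y. \<Sum>r\<in>A. g t y r) z = (\<Sum>r\<in>A. c r * g t z r)" if "finite A" for A
  proof -
    have 1: "((\<lambda>y. g t y r) has_field_derivative of_real pi * \<i> * of_int r * g t y r) (at y)" for y r
      unfolding g_def by (auto intro!: derivative_eq_intros)
    have 2: "deriv (\<lambda>y. \<Sum>r\<in>A. g t y r) = (\<lambda>y. \<Sum>r\<in>A. of_real pi * \<i> * of_int r * g t y r)"
      by (intro ext DERIV_imp_deriv DERIV_sum 1)
    have "deriv (\<lambda>y. \<Sum>r\<in>A. of_real pi * \<i> * of_int r * g t y r) z =
        (\<Sum>r\<in>A. of_real pi * \<i> * of_int r * (of_real pi * \<i> * of_int r * g t z r))"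
      by (intro DERIV_imp_deriv DERIV_sum DERIV_cmult 1)
    thus ?thesis by (simp add: 2 numeral_2_eq_2 c_def power2_eq_square mult.assoc)
  qed
  have dt: "deriv (\<lambda>s. \<Sum>r\<in>A. g s z r) t = (\<Sum>r\<in>A. c r * g t z r) / (4 * of_real pi * \<i>)" if "finite A" for A
  proof -
    have 1: "((\<lambda>s. g s z r) has_field_derivative c r / (4 * of_real pi * \<i>) * g t z r) (at t)" for r
      unfolding g_def c_def by (auto intro!: derivative_eq_intros simp: field_simps power2_eq_square)
    show ?thesis
      unfolding sum_divide_distrib by (intro DERIV_imp_deriv) (use DERIV_sum[OF 1] in simp)
  qed
  have ev: "\<forall>\<^sub>F A in F. finite A" unfolding F_def by (rule eventually_finite_subsets_at_top_weakI)
  have hz: "(\<lambda>y. \<Sum>r\<in>A. g t y r) holomorphic_on X" for A X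
    unfolding g_def by (intro holomorphic_intros) auto
  have ht: "(\<lambda>s. \<Sum>r\<in>A. g s z r) holomorphic_on X" for A X
    unfolding g_def by (intro holomorphic_intros) auto
  have "((\<lambda>A. (deriv ^^ 2) (\<lambda>y. \<Sum>r\<in>A. g t y r) z) \<longlongrightarrow> (deriv ^^ 2) (theta t) z) F"
    by (rule higher_deriv_complex_uniform_limit[OF U]) (auto simp: hz F_def)
  hence A: "((\<lambda>A. \<Sum>r\<in>A. c r * g t z r) \<longlongrightarrow> (deriv ^^ 2) (theta t) z) F"
    by (rule Lim_transform_eventually[OF _ eventually_mono[OF ev dz]])
  have op: "open {s. Im s > Im t / 2}" by (rule open_halfspace_Im_gt)
  have "((\<lambda>A. (deriv ^^ 1) (\<lambda>s. \<Sum>r\<in>A. g s z r) t) \<longlongrightarrow> (deriv ^^ 1) (\<lambda>s. theta s z) t) F"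
    by (rule higher_deriv_complex_uniform_limit[OF V _ _ op]) (use t in \<open>auto simp: ht F_def\<close>)
  hence "((\<lambda>A. deriv (\<lambda>s. \<Sum>r\<in>A. g s z r) t) \<longlongrightarrow> deriv (\<lambda>s. theta s z) t) F" by simp
  hence "((\<lambda>A. (\<Sum>r\<in>A. c r * g t z r) / (4 * of_real pi * \<i>)) \<longlongrightarrow> deriv (\<lambda>s. theta s z) t) F"
    by (rule Lim_transform_eventually[OF _ eventually_mono[OF ev dt]])
  moreover have "((\<lambda>A. (\<Sum>r\<in>A. c r * g t z r) / (4 * of_real pi * \<i>)) \<longlongrightarrow> (deriv ^^ 2) (theta t) z / (4 * of_real pi * \<i>)) F"
    by (intro tendsto_divide A tendsto_const) simp
  ultimately have "deriv (\<lambda>s. theta s z) t = (deriv ^^ 2) (theta t) z / (4 * of_real pi * \<i>)"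
    by (rule tendsto_unique[rotated 1]) (simp add: F_def)
  thus ?thesis by simp
qed


section \<open>Modular transformations of theta and eta\<close>

lemma periodic_of_int:
  fixes f :: "complex \<Rightarrow> 'a"
  assumes "\<And>z. f (z + p) = f z"
  shows "f (z + of_int n * p) = f z"
proof (induction n rule: int_induct[where k = 0])
  case base
  show ?case by simp
next
  case (step1 i)
  have "f (z + of_int (i + 1) * p) = f ((z + of_int i * p) + p)" by (simp add: algebra_simps)
  thus ?case using step1 assms by simp
next
  case (step2 i)
  have "f (z + of_int i * p) = f ((z + of_int (i - 1) * p) + p)" by (simp add: algebra_simps)
  thus ?case using step2 assms by simp
qed

text \<open>Every value is already taken on the compact period parallelogram, so the function is
  bounded and Liouville applies.\<close>

lemma doubly_periodic_entire_constant:
  assumes t: "Im t > 0" and h: "f holomorphic_on UNIV"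
    and p1: "\<And>z. f (z + 1) = f z" and p2: "\<And>z. f (z + t) = f z"
  shows "f z = f 0"
proof -
  define K where "K = (\<lambda>(s, r). of_real s * t + of_real r) ` ({0..1::real} \<times> {0..1::real})"
  have K: "compact K" unfolding K_def case_prod_unfold
    by (intro compact_continuous_image continuous_intros compact_Times compact_Icc)
  have "range f \<subseteq> f ` K"
  proof safe
    fix z
    define s where "s = Im z / Im t"
    define r where "r = Re (z - of_real s * t)"
    have z: "z = of_real s * t + of_real r"
      using t by (auto simp: complex_eq_iff s_def r_def)
    have "f z = f ((of_real (frac s) * t + of_real (frac r)) + of_int \<lfloor>s\<rfloor> * t + of_int \<lfloor>r\<rfloor> * 1)"
      unfolding z by (rule arg_cong[of _ _ f]) (simp add: frac_def algebra_simps)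
    also have "\<dots> = f (of_real (frac s) * t + of_real (frac r))"
      unfolding periodic_of_int[of f 1, OF p1] periodic_of_int[of f t, OF p2] ..
    also have "\<dots> \<in> f ` K"
      unfolding K_def by (intro imageI) (auto intro!: image_eqI[of _ _ "(frac s, frac r)"] less_imp_le[OF frac_lt_1])
    finally show "f z \<in> f ` K" .
  qed
  moreover have "compact (f ` K)"
    using K h by (intro compact_continuous_image) (auto intro: holomorphic_on_imp_continuous_on holomorphic_on_subset)
  ultimately have "bounded (range f)" using bounded_subset compact_imp_bounded by blast
  from Liouville_theorem[OF h this] show ?thesis by (auto simp: constant_on_def)
qed

locale modular_matrix =
  fixes a b c d :: int
  assumes det: "a * d - b * c = 1"
begin

definition J :: "complex \<Rightarrow> complex" where "J t = of_int c * t + of_int d"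
definition mob :: "complex \<Rightarrow> complex" where "mob t = (of_int a * t + of_int b) / J t"

lemma det': "of_int a * of_int d - of_int b * of_int c = (1 :: 'z :: comm_ring_1)"
  using arg_cong[OF det, of "of_int :: int \<Rightarrow> 'z"] by simp

lemma cd_nz: "c \<noteq> 0 \<or> d \<noteq> 0"
  using det by auto

lemma J_nz: "Im t > 0 \<Longrightarrow> J t \<noteq> 0"
  using cd_nz by (auto simp: J_def complex_eq_iff)

lemma Im_mob: "Im t > 0 \<Longrightarrow> Im (mob t) = Im t / (cmod (J t))\<^sup>2"
proof -
  assume t: "Im t > 0"
  have "Im (mob t) = (of_int a * of_int d - of_int b * of_int c) * Im t / (cmod (J t))\<^sup>2"
    unfolding mob_def Im_divide' cmod_power2 J_def by (simp add: algebra_simps)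
  thus ?thesis unfolding det' by simp
qed

lemma Im_mob_pos: "Im t > 0 \<Longrightarrow> Im (mob t) > 0"
  using J_nz[of t] by (simp add: Im_mob)

text \<open>With \<open>t_div_J\<close> this gives the coordinates of 1 and t after division by
  \<open>J t\<close>: the lattice of t is scaled onto the lattice of \<open>mob t\<close>.\<close>

lemma inverse_J: "Im t > 0 \<Longrightarrow> 1 / J t = of_int a - of_int c * mob t"
proof -
  assume t: "Im t > 0"
  have "(of_int a - of_int c * mob t) * J t = of_int a * J t - of_int c * (of_int a * t + of_int b)"
    using J_nz[OF t] by (simp add: mob_def field_simps)
  also have "\<dots> = of_int a * of_int d - of_int b * of_int c" by (simp add: J_def algebra_simps)
  finally show ?thesis unfolding det' using J_nz[OF t] by (simp add: field_simps)
qed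

lemma t_div_J: "Im t > 0 \<Longrightarrow> t / J t = of_int d * mob t - of_int b"
proof -
  assume t: "Im t > 0"
  have "(of_int d * mob t - of_int b) * J t = of_int d * (of_int a * t + of_int b) - of_int b * J t"
    using J_nz[OF t] by (simp add: mob_def field_simps)
  also have "\<dots> = (of_int a * of_int d - of_int b * of_int c) * t" by (simp add: J_def algebra_simps)
  finally show ?thesis unfolding det' using J_nz[OF t] by (simp add: field_simps)
qed

text \<open>The Gaussian factor is the one that gives \<open>lhs t\<close> the quasi-periods of
  \<open>theta t\<close>.\<close>

definition lhs :: "complex \<Rightarrow> complex \<Rightarrow> complex" where
  "lhs t z = theta (mob t) (z / J t) * cexp2pi (- (of_int c * z\<^sup>2 / (2 * J t)))"

text \<open>Note a + c + a c = (a + 1)(c + 1) - 1, and a column of a matrix of determinant 1 cannot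
  be even. These exponents collect the signs from \<open>theta_translate\<close> and from the
  Gaussian.\<close>

lemma parity_ac: "odd (a + c + a * c)" "odd (d + b + b * d)"
proof -
  have *: "a * d = 1 + b * c" using det by simp
  have "\<not> (even a \<and> even c)"
  proof
    assume "even a \<and> even c"
    hence "even (a * d)" "even (b * c)" by auto
    thus False using * by simp
  qed
  thus "odd (a + c + a * c)" by auto
  have "\<not> (even d \<and> even b)"
  proof
    assume "even d \<and> even b"
    hence "even (a * d)" "even (b * c)" by auto
    thus False using * by simp
  qed
  thus "odd (d + b + b * d)" by auto
qed

lemma lhs_1:
  assumes t: "Im t > 0"
  shows "lhs t (z + 1) = - lhs t z"
proof -
  define m where "m = mob t"
  define j where "j = J t"
  have j: "j \<noteq> 0" "1 / j = of_int a - of_int c * m" using J_nz inverse_J t by (auto simp: j_def m_def)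
  have "theta m ((z + 1) / j) = theta m (z / j + of_int (-c) * m + of_int a)"
    by (rule arg_cong[of _ _ "theta m"]) (simp add: add_divide_distrib j(2))
  also have "\<dots> = (-1) powi (- c + a) * cexp2pi (- (of_int c ^ 2 * m / 2) + of_int c * (z / j)) * theta m (z / j)"
    by (subst theta_translate) simp
  finally have "lhs t (z + 1) = (-1) powi (- c + a) *
      (cexp2pi (- (of_int c ^ 2 * m / 2) + of_int c * (z / j)) * cexp2pi (- (of_int c * (z + 1)\<^sup>2 / (2 * j)))) * theta m (z / j)"
    by (simp add: lhs_def m_def j_def mult_ac)
  also have "cexp2pi (- (of_int c ^ 2 * m / 2) + of_int c * (z / j)) * cexp2pi (- (of_int c * (z + 1)\<^sup>2 / (2 * j))) =
     cexp2pi (of_int (- (a * c)) / 2) * cexp2pi (- (of_int c * z\<^sup>2 / (2 * j)))"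
    unfolding cexp2pi_add[symmetric]
  proof (rule arg_cong[of _ _ cexp2pi])
    have "- (of_int c ^ 2 * m / 2) + of_int c * (z / j) + (- (of_int c * (z + 1)\<^sup>2 / (2 * j))) =
       - (of_int c * (of_int c * m + 1 / j)) / 2 - of_int c * z\<^sup>2 / (2 * j)"
      using j(1) by (simp add: field_simps power2_eq_square)
    also have "of_int c * m + 1 / j = of_int a" by (simp add: j(2))
    finally show "- (of_int c ^ 2 * m / 2) + of_int c * (z / j) + (- (of_int c * (z + 1)\<^sup>2 / (2 * j))) =
        of_int (- (a * c)) / 2 + - (of_int c * z\<^sup>2 / (2 * j))" by simp
  qed
  also have "cexp2pi (of_int (- (a * c)) / 2) = (-1) powi (- (a * c))" by (rule cexp2pi_half_int)
  also have "(-1) powi (- c + a) * ((-1) powi (- (a * c)) * cexp2pi (- (of_int c * z\<^sup>2 / (2 * j)))) =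
     - cexp2pi (- (of_int c * z\<^sup>2 / (2 * j)))"
    using parity_ac(1) by (simp add: minus_one_powi)
  finally show ?thesis by (simp add: lhs_def m_def j_def mult_ac)
qed

lemma lhs_t:
  assumes t: "Im t > 0"
  shows "lhs t (z + t) = - cexp2pi (- (t / 2) - z) * lhs t z"
proof -
  define m where "m = mob t"
  define j where "j = J t"
  have j: "j \<noteq> 0" "t / j = of_int d * m - of_int b" "j = of_int c * t + of_int d"
    using J_nz t_div_J t by (auto simp: j_def m_def J_def)
  have "theta m ((z + t) / j) = theta m (z / j + of_int d * m + of_int (- b))"
    by (rule arg_cong[of _ _ "theta m"]) (simp add: add_divide_distrib j(2))
  also have "\<dots> = (-1) powi (d + - b) * cexp2pi (- (of_int d ^ 2 * m / 2) - of_int d * (z / j)) * theta m (z / j)"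
    by (subst theta_translate) simp
  finally have "lhs t (z + t) = (-1) powi (d + - b) *
      (cexp2pi (- (of_int d ^ 2 * m / 2) - of_int d * (z / j)) * cexp2pi (- (of_int c * (z + t)\<^sup>2 / (2 * j)))) * theta m (z / j)"
    by (simp add: lhs_def m_def j_def mult_ac)
  also have "cexp2pi (- (of_int d ^ 2 * m / 2) - of_int d * (z / j)) * cexp2pi (- (of_int c * (z + t)\<^sup>2 / (2 * j))) =
     cexp2pi (of_int (- (b * d)) / 2) * (cexp2pi (- (t / 2) - z) * cexp2pi (- (of_int c * z\<^sup>2 / (2 * j))))"
    unfolding cexp2pi_add[symmetric]
  proof (rule arg_cong[of _ _ cexp2pi])
    have m: "of_int d * m = t / j + of_int b" by (simp add: j(2))
    have "- (of_int d ^ 2 * m / 2) - of_int d * (z / j) + (- (of_int c * (z + t)\<^sup>2 / (2 * j))) =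
      - (of_int d * (of_int d * m)) / 2 - of_int d * (z / j) - of_int c * (z + t)\<^sup>2 / (2 * j)"
      by (simp add: power2_eq_square)
    also have "\<dots> = - (of_int b * of_int d) / 2 - (of_int d + of_int c * t) / j * (t / 2) - (of_int d + of_int c * t) / j * z
         - of_int c * z\<^sup>2 / (2 * j)"
      unfolding m using j(1) by (simp add: field_simps power2_eq_square)
    also have "(of_int d + of_int c * t) / j = 1" using j by (simp add: add.commute)
    finally show "- (of_int d ^ 2 * m / 2) - of_int d * (z / j) + (- (of_int c * (z + t)\<^sup>2 / (2 * j))) =
        of_int (- (b * d)) / 2 + (- (t / 2) - z + - (of_int c * z\<^sup>2 / (2 * j)))" by simp
  qed
  also have "cexp2pi (of_int (- (b * d)) / 2) = (-1) powi (- (b * d))" by (rule cexp2pi_half_int)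
  also have "(-1) powi (d + - b) * ((-1) powi (- (b * d)) * (cexp2pi (- (t / 2) - z) * cexp2pi (- (of_int c * z\<^sup>2 / (2 * j))))) =
     - cexp2pi (- (t / 2) - z) * cexp2pi (- (of_int c * z\<^sup>2 / (2 * j)))"
    using parity_ac(2) by (simp add: minus_one_powi)
  finally show ?thesis by (simp add: lhs_def m_def j_def mult_ac)
qed

text \<open>By \<open>theta_cof_0\<close> this is the ratio of the z-derivatives of
  \<open>lhs t\<close> and \<open>theta t\<close> at z = 0.\<close>

definition C :: "complex \<Rightarrow> complex" where
  "C t = eta (mob t) ^ 3 / (J t * eta t ^ 3)"

text \<open>Both sides have the same quasi-periods and the right-hand side has simple zeros exactly
  at the lattice, where the left-hand side vanishes too; so their quotient extends to an elliptic
  function without poles.\<close>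

lemma theta_mob:
  assumes t: "Im t > 0"
  shows "theta (mob t) (z / J t) = C t * cexp2pi (of_int c * z\<^sup>2 / (2 * J t)) * theta t z"
proof -
  have m: "Im (mob t) > 0" using Im_mob_pos t by blast
  have j: "J t \<noteq> 0" using J_nz t by blast
  define lc where "lc = (\<lambda>z. theta_cof (mob t) (z / J t) / J t * cexp2pi (- (of_int c * z\<^sup>2 / (2 * J t))))"
  have lc: "lhs t z = z * lc z" for z
    unfolding lhs_def theta_eq_cof[OF m] lc_def by simp
  \<comment> \<open>The value on the lattice is the limit at 0. It makes \<open>R\<close>
    differentiable at 0, and periodicity carries this to every lattice point.\<close>
  define R where "R = (\<lambda>z. if theta t z = 0 then lc 0 / theta_cof t 0 else lhs t z / theta t z)"
  have th1: "theta t (z + 1) = - theta t z" for z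
    using theta_translate[of t z 0 1] by simp
  have tht: "theta t (z + t) = - cexp2pi (- (t / 2) - z) * theta t z" for z
    using theta_translate[of t z 1 0] by simp
  have R1: "R (z + 1) = R z" for z
    by (simp add: R_def th1 lhs_1[OF t])
  have Rt: "R (z + t) = R z" for z
    by (simp add: R_def tht lhs_t[OF t])
  have lch: "lc holomorphic_on UNIV"
    unfolding lc_def
    by (intro holomorphic_intros holomorphic_on_compose_gen[of "\<lambda>z. z / J t" _ "theta_cof (mob t)" UNIV, unfolded o_def]
         theta_cof_holomorphic m) (use j in auto)
  have lhsh: "lhs t holomorphic_on UNIV"
  proof -
    have "lhs t = (\<lambda>z. z * lc z)" using lc by (intro ext)
    moreover have "(\<lambda>z. z * lc z) holomorphic_on UNIV" by (intro holomorphic_intros lch)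
    ultimately show ?thesis by simp
  qed
  have R0: "R field_differentiable at 0"
  proof -
    define U where "U = {z. theta_cof t z \<noteq> 0}"
    have U: "open U"
    proof -
      have "open (theta_cof t -` (- {0}))"
        using theta_cof_holomorphic[OF t] by (intro open_vimage) (auto intro: holomorphic_on_imp_continuous_on)
      thus ?thesis by (simp add: U_def vimage_def)
    qed
    have 0: "0 \<in> U" using theta_cof_nonzero[OF t, of 0] by (simp add: U_def)
    have "(\<lambda>z. lc z / theta_cof t z) holomorphic_on U"
      using lch theta_cof_holomorphic[OF t]
      by (intro holomorphic_on_divide) (auto simp: U_def intro: holomorphic_on_subset)
    moreover have "lc z / theta_cof t z = R z" if "z \<in> U" for z
      using that by (auto simp: R_def U_def theta_eq_cof[OF t] lc)
    ultimately have "R holomorphic_on U" by (rule holomorphic_transform)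
    thus ?thesis using U 0 holomorphic_on_imp_differentiable_at by blast
  qed
  have "R field_differentiable at z" for z
  proof (cases "theta t z = 0")
    case True
    then obtain l u :: int where z: "z = of_int l * t + of_int u" using theta_eq_0_iff[OF t] by blast
    have RR: "R y = R (y - z)" for y
    proof -
      have "R y = R ((y - z) + of_int l * t + of_int u * 1)" by (simp add: z)
      thus ?thesis unfolding periodic_of_int[of R 1, OF R1] periodic_of_int[of R t, OF Rt] .
    qed
    obtain D where "(R has_field_derivative D) (at (z - z))" using R0 by (auto simp: field_differentiable_def)
    hence "((\<lambda>y. R (y - z)) has_field_derivative D * (1 - 0)) (at z)"
      by (intro DERIV_chain2[of R D] derivative_intros)
    thus ?thesis unfolding RR[symmetric] field_differentiable_def by blast
  next
    case False
    define U where "U = {z. theta t z \<noteq> 0}"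
    have U: "open U"
    proof -
      have "open (theta t -` (- {0}))"
        using theta_holomorphic[OF t] by (intro open_vimage) (auto intro: holomorphic_on_imp_continuous_on)
      thus ?thesis by (simp add: U_def vimage_def)
    qed
    have "(\<lambda>z. lhs t z / theta t z) holomorphic_on U"
      using lhsh theta_holomorphic[OF t]
      by (intro holomorphic_on_divide) (auto simp: U_def intro: holomorphic_on_subset)
    hence "R holomorphic_on U"
      by (rule holomorphic_transform) (auto simp: R_def U_def)
    moreover have "z \<in> U" using False by (simp add: U_def)
    ultimately show ?thesis using U holomorphic_on_imp_differentiable_at by blast
  qed
  hence "R holomorphic_on UNIV" by (simp add: holomorphic_on_def)
  hence "R z = R 0" using doubly_periodic_entire_constant[OF t _ R1 Rt] by blast
  moreover have "R 0 = C t"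
    using eta_nonzero[OF t] j by (simp add: R_def theta_eq_cof[OF t] lc_def theta_cof_0[OF t] theta_cof_0[OF m] C_def field_simps)
  ultimately have Rz: "R z = C t" by simp
  have "lhs t z = C t * theta t z"
  proof (cases "theta t z = 0")
    case False
    thus ?thesis using Rz by (simp add: R_def field_simps)
  next
    case True
    then obtain l u :: int where z: "z = of_int l * t + of_int u" using theta_eq_0_iff[OF t] by blast
    \<comment> \<open>At lattice points \<open>R\<close> says nothing about \<open>lhs\<close>.
      Vanishing of \<open>lhs\<close> is itself doubly periodic, as the quasi-period factors are
      nonzero, and it holds at 0.\<close>
    define Z where "Z = (\<lambda>z. lhs t z = 0)"
    have Z1: "Z (z + 1) = Z z" and Zt: "Z (z + t) = Z z" for z
      by (simp_all add: Z_def lhs_1[OF t] lhs_t[OF t])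
    have "Z (0 + of_int l * t + of_int u * 1) = Z 0"
      unfolding periodic_of_int[of Z 1, OF Z1] periodic_of_int[of Z t, OF Zt] ..
    moreover have "Z 0" by (simp add: Z_def lc)
    ultimately have "lhs t z = 0" by (simp add: Z_def z)
    thus ?thesis using True by simp
  qed
  note L = this
  have e: "cexp2pi (- (of_int c * z\<^sup>2 / (2 * J t))) * cexp2pi (of_int c * z\<^sup>2 / (2 * J t)) = 1"
    unfolding cexp2pi_add[symmetric] by simp
  have "theta (mob t) (z / J t) = theta (mob t) (z / J t) *
      (cexp2pi (- (of_int c * z\<^sup>2 / (2 * J t))) * cexp2pi (of_int c * z\<^sup>2 / (2 * J t)))"
    unfolding e by simp
  also have "\<dots> = lhs t z * cexp2pi (of_int c * z\<^sup>2 / (2 * J t))"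
    by (simp only: lhs_def mult.assoc)
  finally show ?thesis unfolding L by (simp only: mult_ac)
qed

lemma J_deriv: "(J has_field_derivative of_int c) (at t)"
  unfolding J_def[abs_def] by (auto intro!: derivative_eq_intros)

lemma mob_deriv:
  assumes t: "Im t > 0"
  shows "(mob has_field_derivative 1 / (J t)\<^sup>2) (at t)"
proof -
  have "(mob has_field_derivative (of_int a * J t - (of_int a * t + of_int b) * of_int c) / (J t * J t)) (at t)"
    unfolding mob_def[abs_def]
    by (rule derivative_eq_intros J_deriv refl J_nz t)+ (simp add: J_nz t)
  also have "of_int a * J t - (of_int a * t + of_int b) * of_int c = of_int a * of_int d - of_int b * of_int c"
    by (simp add: J_def algebra_simps)
  finally show ?thesis unfolding det' by (simp add: power2_eq_square)
qed

lemma C_field_differentiable: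
  assumes t: "Im t > 0"
  shows "C field_differentiable at t"
proof -
  have op: "open {t. Im t > 0}" by (rule open_halfspace_Im_gt)
  have e: "eta field_differentiable at s" if "Im s > 0" for s
    using that eta_holomorphic op holomorphic_on_imp_differentiable_at by blast
  have m: "mob field_differentiable at t" using mob_deriv[OF t] by (auto simp: field_differentiable_def)
  have "(eta \<circ> mob) field_differentiable at t"
    by (intro field_differentiable_compose m e Im_mob_pos t)
  moreover have "J field_differentiable at t" using J_deriv by (auto simp: field_differentiable_def)
  ultimately show ?thesis
    unfolding C_def[abs_def] using e[OF t] J_nz[OF t] eta_nonzero[OF t]
    by (intro derivative_intros) (auto simp: o_def)
qed

text \<open>The heat equation, applied to both sides of the transformation law, pins down the weight.\<close>

lemma C_deriv:
  assumes t: "Im t > 0"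
  shows "(C has_field_derivative of_int c * C t / (2 * J t)) (at t)"
proof -
  have m: "Im (mob t) > 0" using Im_mob_pos t by blast
  define j where "j = J t"
  have j: "j \<noteq> 0" using J_nz t by (simp add: j_def)
  \<comment> \<open>A point off the lattice for every t, so that \<open>theta t z\<close> can be
    cancelled at the end.\<close>
  define z :: complex where "z = 1 / 2"
  have th: "theta t z \<noteq> 0"
  proof
    assume "theta t z = 0"
    then obtain l u :: int where "z = of_int l * t + of_int u" using theta_eq_0_iff[OF t] by blast
    hence "of_real (of_int l) * t + of_real (of_int u) = of_real 0 * t + of_real (1 / 2)" by (simp add: z_def)
    from lattice_unique[OF t this] have "real_of_int (2 * u) = real_of_int 1" by simp
    hence "2 * u = 1" unfolding of_int_eq_iff .
    thus False by presburger
  qed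
  \<comment> \<open>The Gaussian of the law becomes exp (al y^2 / 2). The relation
    \<open>ka * (of_int c / j) = 2 * al\<close> to the constant of the heat equation is what makes
    the first z-derivatives cancel.\<close>
  define al where "al = 2 * of_real pi * \<i> * of_int c / j"
  define ka :: complex where "ka = 4 * of_real pi * \<i>"
  have ka: "ka \<noteq> 0" "ka * (of_int c / j) = 2 * al" by (auto simp: ka_def al_def)
  define E where "E = exp (al * z\<^sup>2 / 2)"
  define D1 where "D1 = (\<lambda>s z. deriv (theta s) z)"
  define D2 where "D2 = (\<lambda>s z. (deriv ^^ 2) (theta s) z)"
  define Dt where "Dt = (\<lambda>s z. deriv (\<lambda>s. theta s z) s)"
  have heat: "D2 s y = ka * Dt s y" if "Im s > 0" for s y
    using theta_heat[OF that, of y] by (simp add: D2_def Dt_def ka_def)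
  have d1: "(theta s has_field_derivative D1 s y) (at y)" if "Im s > 0" for s y
    unfolding D1_def using theta_field_differentiable[OF that] by (rule field_differentiable_derivI)
  have d2: "(D1 s has_field_derivative D2 s y) (at y)" if "Im s > 0" for s y
  proof -
    have "deriv (theta s) holomorphic_on UNIV" using theta_holomorphic[OF that] by (intro holomorphic_deriv) auto
    hence "deriv (theta s) field_differentiable at y" using holomorphic_on_imp_differentiable_at by blast
    from field_differentiable_derivI[OF this] show ?thesis by (simp add: D1_def[abs_def] D2_def numeral_2_eq_2)
  qed
  have ec: "cexp2pi (of_int c * y\<^sup>2 / (2 * j)) = exp (al * y\<^sup>2 / 2)" for y
    by (simp add: al_def)
  have main: "theta (mob t) (y / j) = C t * exp (al * y\<^sup>2 / 2) * theta t y" for y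
    using theta_mob[OF t, of y] unfolding j_def[symmetric] ec .
  have eq1: "D1 (mob t) (y / j) / j = C t * exp (al * y\<^sup>2 / 2) * (al * y * theta t y + D1 t y)" for y
  proof -
    have "((\<lambda>y. theta (mob t) (y / j)) has_field_derivative D1 (mob t) (y / j) * (1 / j)) (at y)"
      by (rule DERIV_chain2[OF d1[OF m]]) (use j in \<open>auto intro!: derivative_eq_intros\<close>)
    moreover have "((\<lambda>y. C t * exp (al * y\<^sup>2 / 2) * theta t y) has_field_derivative
       C t * exp (al * y\<^sup>2 / 2) * (al * y * theta t y + D1 t y)) (at y)"
    proof -
      have a: "((\<lambda>y. C t * exp (al * y\<^sup>2 / 2)) has_field_derivative C t * exp (al * y\<^sup>2 / 2) * (al * y)) (at y)"
        by (auto intro!: derivative_eq_intros)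
      from DERIV_mult[OF a d1[OF t, of y]] show ?thesis by (simp add: algebra_simps)
    qed
    ultimately show ?thesis unfolding main by (simp add: DERIV_unique)
  qed
  have eq2: "D2 (mob t) (z / j) / j\<^sup>2 = C t * E * ((al\<^sup>2 * z\<^sup>2 + al) * theta t z + 2 * al * z * D1 t z + D2 t z)"
  proof -
    have "((\<lambda>y. D1 (mob t) (y / j) / j) has_field_derivative D2 (mob t) (z / j) * (1 / j) / j) (at z)"
      by (intro DERIV_cdivide DERIV_chain2[OF d2[OF m]]) (use j in \<open>auto intro!: derivative_eq_intros\<close>)
    moreover have "((\<lambda>y. C t * exp (al * y\<^sup>2 / 2) * (al * y * theta t y + D1 t y)) has_field_derivative
       C t * E * ((al\<^sup>2 * z\<^sup>2 + al) * theta t z + 2 * al * z * D1 t z + D2 t z)) (at z)"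
    proof -
      have a: "((\<lambda>y. C t * exp (al * y\<^sup>2 / 2)) has_field_derivative C t * E * (al * z)) (at z)"
        unfolding E_def by (auto intro!: derivative_eq_intros)
      from DERIV_mult[OF a DERIV_add[OF DERIV_mult[OF DERIV_cmult_Id[of al] d1[OF t, of z]] d2[OF t, of z]]]
      show ?thesis unfolding E_def[symmetric] by (simp add: algebra_simps power2_eq_square)
    qed
    ultimately show ?thesis unfolding eq1 by (simp add: DERIV_unique power2_eq_square)
  qed
  obtain C' where C': "(C has_field_derivative C') (at t)"
    using C_field_differentiable[OF t] by (auto simp: field_differentiable_def)
  have dth: "((\<lambda>s. theta s y) has_field_derivative Dt s y) (at s)" if "Im s > 0" for s y
    unfolding Dt_def using cdiff2_field_differentiable(2)[of "\<lambda>w. theta (fst w) (snd w)" s y] cdiff2_theta[of "(s, y)"] that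
    by (intro field_differentiable_derivI) (simp add: HC_iff)
  have eq3: "Dt (mob t) (z / j) / j\<^sup>2 - D1 (mob t) (z / j) * (of_int c * z / j\<^sup>2) =
      C' * E * theta t z - C t * E * (al * of_int c * z\<^sup>2 / (2 * j)) * theta t z + C t * E * Dt t z"
  proof -
    have L: "((\<lambda>s. theta (mob s) (z / J s)) has_field_derivative
        Dt (mob t) (z / j) * (1 / j\<^sup>2) + D1 (mob t) (z / j) * (- (z * of_int c / j\<^sup>2))) (at t)"
    proof -
      have "cdiff2 (\<lambda>w. theta (fst w) (snd w)) (mob t, z / j)" by (intro cdiff2_theta) (simp add: HC_iff m)
      from cdiff2_partials[OF this]
      have T: "((\<lambda>w. theta (fst w) (snd w)) has_derivative (\<lambda>p. Dt (mob t) (z / j) * fst p + D1 (mob t) (z / j) * snd p))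
         (at (mob t, z / j))" by (simp add: Dt_def D1_def)
      have "((\<lambda>s. z / J s) has_field_derivative - (z * of_int c / j\<^sup>2)) (at t)"
        unfolding j_def by (rule derivative_eq_intros J_deriv refl J_nz t)+ (simp_all add: power2_eq_square J_nz t)
      hence "((\<lambda>s. (mob s, z / J s)) has_derivative (\<lambda>x. (1 / j\<^sup>2 * x, - (z * of_int c / j\<^sup>2) * x))) (at t)"
        using mob_deriv[OF t] unfolding has_field_derivative_def j_def by (rule has_derivative_Pair[rotated])
      from has_derivative_compose[OF this T[unfolded j_def]]
      have "((\<lambda>s. theta (mob s) (z / J s)) has_derivative
         (\<lambda>x. Dt (mob t) (z / j) * (1 / j\<^sup>2 * x) + D1 (mob t) (z / j) * (- (z * of_int c / j\<^sup>2) * x))) (at t)"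
        by (simp add: j_def)
      also have "(\<lambda>x. Dt (mob t) (z / j) * (1 / j\<^sup>2 * x) + D1 (mob t) (z / j) * (- (z * of_int c / j\<^sup>2) * x)) =
          (*) (Dt (mob t) (z / j) * (1 / j\<^sup>2) + D1 (mob t) (z / j) * (- (z * of_int c / j\<^sup>2)))"
        by (simp add: fun_eq_iff algebra_simps)
      finally show ?thesis by (simp only: has_field_derivative_def)
    qed
    have R: "((\<lambda>s. C s * cexp2pi (of_int c * z\<^sup>2 / (2 * J s)) * theta s z) has_field_derivative
       C' * E * theta t z - C t * E * (al * of_int c * z\<^sup>2 / (2 * j)) * theta t z + C t * E * Dt t z) (at t)"
    proof -
      have "((\<lambda>s. 2 * of_real pi * \<i> * (of_int c * z\<^sup>2 / (2 * J s))) has_field_derivative - (al * of_int c * z\<^sup>2 / (2 * j))) (at t)"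
        using j unfolding al_def j_def by (auto intro!: derivative_eq_intros J_deriv simp: field_simps power2_eq_square)
      from DERIV_chain2[OF DERIV_exp this]
      have "((\<lambda>s. cexp2pi (of_int c * z\<^sup>2 / (2 * J s))) has_field_derivative E * - (al * of_int c * z\<^sup>2 / (2 * j))) (at t)"
        unfolding j_def[symmetric] ec E_def .
      from DERIV_mult[OF DERIV_mult[OF C' this] dth[OF t, of z]]
      show ?thesis unfolding j_def[symmetric] ec E_def[symmetric] by (simp add: algebra_simps)
    qed
    have "((\<lambda>s. theta (mob s) (z / J s)) has_field_derivative
       C' * E * theta t z - C t * E * (al * of_int c * z\<^sup>2 / (2 * j)) * theta t z + C t * E * Dt t z) (at t)"
    proof (rule has_field_derivative_transform_within_open[OF R, of "{t. Im t > 0}"])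
      show "open {t. Im t > 0}" by (rule open_halfspace_Im_gt)
    qed (use t theta_mob in auto)
    from DERIV_unique[OF L this] show ?thesis by (simp add: mult_ac)
  qed
  have E0: "E \<noteq> 0" by (simp add: E_def)
  \<comment> \<open>Multiply \<open>eq3\<close> by \<open>ka\<close> and replace the
    \<tau>-derivative at \<open>mob t\<close> by a second z-derivative, which \<open>eq2\<close>
    evaluates. The terms in \<open>D1\<close>, \<open>Dt\<close> and al^2 cancel, and
    \<open>C t * al = ka * C'\<close> is left.\<close>
  define v where "v = D1 (mob t) (z / j) / j"
  have v: "v = C t * E * (al * z * theta t z + D1 t z)" using eq1[of z] by (simp add: v_def E_def)
  have "ka * (Dt (mob t) (z / j) / j\<^sup>2) = C t * E * ((al\<^sup>2 * z\<^sup>2 + al) * theta t z + 2 * al * z * D1 t z + ka * Dt t z)"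
    using eq2 unfolding heat[OF m] heat[OF t] by simp
  moreover have "D1 (mob t) (z / j) * (of_int c * z / j\<^sup>2) = (of_int c / j) * z * v"
    by (simp add: v_def power2_eq_square)
  ultimately have "C t * E * ((al\<^sup>2 * z\<^sup>2 + al) * theta t z + 2 * al * z * D1 t z + ka * Dt t z) - (ka * (of_int c / j)) * z * v =
     ka * (C' * E * theta t z) - C t * E * (al * (ka * (of_int c / j)) * z\<^sup>2 / 2) * theta t z + C t * E * ka * Dt t z"
    using arg_cong[OF eq3, of "\<lambda>x. ka * x"] by (simp add: algebra_simps)
  hence "E * theta t z * (C t * al - ka * C') = 0"
    unfolding ka(2) v by (simp add: algebra_simps power2_eq_square)
  hence "C t * al = ka * C'" using th E0 by simp
  hence "C' = of_int c * C t / (2 * J t)" using ka(1) j by (simp add: ka_def al_def j_def field_simps)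
  thus ?thesis using C' by simp
qed

text \<open>The function \<open>csqrt (J t)\<close> solves the same linear differential equation as
  \<open>C\<close>, so their quotient has derivative 0 on a convex domain.\<close>

lemma C_weight: "\<exists>w. \<forall>t. Im t > 0 \<longrightarrow> C t = w * csqrt (J t)"
proof -
  have cv: "convex {t. Im t > 0}" by (rule convex_halfspace_Im_gt)
  have "\<exists>w. \<forall>t\<in>{t. Im t > 0}. C t / csqrt (J t) = w"
  proof (rule has_field_derivative_zero_constant[OF cv])
    fix t assume "t \<in> {t. Im t > 0}"
    hence t: "Im t > 0" by simp
    have sq: "csqrt (J t) * csqrt (J t) = J t" by (metis power2_csqrt power2_eq_square)
    have nz: "csqrt (J t) \<noteq> 0" using J_nz[OF t] by simp
    show "((\<lambda>t. C t / csqrt (J t)) has_field_derivative 0) (at t within {t. Im t > 0})"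
    \<comment> \<open>If c = 0, then J is a constant that may lie on the branch cut of the square
      root; otherwise J takes no real value.\<close>
    proof (cases "c = 0")
      case True
      have Jc: "J t = of_int d" for t unfolding J_def by (simp add: True)
      have z: "of_int c * C t / (2 * J t) = 0" using True by simp
      have "(C has_field_derivative 0) (at t)" using C_deriv[OF t] unfolding z .
      from DERIV_cdivide[OF this] have "((\<lambda>t. C t / csqrt (of_int d)) has_field_derivative 0) (at t)" by simp
      thus ?thesis unfolding Jc by (rule has_field_derivative_at_within)
    next
      case False
      hence "J t \<notin> \<real>\<^sub>\<le>\<^sub>0" using t by (auto simp: J_def complex_nonpos_Reals_iff)
      note D = DERIV_chain2[OF has_field_derivative_csqrt[OF this] J_deriv]
      have i: "inverse (2 * csqrt (J t)) = csqrt (J t) / (2 * J t)"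
        using nz J_nz[OF t] sq by (simp add: field_simps)
      have "((\<lambda>t. csqrt (J t)) has_field_derivative csqrt (J t) / (2 * J t) * of_int c) (at t)"
        using D unfolding i .
      from DERIV_divide[OF C_deriv[OF t] this nz]
      have "((\<lambda>t. C t / csqrt (J t)) has_field_derivative 0) (at t)"
        by (simp add: algebra_simps)
      thus ?thesis by (rule has_field_derivative_at_within)
    qed
  qed
  then obtain w where w: "\<And>t. Im t > 0 \<Longrightarrow> C t / csqrt (J t) = w" by auto
  have "C t = w * csqrt (J t)" if "Im t > 0" for t
  proof -
    have "csqrt (J t) \<noteq> 0" using J_nz[OF that] by simp
    thus ?thesis using w[OF that] by (simp add: nonzero_divide_eq_eq)
  qed
  thus ?thesis by blast
qed

lemma eta_mob_ex: "\<exists>v. v \<noteq> 0 \<and> (\<forall>t. Im t > 0 \<longrightarrow> eta (mob t) = v * csqrt (J t) * eta t)"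
proof -
  obtain w where w: "\<And>t. Im t > 0 \<Longrightarrow> C t = w * csqrt (J t)" using C_weight by blast
  define H where "H = {t::complex. Im t > 0}"
  define g where "g = (\<lambda>t. eta (mob t) / (csqrt (J t) * eta t))"
  have g3: "g t ^ 3 = w" if t: "Im t > 0" for t
  proof -
    have nz: "csqrt (J t) \<noteq> 0" "eta t \<noteq> 0" using J_nz[OF t] eta_nonzero[OF t] by auto
    have sq: "csqrt (J t) * csqrt (J t) = J t" by (metis power2_csqrt power2_eq_square)
    have "eta (mob t) ^ 3 = C t * (J t * eta t ^ 3)"
      using nz J_nz[OF t] by (simp add: C_def)
    also have "C t = w * csqrt (J t)" by (rule w[OF t])
    also have "w * csqrt (J t) * (J t * eta t ^ 3) = w * csqrt (J t) * (csqrt (J t) * csqrt (J t) * eta t ^ 3)"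
      unfolding sq ..
    also have "\<dots> = w * (csqrt (J t) * eta t) ^ 3"
      by (simp only: power3_eq_cube mult_ac)
    finally show ?thesis using nz by (simp add: g_def power_divide)
  qed
  have "g constant_on H"
  proof (rule continuous_finite_range_constant)
    show "connected H" unfolding H_def by (intro convex_connected convex_halfspace_Im_gt)
    have ce: "continuous_on H eta" unfolding H_def by (rule holomorphic_on_imp_continuous_on[OF eta_holomorphic])
    have cm: "continuous_on H mob"
      unfolding H_def using mob_deriv by (intro continuous_at_imp_continuous_on) (auto dest: DERIV_isCont)
    have "continuous_on H (\<lambda>t. eta (mob t))"
      by (rule continuous_on_compose2[OF ce cm]) (auto simp: H_def Im_mob_pos)
    moreover have "continuous_on H (\<lambda>t. csqrt (J t))"
    proof (cases "c = 0")
      case True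
      hence Jc: "J t = of_int d" for t unfolding J_def by (simp add: True)
      show ?thesis unfolding Jc by (rule continuous_on_const)
    next
      case False
      show ?thesis
      proof (intro continuous_at_imp_continuous_on ballI)
        fix t assume "t \<in> H"
        hence "J t \<notin> \<real>\<^sub>\<le>\<^sub>0" using False by (auto simp: H_def J_def complex_nonpos_Reals_iff)
        thus "isCont (\<lambda>t. csqrt (J t)) t"
          using DERIV_isCont[OF J_deriv] by (intro isCont_o2[OF _ continuous_at_csqrt])
      qed
    qed
    ultimately show "continuous_on H g"
      unfolding g_def using ce by (intro continuous_intros) (auto simp: H_def J_nz eta_nonzero)
    have "finite {x::complex. x ^ 3 = w}" by (rule finite_nth_roots) simp
    moreover have "g ` H \<subseteq> {x. x ^ 3 = w}" using g3 by (auto simp: H_def)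
    ultimately show "finite (g ` H)" by (rule finite_subset[rotated])
  qed
  then obtain v where v: "\<And>t. Im t > 0 \<Longrightarrow> g t = v" by (auto simp: constant_on_def H_def)
  have e: "eta (mob t) = v * csqrt (J t) * eta t" if t: "Im t > 0" for t
    using v[OF t] J_nz[OF t] eta_nonzero[OF t] by (auto simp: g_def field_simps)
  moreover have "v \<noteq> 0"
    using e[of \<i>] eta_nonzero[OF Im_mob_pos[of \<i>]] by auto
  ultimately show ?thesis by blast
qed

lemma
  shows eta_mult_nz: "eta_mult a b c d \<noteq> 0"
    and eta_mob: "Im t > 0 \<Longrightarrow> eta (mob t) = eta_mult a b c d * csqrt (J t) * eta t"
proof -
  obtain v where v: "v \<noteq> 0" "\<And>t. Im t > 0 \<Longrightarrow> eta (mob t) = v * csqrt (J t) * eta t"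
    using eta_mob_ex by blast
  have "eta_mult a b c d = v"
    unfolding eta_mult_def
  proof (rule the_equality)
    show "\<forall>\<tau>\<in>upper_half. eta ((of_int a * \<tau> + of_int b) / (of_int c * \<tau> + of_int d)) =
       v * csqrt (of_int c * \<tau> + of_int d) * eta \<tau>"
      using v(2) by (simp add: upper_half_def mob_def J_def)
    fix v' assume "\<forall>\<tau>\<in>upper_half. eta ((of_int a * \<tau> + of_int b) / (of_int c * \<tau> + of_int d)) =
       v' * csqrt (of_int c * \<tau> + of_int d) * eta \<tau>"
    hence "eta (mob \<i>) = v' * csqrt (J \<i>) * eta \<i>" by (simp add: upper_half_def mob_def J_def)
    hence "v' * csqrt (J \<i>) * eta \<i> = eta (mob \<i>)" by (rule sym)
    also have "\<dots> = v * csqrt (J \<i>) * eta \<i>" by (rule v(2)) simp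
    finally have "v' * csqrt (J \<i>) * eta \<i> = v * csqrt (J \<i>) * eta \<i>" .
    moreover have "csqrt (J \<i>) \<noteq> 0" "eta \<i> \<noteq> 0" by (simp_all add: J_nz eta_nonzero)
    ultimately show "v' = v" by simp
  qed
  thus "eta_mult a b c d \<noteq> 0" "Im t > 0 \<Longrightarrow> eta (mob t) = eta_mult a b c d * csqrt (J t) * eta t"
    using v by auto
qed

text \<open>Inserting the law of \<open>eta\<close> into \<open>C\<close> leaves the cube of the
  multiplier times J^(3/2) / J.\<close>

lemma theta_mob_eta_mult:
  assumes t: "Im t > 0"
  shows "theta (mob t) (z / J t) =
    eta_mult a b c d ^ 3 * csqrt (J t) * cexp2pi (of_int c * z\<^sup>2 / (2 * J t)) * theta t z"
proof -
  have sq: "csqrt (J t) * csqrt (J t) = J t" by (metis power2_csqrt power2_eq_square)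
  have "C t = eta_mult a b c d ^ 3 * (csqrt (J t) * (csqrt (J t) * csqrt (J t))) / J t"
    using eta_nonzero[OF t] by (simp add: C_def eta_mob[OF t] power_mult_distrib power3_eq_cube)
  hence "C t = eta_mult a b c d ^ 3 * csqrt (J t)" unfolding sq using J_nz[OF t] by simp
  thus ?thesis using theta_mob[OF t, of z] by simp
qed

end


section \<open>Behaviour at infinity and the Fourier series of the second Bernoulli polynomial\<close>

text \<open>The minimum is attained at k = -floor x. The value is 1/24 plus half the second
  Bernoulli polynomial at \<open>frac x\<close>; dividing theta by \<open>eta\<close> removes the
  1/24.\<close>

lemma theta_B_eq: "theta_B x = (frac x - 1 / 2)\<^sup>2 / 2"
  unfolding theta_B_def
proof (rule cInf_eq_minimum)
  show "(frac x - 1 / 2)\<^sup>2 / 2 \<in> range (\<lambda>k::int. (x - 1/2 + of_int k)\<^sup>2 / 2)"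
    by (rule image_eqI[of _ _ "- \<lfloor>x\<rfloor>"]) (simp_all add: frac_def algebra_simps)
  fix y assume "y \<in> range (\<lambda>k::int. (x - 1/2 + of_int k)\<^sup>2 / 2)"
  then obtain k :: int where y: "y = (x - 1/2 + of_int k)\<^sup>2 / 2" by blast
  define j where "j = k + \<lfloor>x\<rfloor>"
  define s where "s = frac x"
  have s: "0 \<le> s" "s < 1" by (auto simp: s_def frac_lt_1)
  have y': "y = (s - 1/2)\<^sup>2 / 2 + of_int j * (of_int j + 2 * s - 1) / 2"
    unfolding y by (simp add: j_def s_def frac_def field_simps power2_eq_square)
  have "of_int j * (of_int j + 2 * s - 1) \<ge> (0::real)"
  proof (cases "j \<le> 0")
    case True
    hence "real_of_int j \<le> 0" by simp
    thus ?thesis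
    proof (cases "j = 0")
      case False
      hence "j \<le> -1" using True by simp
      hence "real_of_int j \<le> real_of_int (-1)" by (simp only: of_int_le_iff)
      hence "real_of_int j \<le> -1" by simp
      thus ?thesis using s by (intro mult_nonpos_nonpos) auto
    qed simp
  next
    case False
    hence "real_of_int j \<ge> 1" by simp
    thus ?thesis using s by (intro mult_nonneg_nonneg) auto
  qed
  thus "(frac x - 1 / 2)\<^sup>2 / 2 \<le> y" unfolding y' s_def by simp
qed

lemma theta_B_minus: "theta_B (- x) = theta_B x"
proof (cases "x \<in> \<int>")
  case False
  hence f: "frac (- x) = 1 - frac x" by (simp add: frac_neg)
  show ?thesis unfolding theta_B_eq f by (simp add: power2_eq_square algebra_simps)
next
  case True
  hence f: "frac x = 0" "frac (- x) = 0" by (simp_all add: frac_eq_0_iff)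
  show ?thesis unfolding theta_B_eq f ..
qed

lemma at_i_inf_neq_bot [simp]: "at_i_inf \<noteq> bot"
proof -
  have "surj Im" by (rule surjI[of _ "\<lambda>x. Complex 0 x"]) simp
  thus ?thesis by (intro filtercomap_neq_bot_surj) auto
qed

lemma filterlim_Im_at_i_inf: "filterlim Im at_top at_i_inf"
  by (rule filterlim_filtercomap)

lemma eventually_at_i_inf: "eventually (\<lambda>t. Im t > x) at_i_inf"
  using filterlim_Im_at_i_inf by (auto simp: filterlim_at_top_dense)

lemma cexp2pi_tendsto_0:
  assumes "c > 0"
  shows "((\<lambda>t. cexp2pi (of_real c * t + w)) \<longlongrightarrow> 0) at_i_inf"
proof (rule tendsto_norm_zero_cancel)
  have "filterlim (\<lambda>t. (2 * pi * c) * Im t) at_top at_i_inf"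
    by (rule filterlim_tendsto_pos_mult_at_top[OF tendsto_const _ filterlim_Im_at_i_inf]) (use assms in simp)
  hence "filterlim (\<lambda>t. - ((2 * pi * c) * Im t)) at_bot at_i_inf"
    by (simp add: filterlim_uminus_at_bot)
  hence "((\<lambda>t. exp (- ((2 * pi * c) * Im t))) \<longlongrightarrow> 0) at_i_inf"
    by (rule filterlim_compose[OF exp_at_bot])
  hence "((\<lambda>t. exp (- ((2 * pi * c) * Im t)) * exp (- (2 * pi * Im w))) \<longlongrightarrow> 0 * exp (- (2 * pi * Im w))) at_i_inf"
    by (intro tendsto_mult tendsto_const)
  thus "((\<lambda>t. norm (cexp2pi (of_real c * t + w))) \<longlongrightarrow> 0) at_i_inf"
    by (simp add: exp_add[symmetric] algebra_simps)
qed

lemma q_poch_tendsto_1: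
  assumes "(f \<longlongrightarrow> 0) F" "(g \<longlongrightarrow> 0) F"
  shows "((\<lambda>t. q_poch (f t) (g t)) \<longlongrightarrow> 1) F"
proof -
  have "isCont (\<lambda>w. q_poch (fst w) (snd w)) (0, 0)"
    by (intro cdiff2_isCont cdiff2_q_poch) simp
  moreover have "((\<lambda>t. (f t, g t)) \<longlongrightarrow> (0, 0)) F" by (intro tendsto_Pair assms)
  ultimately have "((\<lambda>t. q_poch (fst (f t, g t)) (snd (f t, g t))) \<longlongrightarrow> q_poch (fst (0::complex, 0::complex)) (snd (0::complex, 0::complex))) F"
    by (rule isCont_tendsto_compose)
  thus ?thesis by simp
qed

lemma cexp2pi_tendsto_0': "(cexp2pi \<longlongrightarrow> 0) at_i_inf"
  using cexp2pi_tendsto_0[of 1 0] by simp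

lemma eta_at_i_inf: "((\<lambda>t. cexp2pi (- of_real (1 / 24) * t) * eta t) \<longlongrightarrow> 1) at_i_inf"
proof -
  have "cexp2pi (- of_real (1 / 24) * t) * eta t = q_poch (cexp2pi t) (cexp2pi t)" for t
  proof -
    have "cexp2pi (- of_real (1 / 24) * t) * cexp2pi (t / 24) = 1"
      unfolding cexp2pi_add[symmetric] by simp
    thus ?thesis by (simp only: eta_eq mult.assoc[symmetric] mult_1_left)
  qed
  moreover have "((\<lambda>t. q_poch (cexp2pi t) (cexp2pi t)) \<longlongrightarrow> 1) at_i_inf"
    by (intro q_poch_tendsto_1 cexp2pi_tendsto_0')
  ultimately show ?thesis by simp
qed

text \<open>Translating by the integer part of x reduces to 0 \<le> s < 1, where all q-products tend
  to 1. The factor left over is e(s \<tau>) - e(-y), with limit -e(-y) for s > 0 and 1 - e(-y) for s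
  = 0; for s = 0 this is nonzero because y is not an integer.\<close>

lemma theta_at_i_inf:
  fixes x y :: real
  assumes y: "y \<notin> \<int>"
  shows "\<exists>L. L \<noteq> 0 \<and> ((\<lambda>t. cexp2pi (- of_real (theta_B x) * t) *
     (cexp2pi (of_real (x\<^sup>2 / 2) * t) * theta t (of_real x * t + of_real y))) \<longlongrightarrow> L) at_i_inf"
proof -
  define s where "s = frac x"
  define n where "n = \<lfloor>x\<rfloor>"
  have s: "0 \<le> s" "s < 1" by (auto simp: s_def frac_lt_1)
  have x: "x = s + of_int n" by (simp add: s_def n_def frac_def)
  define c where "c = (-1) powi n * cexp2pi (- (of_int n * of_real y) + of_real y / 2)"
  have c: "c \<noteq> 0" by (simp add: c_def)
  define H where "H = (\<lambda>t. c * (cexp2pi (of_real s * t) - cexp2pi (- of_real y)) *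
     (q_poch (cexp2pi t) (cexp2pi t) * q_poch (cexp2pi (of_real (1 + s) * t + of_real y)) (cexp2pi t) *
      q_poch (cexp2pi (of_real (1 - s) * t + - of_real y)) (cexp2pi t)))"
  have eq: "cexp2pi (- of_real (theta_B x) * t) *
     (cexp2pi (of_real (x\<^sup>2 / 2) * t) * theta t (of_real x * t + of_real y)) = H t" if t: "Im t > 0" for t
  proof -
    have q: "norm (cexp2pi t) < 1" by (rule norm_cexp2pi_less_1[OF t])
    define z where "z = of_real s * t + of_real y"
    define Q where "Q = q_poch (cexp2pi t) (cexp2pi t) * q_poch (cexp2pi z * cexp2pi t) (cexp2pi t) * q_poch (inverse (cexp2pi z) * cexp2pi t) (cexp2pi t)"
    have th: "theta t z = cexp2pi (t / 8) * cexp2pi (z / 2) * (1 - inverse (cexp2pi z)) * Q"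
      unfolding theta_product[OF t] q_poch_rec[OF q, of "inverse (cexp2pi z)"] Q_def by (simp only: mult_ac)
    have "of_real x * t + of_real y = z + of_int n * t + of_int 0" by (simp add: z_def x algebra_simps)
    hence "theta t (of_real x * t + of_real y) = (-1) powi n * cexp2pi (- (of_int n ^ 2 * t / 2) - of_int n * z) * theta t z"
      using theta_translate[of t z n 0] by simp
    hence "cexp2pi (- of_real (theta_B x) * t) * (cexp2pi (of_real (x\<^sup>2 / 2) * t) * theta t (of_real x * t + of_real y)) =
      (-1) powi n * (cexp2pi (- of_real (theta_B x) * t) * cexp2pi (of_real (x\<^sup>2 / 2) * t) *
        cexp2pi (- (of_int n ^ 2 * t / 2) - of_int n * z) * cexp2pi (t / 8) * cexp2pi (z / 2)) * (1 - inverse (cexp2pi z)) * Q"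
      unfolding th by (simp only: mult_ac)
    also have "cexp2pi (- of_real (theta_B x) * t) * cexp2pi (of_real (x\<^sup>2 / 2) * t) *
        cexp2pi (- (of_int n ^ 2 * t / 2) - of_int n * z) * cexp2pi (t / 8) * cexp2pi (z / 2) =
        cexp2pi (- (of_int n * of_real y) + of_real y / 2) * cexp2pi (of_real s * t)"
      unfolding cexp2pi_add[symmetric] theta_B_eq s_def[symmetric]
      by (rule arg_cong[of _ _ cexp2pi]) (simp add: x z_def field_simps power2_eq_square)
    also have "(-1) powi n * (cexp2pi (- (of_int n * of_real y) + of_real y / 2) * cexp2pi (of_real s * t)) * (1 - inverse (cexp2pi z)) * Q =
       c * (cexp2pi (of_real s * t) * (1 - inverse (cexp2pi z))) * Q"
      unfolding c_def by (simp only: mult_ac)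
    also have "cexp2pi (of_real s * t) * (1 - inverse (cexp2pi z)) = cexp2pi (of_real s * t) - cexp2pi (- of_real y)"
    proof -
      have "cexp2pi (of_real s * t) * inverse (cexp2pi z) = cexp2pi (- of_real y)"
        unfolding cexp2pi_minus[symmetric] cexp2pi_add[symmetric] by (simp add: z_def)
      thus ?thesis by (simp only: right_diff_distrib mult_1_right)
    qed
    also have "Q = q_poch (cexp2pi t) (cexp2pi t) * q_poch (cexp2pi (of_real (1 + s) * t + of_real y)) (cexp2pi t) *
      q_poch (cexp2pi (of_real (1 - s) * t + - of_real y)) (cexp2pi t)"
      unfolding Q_def cexp2pi_minus[symmetric] cexp2pi_add[symmetric] by (simp add: z_def algebra_simps)
    finally show ?thesis by (simp only: H_def)
  qed
  have Q1: "((\<lambda>t. q_poch (cexp2pi t) (cexp2pi t) * q_poch (cexp2pi (of_real (1 + s) * t + of_real y)) (cexp2pi t) *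
      q_poch (cexp2pi (of_real (1 - s) * t + - of_real y)) (cexp2pi t)) \<longlongrightarrow> 1 * 1 * 1) at_i_inf"
    by (intro tendsto_mult q_poch_tendsto_1 cexp2pi_tendsto_0' cexp2pi_tendsto_0) (use s in auto)
  obtain e where e: "((\<lambda>t. cexp2pi (of_real s * t)) \<longlongrightarrow> e) at_i_inf" "e - cexp2pi (- of_real y) \<noteq> 0"
  proof (cases "s = 0")
    case True
    have "cexp2pi (- of_real y) \<noteq> 1"
    proof
      assume "cexp2pi (- of_real y) = 1"
      then obtain k :: int where "- complex_of_real y = of_int k" using cexp2pi_eq_1_iff by blast
      hence "y = of_int (- k)" by (metis minus_minus of_int_minus of_real_eq_iff of_real_of_int_eq)
      thus False using y by simp
    qed
    thus ?thesis using True by (intro that[of 1]) auto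
  next
    case False
    thus ?thesis using cexp2pi_tendsto_0[of s 0] s by (intro that[of 0]) auto
  qed
  have "(H \<longlongrightarrow> c * (e - cexp2pi (- of_real y)) * (1 * 1 * 1)) at_i_inf"
    unfolding H_def by (intro tendsto_mult Q1 tendsto_diff e tendsto_const)
  moreover have "\<forall>\<^sub>F t in at_i_inf. H t = cexp2pi (- of_real (theta_B x) * t) *
     (cexp2pi (of_real (x\<^sup>2 / 2) * t) * theta t (of_real x * t + of_real y))"
    using eventually_at_i_inf[of 0] by eventually_elim (simp only: eq)
  ultimately have "((\<lambda>t. cexp2pi (- of_real (theta_B x) * t) *
     (cexp2pi (of_real (x\<^sup>2 / 2) * t) * theta t (of_real x * t + of_real y))) \<longlongrightarrow> c * (e - cexp2pi (- of_real y)) * (1 * 1 * 1)) at_i_inf"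
    by (rule Lim_transform_eventually)
  thus ?thesis using c e(2) by (intro exI[of _ "c * (e - cexp2pi (- of_real y)) * (1 * 1 * 1)"]) simp
qed

section \<open>Abel summation of the cosine series\<close>

definition cos_series :: "real \<Rightarrow> real \<Rightarrow> real" where
  "cos_series r \<theta> = (\<Sum>n. r ^ Suc n * cos (of_nat (Suc n) * \<theta>) / (of_nat (Suc n))\<^sup>2)"

lemma summable_inv_squares: "summable (\<lambda>n. 1 / (real (Suc n))\<^sup>2)"
  using inverse_squares_sums by (simp add: sums_iff add.commute)

lemma cos_series_bound:
  fixes r \<theta> :: real
  assumes "0 \<le> r" "r \<le> 1"
  shows "norm (r ^ Suc n * cos (of_nat (Suc n) * \<theta>) / (of_nat (Suc n))\<^sup>2) \<le> 1 / (real (Suc n))\<^sup>2"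
proof -
  have "\<bar>r ^ Suc n\<bar> * \<bar>cos (of_nat (Suc n) * \<theta>)\<bar> \<le> 1 * 1"
    using assms by (intro mult_mono) (auto intro: power_le_one simp del: power_Suc)
  hence "\<bar>r ^ Suc n\<bar> * \<bar>cos (of_nat (Suc n) * \<theta>)\<bar> / (real (Suc n))\<^sup>2 \<le> 1 / (real (Suc n))\<^sup>2"
    by (intro divide_right_mono) auto
  thus ?thesis unfolding real_norm_def abs_divide abs_mult by (simp only: abs_power2)
qed

text \<open>The majorant 1 / n^2 is uniform up to r = 1, so the limit r \<rightarrow> 1 can be taken
  in the series itself.\<close>

lemma cos_series_continuous: "continuous_on ({0..1} \<times> UNIV) (\<lambda>(r, \<theta>). cos_series r \<theta>)"
proof -
  have "uniform_limit ({0..1} \<times> (UNIV :: real set))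
     (\<lambda>N p. \<Sum>n<N. fst p ^ Suc n * cos (of_nat (Suc n) * snd p) / (of_nat (Suc n))\<^sup>2)
     (\<lambda>p. \<Sum>n. fst p ^ Suc n * cos (of_nat (Suc n) * snd p) / (of_nat (Suc n))\<^sup>2) sequentially"

    by (rule Weierstrass_m_test[OF _ summable_inv_squares]) (rule cos_series_bound, auto)
  hence "continuous_on ({0..1} \<times> (UNIV :: real set)) (\<lambda>p. \<Sum>n. fst p ^ Suc n * cos (of_nat (Suc n) * snd p) / (of_nat (Suc n))\<^sup>2)"
    by (rule uniform_limit_theorem[rotated])
       (auto intro!: always_eventually continuous_intros simp del: of_nat_Suc)
  thus ?thesis by (simp add: cos_series_def case_prod_unfold)
qed

text \<open>For r < 1 a geometric series majorizes the termwise derivative, which is the imaginary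
  part of Ln (1 - w) = -(w + w^2 / 2 + ...) at w = r e^(i \<theta>).\<close>

lemma cos_series_deriv:
  assumes r: "0 \<le> r" "r < 1"
  shows "(cos_series r has_field_derivative Im (Ln (1 - of_real r * cis \<theta>))) (at \<theta>)"
proof -
  define f where "f = (\<lambda>n \<theta>. r ^ Suc n * cos (of_nat (Suc n) * \<theta>) / (of_nat (Suc n))\<^sup>2)"
  define f' where "f' = (\<lambda>n \<theta>. - (r ^ Suc n * sin (of_nat (Suc n) * \<theta>) / of_nat (Suc n)))"
  have der: "((\<lambda>\<theta>. \<Sum>n. f n \<theta>) has_field_derivative (\<Sum>n. f' n \<theta>)) (at \<theta>)"
  proof (rule has_field_derivative_series'(2)[where S = UNIV])
    show "(f n has_field_derivative f' n x) (at x within UNIV)" for n x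
      unfolding f_def f'_def
      by (auto intro!: derivative_eq_intros simp del: power_Suc of_nat_Suc simp: field_simps power2_eq_square)
    show "uniformly_convergent_on UNIV (\<lambda>n x. \<Sum>i<n. f' i x)"
    proof (rule Weierstrass_m_test')
      show "summable (\<lambda>n. r ^ Suc n)" using r summable_Suc_iff[of "\<lambda>n. r ^ n"] by (simp add: summable_geometric del: power_Suc)
      show "norm (f' n x) \<le> r ^ Suc n" for n x
      proof -
        have "\<bar>sin (real (Suc n) * x)\<bar> / real (Suc n) \<le> 1"
        proof -
          have "\<bar>sin (real (Suc n) * x)\<bar> \<le> real (Suc n)" using abs_sin_le_one[of "real (Suc n) * x"] by linarith
          thus ?thesis by (simp add: divide_le_eq)
        qed
        hence "r ^ Suc n * (\<bar>sin (real (Suc n) * x)\<bar> / real (Suc n)) \<le> r ^ Suc n * 1"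
          using r by (intro mult_left_mono) auto
        thus ?thesis using r by (simp add: f'_def abs_mult del: power_Suc of_nat_Suc)
      qed
    qed
    show "summable (\<lambda>n. f n \<theta>)"
      unfolding f_def by (rule summable_comparison_test'[OF summable_inv_squares, of 0]) (rule cos_series_bound, use r in auto)
  qed auto
  have "norm (- (of_real r * cis \<theta>)) < 1" using r by (simp add: norm_mult)
  from Ln_series[OF this] have "(\<lambda>n. (- 1) ^ Suc n / of_nat n * (- (of_real r * cis \<theta>)) ^ n) sums Ln (1 + - (of_real r * cis \<theta>))" .
  hence "(\<lambda>n. (- 1) ^ Suc (Suc n) / of_nat (Suc n) * (- (of_real r * cis \<theta>)) ^ Suc n) sums Ln (1 - of_real r * cis \<theta>)"
    by (subst sums_Suc_iff) simp
  also have "(\<lambda>n. (- 1) ^ Suc (Suc n) / of_nat (Suc n) * (- (of_real r * cis \<theta>)) ^ Suc n) =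
      (\<lambda>n. - (of_real (r ^ Suc n / of_nat (Suc n)) * cis (of_nat (Suc n) * \<theta>)))"
  proof
    fix n
    have "(- (of_real r * cis \<theta>)) ^ Suc n = (-1) ^ Suc n * (of_real r * cis \<theta>) ^ Suc n"
      by (rule power_minus)
    also have "(of_real r * cis \<theta>) ^ Suc n = of_real r ^ Suc n * cis \<theta> ^ Suc n"
      by (rule power_mult_distrib)
    also have "cis \<theta> ^ Suc n = cis (of_nat (Suc n) * \<theta>)" by (rule Complex.DeMoivre)
    also have "complex_of_real r ^ Suc n = of_real (r ^ Suc n)" by (rule of_real_power[symmetric])
    finally have "(- (of_real r * cis \<theta>)) ^ Suc n = (-1) ^ Suc n * (of_real (r ^ Suc n) * cis (of_nat (Suc n) * \<theta>))" .
    moreover have "(-1 :: complex) ^ Suc (Suc n) * (-1) ^ Suc n = -1"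
      by (simp add: power_add[symmetric] mult_2[symmetric])
    ultimately show "(- 1) ^ Suc (Suc n) / of_nat (Suc n) * (- (of_real r * cis \<theta>)) ^ Suc n =
       - (of_real (r ^ Suc n / of_nat (Suc n)) * cis (of_nat (Suc n) * \<theta>))"
      by (simp del: power_Suc of_nat_Suc add: divide_simps mult.assoc[symmetric])
  qed
  finally have "(\<lambda>n. Im (- (of_real (r ^ Suc n / of_nat (Suc n)) * cis (of_nat (Suc n) * \<theta>)))) sums Im (Ln (1 - of_real r * cis \<theta>))"
    by (rule sums_Im)
  hence "(\<lambda>n. f' n \<theta>) sums Im (Ln (1 - of_real r * cis \<theta>))"
    by (simp add: f'_def del: power_Suc of_nat_Suc)
  with der show ?thesis
    unfolding sums_iff cos_series_def[abs_def] f_def by simp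
qed

text \<open>Because 1 - e^(i \<theta>) = 2 sin (\<theta>/2) e^(i (\<theta> - pi)/2), with positive
  modulus and an argument between -pi/2 and pi/2.\<close>

lemma Im_Ln_1_minus_cis:
  assumes "0 < \<theta>" "\<theta> < 2 * pi"
  shows "Im (Ln (1 - cis \<theta>)) = (\<theta> - pi) / 2"
proof -
  have s: "sin (\<theta> / 2) > 0" using assms by (intro sin_gt_zero) auto
  have c: "cos \<theta> = 1 - 2 * sin (\<theta> / 2) ^ 2" "sin \<theta> = 2 * sin (\<theta> / 2) * cos (\<theta> / 2)"
    using cos_double_sin[of "\<theta> / 2"] sin_double[of "\<theta> / 2"] by simp_all
  have "1 - cis \<theta> = of_real (2 * sin (\<theta> / 2)) * cis ((\<theta> - pi) / 2)"
  proof -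
    have "cos ((\<theta> - pi) / 2) = sin (\<theta> / 2)" "sin ((\<theta> - pi) / 2) = - cos (\<theta> / 2)"
      by (simp_all add: diff_divide_distrib cos_diff sin_diff)
    thus ?thesis by (simp add: complex_eq_iff c power2_eq_square)
  qed
  also have "\<dots> = exp (of_real (ln (2 * sin (\<theta> / 2))) + \<i> * of_real ((\<theta> - pi) / 2))"
    using s by (simp add: exp_add exp_of_real cis_conv_exp)
  finally have "Ln (1 - cis \<theta>) = of_real (ln (2 * sin (\<theta> / 2))) + \<i> * of_real ((\<theta> - pi) / 2)"
    by (simp only:) (rule Ln_exp; use assms in simp)
  thus ?thesis by simp
qed

text \<open>The derivative \<open>h\<close> of the difference \<Phi> vanishes at r = 1 by
  \<open>Im_Ln_1_minus_cis\<close>, and \<open>h\<close> is uniformly continuous on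
  \<open>K\<close>, which avoids the logarithmic singularities at 0 and 2 pi. So the increment of
  \<Phi> from a to b is arbitrarily small as r \<rightarrow> 1.\<close>

lemma cos_series_const_aux:
  assumes "0 < a" "a \<le> b" "b < 2 * pi"
  shows "cos_series 1 b - (b - pi)\<^sup>2 / 4 = cos_series 1 a - (a - pi)\<^sup>2 / 4"
proof -
  define \<Phi> where "\<Phi> = (\<lambda>r \<theta>. cos_series r \<theta> - (\<theta> - pi)\<^sup>2 / 4)"
  define h where "h = (\<lambda>p :: real \<times> real. Im (Ln (1 - of_real (fst p) * cis (snd p))) - (snd p - pi) / 2)"
  define K where "K = {0..1::real} \<times> {a..b}"
  have "continuous_on K h"
  proof -
    have "1 - complex_of_real (fst p) * cis (snd p) \<notin> \<real>\<^sub>\<le>\<^sub>0" if "p \<in> K" for p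
    proof -
      have p: "0 \<le> fst p" "fst p \<le> 1" "0 < snd p" "snd p < 2 * pi" using that assms by (auto simp: K_def)
      have "cos (snd p) < 1"
      proof -
        have "sin (snd p / 2) > 0" using p by (intro sin_gt_zero) auto
        thus ?thesis using cos_double_sin[of "snd p / 2"] by simp
      qed
      hence "fst p * cos (snd p) < 1"
      proof (cases "cos (snd p) \<le> 0")
        case True
        hence "fst p * cos (snd p) \<le> 0" using p by (simp add: mult_nonneg_nonpos)
        thus ?thesis by linarith
      next
        case False
        hence "fst p * cos (snd p) \<le> 1 * cos (snd p)" using p by (intro mult_right_mono) auto
        thus ?thesis using \<open>cos (snd p) < 1\<close> by linarith
      qed
      thus ?thesis by (auto simp: complex_nonpos_Reals_iff)
    qed
    thus ?thesis unfolding h_def by (intro continuous_intros) auto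
  qed
  moreover have "compact K" by (simp add: K_def compact_Times)
  ultimately have uc: "uniformly_continuous_on K h" by (rule compact_uniformly_continuous)
  have h1: "h (1, \<theta>) = 0" if "\<theta> \<in> {a..b}" for \<theta>
    using Im_Ln_1_minus_cis[of \<theta>] that assms by (simp add: h_def)
  have bd: "\<bar>\<Phi> 1 b - \<Phi> 1 a\<bar> \<le> e * \<bar>b - a\<bar>" if e: "e > 0" for e
  proof -
    from uc[unfolded uniformly_continuous_on_def, rule_format, OF e]
    obtain d where "d > 0 \<and> (\<forall>x\<in>K. \<forall>x'\<in>K. dist x' x < d \<longrightarrow> dist (h x') (h x) < e)" ..
    hence d: "d > 0" "\<And>x x'. x \<in> K \<Longrightarrow> x' \<in> K \<Longrightarrow> dist x' x < d \<Longrightarrow> dist (h x') (h x) < e"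
      by simp_all
    have ineq: "norm (\<Phi> r b - \<Phi> r a) \<le> e * norm (b - a)" if r: "0 \<le> r" "r < 1" "1 - d < r" for r
    proof (rule field_differentiable_bound[of "{a..b}" "\<Phi> r" "\<lambda>\<theta>. h (r, \<theta>)"])
      fix \<theta> assume t: "\<theta> \<in> {a..b}"
      have "(\<Phi> r has_field_derivative h (r, \<theta>)) (at \<theta>)"
        unfolding \<Phi>_def h_def by (auto intro!: derivative_eq_intros cos_series_deriv r simp: field_simps)
      thus "(\<Phi> r has_field_derivative h (r, \<theta>)) (at \<theta> within {a..b})" by (rule has_field_derivative_at_within)
      have "dist (h (r, \<theta>)) (h (1, \<theta>)) < e"
        using t r d(1) by (intro d(2)) (auto simp: K_def dist_Pair_Pair dist_real_def)
      thus "norm (h (r, \<theta>)) \<le> e" using h1[OF t] by simp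
    qed (use assms in auto)
    have lim: "((\<lambda>r. \<Phi> r \<theta>) \<longlongrightarrow> \<Phi> 1 \<theta>) (at 1 within {0..1})" for \<theta>
    proof -
      have "continuous_on {0..1} (\<lambda>r. (\<lambda>(r, \<theta>). cos_series r \<theta>) (r, \<theta>))"
        by (rule continuous_on_compose2[OF cos_series_continuous]) (auto intro!: continuous_intros)
      hence "((\<lambda>r. cos_series r \<theta>) \<longlongrightarrow> cos_series 1 \<theta>) (at 1 within {0..1})" by (auto simp: continuous_on_def)
      thus ?thesis unfolding \<Phi>_def by (intro tendsto_diff tendsto_const)
    qed
    have "((\<lambda>r. norm (\<Phi> r b - \<Phi> r a)) \<longlongrightarrow> norm (\<Phi> 1 b - \<Phi> 1 a)) (at 1 within {0..1})"
      by (intro tendsto_norm tendsto_diff lim)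
    moreover have "\<forall>\<^sub>F r in at 1 within {0..1}. norm (\<Phi> r b - \<Phi> r a) \<le> e * norm (b - a)"
      unfolding eventually_at
    proof (intro exI[of _ d] conjI ballI impI)
      fix r :: real assume r: "r \<in> {0..1}" "r \<noteq> 1 \<and> dist r 1 < d"
      show "norm (\<Phi> r b - \<Phi> r a) \<le> e * norm (b - a)"
        by (rule ineq) (use r in \<open>auto simp: dist_real_def\<close>)
    qed (use d in simp)
    moreover have "at 1 within {0..1::real} \<noteq> bot"
      by (simp add: at_within_Icc_at_left)
    ultimately have "norm (\<Phi> 1 b - \<Phi> 1 a) \<le> e * norm (b - a)"
      by (intro tendsto_upperbound) auto
    thus ?thesis by simp
  qed
  have "\<bar>\<Phi> 1 b - \<Phi> 1 a\<bar> \<le> 0"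
  proof (rule field_le_epsilon)
    fix e :: real assume e: "e > 0"
    have "\<bar>\<Phi> 1 b - \<Phi> 1 a\<bar> \<le> e / (\<bar>b - a\<bar> + 1) * \<bar>b - a\<bar>" by (rule bd) (use e in auto)
    also have "\<dots> \<le> e" using e by (simp add: field_simps)
    finally show "\<bar>\<Phi> 1 b - \<Phi> 1 a\<bar> \<le> 0 + e" by simp
  qed
  thus ?thesis by (simp add: \<Phi>_def)
qed

lemma cos_series_1_0: "cos_series 1 0 = pi\<^sup>2 / 6"
  using inverse_squares_sums by (simp add: cos_series_def sums_iff add.commute)

text \<open>The constant is found at \<theta> = 0, reached by continuity, from the sum pi^2 / 6 of
  the inverse squares: pi^2 / 6 - pi^2 / 4 = -pi^2 / 12.\<close>

lemma cos_series_eq: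
  assumes "0 \<le> \<theta>" "\<theta> < 2 * pi"
  shows "cos_series 1 \<theta> = (\<theta> - pi)\<^sup>2 / 4 - pi\<^sup>2 / 12"
proof -
  define \<Phi> where "\<Phi> = (\<lambda>\<theta>. cos_series 1 \<theta> - (\<theta> - pi)\<^sup>2 / 4)"
  have "continuous_on UNIV (\<lambda>\<theta>. (\<lambda>(r, \<theta>). cos_series r \<theta>) (1, \<theta>))"
    by (rule continuous_on_compose2[OF cos_series_continuous]) (auto intro!: continuous_intros)
  hence cont: "continuous_on UNIV \<Phi>" unfolding \<Phi>_def by (auto intro!: continuous_intros)
  have c: "\<Phi> \<theta> = \<Phi> pi" if "0 < \<theta>" "\<theta> < 2 * pi" for \<theta>
  proof (cases "\<theta> \<le> pi")
    case True
    have "\<Phi> pi = \<Phi> \<theta>"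
      unfolding \<Phi>_def by (rule cos_series_const_aux) (use True that in auto)
    thus ?thesis by (rule sym)
  next
    case False
    show ?thesis
      unfolding \<Phi>_def by (rule cos_series_const_aux) (use False that in auto)
  qed
  have "(\<Phi> \<longlongrightarrow> \<Phi> 0) (at_right 0)"
    using cont by (auto simp: continuous_on_def intro: tendsto_within_subset)
  moreover have "\<forall>\<^sub>F x in at_right 0. x \<in> {0<..<2 * pi}" by (rule eventually_at_right_real) simp
  hence "\<forall>\<^sub>F x in at_right 0. \<Phi> x = \<Phi> pi"
    by (rule eventually_mono) (rule c, auto)
  hence "(\<Phi> \<longlongrightarrow> \<Phi> pi) (at_right 0)" by (rule tendsto_eventually)
  ultimately have "\<Phi> 0 = \<Phi> pi" by (intro tendsto_unique[of "at_right (0::real)"]) auto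
  have "\<Phi> \<theta> = \<Phi> 0"
  proof (cases "\<theta> = 0")
    case False
    hence "\<Phi> \<theta> = \<Phi> pi" by (intro c) (use assms in auto)
    thus ?thesis using \<open>\<Phi> 0 = \<Phi> pi\<close> by simp
  qed simp
  thus ?thesis by (simp add: \<Phi>_def cos_series_1_0 power2_eq_square field_simps)
qed

text \<open>Pairing n with -n gives twice \<open>cos_series 1\<close> at 2 pi \<open>frac x\<close>.
  The number 1/24 is the mean of \<open>theta_B\<close> over a period, the missing term n =
  0.\<close>

lemma fourier_bernoulli:
  fixes x :: real
  shows "((\<lambda>n::int. cexp2pi (of_real x * of_int n) / (of_int n)\<^sup>2) has_sum
     of_real (4 * pi\<^sup>2 * (theta_B x - 1 / 24))) (- {0})"
proof -
  define f where "f = (\<lambda>n::int. cexp2pi (of_real x * of_int n) / (of_int n)\<^sup>2)"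
  define g where "g = (\<lambda>n::nat. f (int (Suc n)))"
  define g' where "g' = (\<lambda>n::nat. f (- int (Suc n)))"
  have ng: "norm (g n) = 1 / (real (Suc n))\<^sup>2" "norm (g' n) = 1 / (real (Suc n))\<^sup>2" for n
    by (simp_all add: g_def g'_def f_def norm_divide norm_power del: of_nat_Suc)
  have sg: "summable (\<lambda>n. norm (g n))" "summable (\<lambda>n. norm (g' n))"
    unfolding ng by (rule summable_inv_squares)+
  have hg: "(g has_sum suminf g) UNIV" "(g' has_sum suminf g') UNIV"
    by (rule norm_summable_imp_has_sum[OF sg(1) summable_sums[OF summable_norm_cancel[OF sg(1)]]],
        rule norm_summable_imp_has_sum[OF sg(2) summable_sums[OF summable_norm_cancel[OF sg(2)]]])
  have "(f has_sum suminf g) ((\<lambda>n. int (Suc n)) ` UNIV)"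
    using hg(1) by (subst has_sum_reindex) (auto simp: inj_on_def o_def g_def)
  moreover have "(f has_sum suminf g') ((\<lambda>n. - int (Suc n)) ` UNIV)"
    using hg(2) by (subst has_sum_reindex) (auto simp: inj_on_def o_def g'_def)
  ultimately have "(f has_sum (suminf g + suminf g')) (range (\<lambda>n. int (Suc n)) \<union> range (\<lambda>n. - int (Suc n)))"
    by (rule has_sum_Un_disjoint) auto
  also have "range (\<lambda>n. int (Suc n)) \<union> range (\<lambda>n. - int (Suc n)) = - {0}"
  proof (intro equalityI subsetI)
    fix n :: int assume "n \<in> - {0}"
    hence "n = int (Suc (nat (n - 1))) \<or> n = - int (Suc (nat (- n - 1)))" by auto
    thus "n \<in> range (\<lambda>n. int (Suc n)) \<union> range (\<lambda>n. - int (Suc n))" by blast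
  qed auto
  also have "suminf g + suminf g' = (\<Sum>n. g n + g' n)"
    by (rule suminf_add[OF summable_norm_cancel[OF sg(1)] summable_norm_cancel[OF sg(2)]])
  also have "(\<lambda>n. g n + g' n) = (\<lambda>n. of_real (2 * (cos (real (Suc n) * (2 * pi * frac x)) / (real (Suc n))\<^sup>2)))"
  proof
    fix n
    define N where "N = Suc n"
    have e: "cexp2pi (of_real x * of_nat N) = cis (of_nat N * (2 * pi * frac x))"
    proof -
      have "cexp2pi (of_real x * of_nat N) = cexp2pi (of_real (frac x) * of_nat N) * cexp2pi (of_int (\<lfloor>x\<rfloor> * int N))"
        unfolding cexp2pi_add[symmetric] by (rule arg_cong[of _ _ cexp2pi]) (simp add: frac_def algebra_simps)
      thus ?thesis unfolding cexp2pi_int by (simp add: cis_conv_exp mult_ac)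
    qed
    have e': "cexp2pi (- (of_real x * of_nat N)) = cis (- (of_nat N * (2 * pi * frac x)))"
      unfolding cexp2pi_minus e by (rule cis_inverse)
    have "g n + g' n = (cexp2pi (of_real x * of_nat N) + cexp2pi (- (of_real x * of_nat N))) / (of_nat N)\<^sup>2"
      unfolding g_def g'_def f_def N_def by (simp add: add_divide_distrib del: of_nat_Suc)
    also have "\<dots> = of_real (2 * (cos (real N * (2 * pi * frac x)) / (real N)\<^sup>2))"
      unfolding e e' by (simp add: complex_eq_iff Re_divide_of_nat Im_divide_of_nat flip: of_nat_power)
    finally show "g n + g' n = of_real (2 * (cos (real (Suc n) * (2 * pi * frac x)) / (real (Suc n))\<^sup>2))"
      by (simp only: N_def)
  qed
  also have "(\<Sum>n. complex_of_real (2 * (cos (real (Suc n) * (2 * pi * frac x)) / (real (Suc n))\<^sup>2))) =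
     of_real (2 * cos_series 1 (2 * pi * frac x))"
  proof -
    define h where "h = (\<lambda>n. cos (real (Suc n) * (2 * pi * frac x)) / (real (Suc n))\<^sup>2)"
    have s: "summable h"
    proof (rule summable_comparison_test'[OF summable_inv_squares, of 0])
      fix n :: nat
      show "norm (h n) \<le> 1 / (real (Suc n))\<^sup>2"
        using cos_series_bound[of 1 n "2 * pi * frac x"] by (simp only: h_def power_one mult_1_left)
    qed
    have "(\<Sum>n. complex_of_real (2 * h n)) = of_real (\<Sum>n. 2 * h n)"
      by (rule suminf_of_real[OF summable_mult[OF s], symmetric])
    also have "(\<Sum>n. 2 * h n) = 2 * suminf h" by (rule suminf_mult[OF s])
    also have "suminf h = cos_series 1 (2 * pi * frac x)" by (simp only: cos_series_def h_def power_one mult_1_left)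
    finally show ?thesis by (simp only: h_def)
  qed
  also have "cos_series 1 (2 * pi * frac x) = (2 * pi * frac x - pi)\<^sup>2 / 4 - pi\<^sup>2 / 12"
    using frac_lt_1[of x] by (intro cos_series_eq) auto
  also have "2 * ((2 * pi * frac x - pi)\<^sup>2 / 4 - pi\<^sup>2 / 12) = 4 * pi\<^sup>2 * (theta_B x - 1 / 24)"
    by (simp add: theta_B_eq power2_eq_square field_simps)
  finally show ?thesis by (simp only: f_def)
qed


section \<open>Theta quotients attached to polynomials\<close>

abbreviation half_int_polys :: "real poly set" where
  "half_int_polys \<equiv> carrier half_int_poly_group"

lemma half_int_polys_iff: "p \<in> half_int_polys \<longleftrightarrow> 2 * coeff p 0 \<in> \<int> \<and> (\<forall>l\<ge>1. coeff p l \<in> \<int>)"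
  by (simp add: half_int_poly_group_def)

lemma floor_exact: "x \<in> \<int> \<Longrightarrow> of_int \<lfloor>x\<rfloor> = x"
  by (auto elim: Ints_cases)

text \<open>The pointwise product is only meaningful off its divisor, but multiplication of the factors by
  units acts on it everywhere, because \<open>x / 0 = 0\<close> and powers of \<open>0\<close> are multiplicative.\<close>

definition theta_prod :: "real poly \<Rightarrow> complex \<times> complex \<Rightarrow> complex" where
  "theta_prod p w = eta (fst w) powi \<lfloor>2 * coeff p 0\<rfloor> *
     (\<Prod>l=1..degree p. (theta (fst w) (of_nat l * snd w) / eta (fst w)) powi \<lfloor>coeff p l\<rfloor>)"

lemma theta_poly_eq: "theta_poly p = mero_nf (theta_prod p)"
  unfolding theta_poly_def by (rule arg_cong[of _ _ mero_nf]) (simp add: fun_eq_iff theta_prod_def theta_a_def)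

lemma theta_prod_upto:
  assumes "degree p \<le> M"
  shows "theta_prod p w = eta (fst w) powi \<lfloor>2 * coeff p 0\<rfloor> *
     (\<Prod>l=1..M. (theta (fst w) (of_nat l * snd w) / eta (fst w)) powi \<lfloor>coeff p l\<rfloor>)"
proof -
  have "(\<Prod>l=1..M. (theta (fst w) (of_nat l * snd w) / eta (fst w)) powi \<lfloor>coeff p l\<rfloor>) =
     (\<Prod>l=1..degree p. (theta (fst w) (of_nat l * snd w) / eta (fst w)) powi \<lfloor>coeff p l\<rfloor>)"
    using assms by (intro prod.mono_neutral_right) (auto simp: coeff_eq_0)
  thus ?thesis by (simp only: theta_prod_def)
qed

text \<open>The sets decrease in \<open>M\<close>, so finitely many generic identities hold on a
  common one.\<close>

definition nondiv :: "nat \<Rightarrow> (complex \<times> complex) set" where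
  "nondiv M = {w \<in> HC. \<forall>l\<in>{1..M}. theta (fst w) (of_nat l * snd w) \<noteq> 0}"

lemma nondiv_mono: "M \<le> N \<Longrightarrow> nondiv N \<subseteq> nondiv M"
  by (auto simp: nondiv_def)

lemma HC_fst: "w \<in> HC \<Longrightarrow> Im (fst w) > 0"
  by (simp add: HC_def upper_half_def mem_Times_iff)

lemma open_Collect_cdiff2_nonzero:
  assumes "open U" "\<And>w. w \<in> U \<Longrightarrow> cdiff2 f w"
  shows "open {w \<in> U. f w \<noteq> 0}"
proof -
  have "continuous_on U f" using assms cdiff2_isCont continuous_at_imp_continuous_on by blast
  hence "open (f -` (- {0}) \<inter> U)" using continuous_on_open_vimage[OF assms(1)] by blast
  also have "f -` (- {0}) \<inter> U = {w \<in> U. f w \<noteq> 0}" by auto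
  finally show ?thesis .
qed

lemma open_Collect_cdiff2_nonzero_finite:
  assumes "open U" "finite A" "\<And>w l. l \<in> A \<Longrightarrow> w \<in> U \<Longrightarrow> cdiff2 (f l) w"
  shows "open {w \<in> U. \<forall>l\<in>A. f l w \<noteq> 0}"
proof -
  have "{w \<in> U. \<forall>l\<in>A. f l w \<noteq> 0} = U \<inter> (\<Inter>l\<in>A. {w \<in> U. f l w \<noteq> 0})" by auto
  also have "open \<dots>"
    using assms by (intro open_Int open_INT ballI open_Collect_cdiff2_nonzero)
  finally show ?thesis .
qed

lemma cdiff2_theta_mult: "w \<in> HC \<Longrightarrow> cdiff2 (\<lambda>w. theta (fst w) (c * snd w)) w"
  by (intro cdiff2_theta_comp cdiff2_intros HC_fst)

lemma cdiff2_eta: "w \<in> HC \<Longrightarrow> cdiff2 (\<lambda>w. eta (fst w)) w"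
  by (intro cdiff2_eta_comp cdiff2_intros HC_fst)

text \<open>For fixed \<tau> the excluded z form a countable set, whereas every disc is
  uncountable.\<close>

lemma dense_open_HC_nondiv: "dense_open_HC (nondiv M)"
proof -
  have "HC \<subseteq> closure (nondiv M)"
  proof
    fix w assume w: "w \<in> HC"
    obtain t z where tz: "w = (t, z)" by force
    have t: "Im t > 0" using w by (simp add: tz HC_iff)
    define T where "T = (\<lambda>(l, u, v). (of_int u * t + of_int v) / of_nat l - z) ` (UNIV :: (nat \<times> int \<times> int) set)"
    have T: "countable T" unfolding T_def by (intro countable_image countableI_type)
    show "w \<in> closure (nondiv M)"
      unfolding closure_approachable
    proof (intro allI impI)
      fix e :: real assume e: "e > 0"
      have "uncountable (ball (0::complex) e)" using e by (rule uncountable_ball)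
      hence "\<not> ball 0 e \<subseteq> T" using countable_subset[OF _ T] by auto
      then obtain s where s: "s \<in> ball 0 e" "s \<notin> T" by blast
      have "(t, z + s) \<in> nondiv M"
        unfolding nondiv_def
      proof safe
        show "(t, z + s) \<in> HC" using t by (simp add: HC_iff)
        fix l assume l: "l \<in> {1..M}" and "theta (fst (t, z + s)) (of_nat l * snd (t, z + s)) = 0"
        then obtain u v :: int where "of_nat l * (z + s) = of_int u * t + of_int v"
          using theta_eq_0_iff[OF t] by auto
        hence "s = (of_int u * t + of_int v) / of_nat l - z" using l by (simp add: field_simps)
        thus False using s(2) unfolding T_def by (force intro: image_eqI[of _ _ "(l, u, v)"])
      qed
      moreover have "dist (t, z + s) w < e" using s(1) by (simp add: tz dist_Pair_Pair dist_norm)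
      ultimately show "\<exists>y\<in>nondiv M. dist y w < e" by blast
    qed
  qed
  moreover have "open (nondiv M)"
    unfolding nondiv_def by (rule open_Collect_cdiff2_nonzero_finite) (auto simp: open_HC cdiff2_theta_mult)
  ultimately show ?thesis by (auto simp: dense_open_HC_def nondiv_def)
qed

lemma nondiv_HC: "w \<in> nondiv M \<Longrightarrow> w \<in> HC"
  by (simp add: nondiv_def)

lemma cdiff2_theta_prod:
  assumes "w \<in> nondiv (degree p)"
  shows "cdiff2 (theta_prod p) w"
  unfolding theta_prod_def[abs_def] using assms eta_nonzero[OF HC_fst[OF nondiv_HC[OF assms]]]
  by (intro cdiff2_mult cdiff2_powi cdiff2_prod cdiff2_divide cdiff2_theta_mult cdiff2_eta) (auto simp: nondiv_def)

text \<open>The bound \<open>M\<close> stays existential because products and sums of polynomials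
  involve different degrees; any \<open>M\<close> suffices for equality of normal forms, by
  density.\<close>

definition eq_generic :: "(complex \<times> complex \<Rightarrow> complex) \<Rightarrow> (complex \<times> complex \<Rightarrow> complex) \<Rightarrow> bool" where
  "eq_generic f g \<longleftrightarrow> (\<exists>M. \<forall>w\<in>nondiv M. f w = g w)"

lemma eqgenI: "(\<And>w. w \<in> nondiv M \<Longrightarrow> f w = g w) \<Longrightarrow> eq_generic f g"
  unfolding eq_generic_def by blast

lemma eq_generic_refl: "eq_generic f f"
  by (auto simp: eq_generic_def)

lemma eq_generic_sym: "eq_generic f g \<Longrightarrow> eq_generic g f"
  unfolding eq_generic_def by metis

lemma eqgen2:
  assumes "eq_generic f g" "eq_generic f' g'"
  shows "\<exists>M. \<forall>w\<in>nondiv M. f w = g w \<and> f' w = g' w"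
proof -
  obtain M M' where M: "\<forall>w\<in>nondiv M. f w = g w" "\<forall>w\<in>nondiv M'. f' w = g' w"
    using assms by (auto simp: eq_generic_def)
  have "nondiv (max M M') \<subseteq> nondiv M" "nondiv (max M M') \<subseteq> nondiv M'"
    by (intro nondiv_mono max.cobounded1 max.cobounded2)+
  thus ?thesis using M by (intro exI[of _ "max M M'"]) blast
qed

lemma eq_generic_trans: "eq_generic f g \<Longrightarrow> eq_generic g h \<Longrightarrow> eq_generic f h"
proof -
  assume "eq_generic f g" "eq_generic g h"
  then obtain M where M: "\<forall>w\<in>nondiv M. f w = g w \<and> g w = h w"
    using eqgen2 by blast
  show ?thesis by (rule eqgenI[of M]) (use M in metis)
qed

lemma eq_generic_mult: "eq_generic f g \<Longrightarrow> eq_generic f' g' \<Longrightarrow> eq_generic (\<lambda>w. f w * f' w) (\<lambda>w. g w * g' w)"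
proof -
  assume "eq_generic f g" "eq_generic f' g'"
  then obtain M where M: "\<forall>w\<in>nondiv M. f w = g w \<and> f' w = g' w"
    using eqgen2 by blast
  show ?thesis by (rule eqgenI[of M]) (use M in metis)
qed

lemma mero_nf_eq_generic: "eq_generic f g \<Longrightarrow> mero_nf f = mero_nf g"
  unfolding eq_generic_def using mero_nf_cong[OF dense_open_HC_nondiv] by blast

lemma eq_generic_mero_nf:
  assumes "\<And>w. w \<in> nondiv M \<Longrightarrow> cdiff2 f w"
  shows "eq_generic (mero_nf f) f"
  by (rule eqgenI[of M]) (rule mero_nf_dense_eq[OF dense_open_HC_nondiv assms])

text \<open>Integrality makes the floors additive, and off the divisor the bases are nonzero, so
  that integer powers multiply.\<close>

lemma theta_prod_add:
  assumes p: "p \<in> half_int_polys" and q: "q \<in> half_int_polys"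
  shows "eq_generic (theta_prod (p + q)) (\<lambda>w. theta_prod p w * theta_prod q w)"
proof (rule eqgenI)
  fix w assume w: "w \<in> nondiv (max (degree p) (degree q))"
  define M where "M = max (degree p) (degree q)"
  have e: "eta (fst w) \<noteq> 0" using eta_nonzero[OF HC_fst[OF nondiv_HC[OF w]]] .
  have f0: "\<lfloor>2 * coeff (p + q) 0\<rfloor> = \<lfloor>2 * coeff p 0\<rfloor> + \<lfloor>2 * coeff q 0\<rfloor>"
    using p q by (auto simp: half_int_polys_iff distrib_left elim!: Ints_cases)
  have fl: "\<lfloor>coeff (p + q) l\<rfloor> = \<lfloor>coeff p l\<rfloor> + \<lfloor>coeff q l\<rfloor>" if "l \<ge> 1" for l
  proof -
    have "coeff p l \<in> \<int>" "coeff q l \<in> \<int>" using p q that by (auto simp: half_int_polys_iff)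
    thus ?thesis by (auto elim!: Ints_cases)
  qed
  have "theta_prod (p + q) w = eta (fst w) powi \<lfloor>2 * coeff (p + q) 0\<rfloor> *
     (\<Prod>l=1..M. (theta (fst w) (of_nat l * snd w) / eta (fst w)) powi \<lfloor>coeff (p + q) l\<rfloor>)"
    by (rule theta_prod_upto) (simp add: M_def degree_add_le)
  also have "\<dots> = (eta (fst w) powi \<lfloor>2 * coeff p 0\<rfloor> * eta (fst w) powi \<lfloor>2 * coeff q 0\<rfloor>) *
     (\<Prod>l=1..M. (theta (fst w) (of_nat l * snd w) / eta (fst w)) powi \<lfloor>coeff p l\<rfloor> *
                 (theta (fst w) (of_nat l * snd w) / eta (fst w)) powi \<lfloor>coeff q l\<rfloor>)"
  proof (intro arg_cong2[of _ _ _ _ "(*)"] prod.cong refl)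
    show "eta (fst w) powi \<lfloor>2 * coeff (p + q) 0\<rfloor> = eta (fst w) powi \<lfloor>2 * coeff p 0\<rfloor> * eta (fst w) powi \<lfloor>2 * coeff q 0\<rfloor>"
      unfolding f0 using e by (intro power_int_add) simp
    fix l assume l: "l \<in> {1..M}"
    have "theta (fst w) (of_nat l * snd w) / eta (fst w) \<noteq> 0"
      using w l e by (auto simp: nondiv_def M_def)
    moreover have "l \<ge> 1" using l by simp
    ultimately show "(theta (fst w) (of_nat l * snd w) / eta (fst w)) powi \<lfloor>coeff (p + q) l\<rfloor> =
       (theta (fst w) (of_nat l * snd w) / eta (fst w)) powi \<lfloor>coeff p l\<rfloor> *
                 (theta (fst w) (of_nat l * snd w) / eta (fst w)) powi \<lfloor>coeff q l\<rfloor>"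
      by (subst fl) (auto intro: power_int_add)
  qed
  also have "\<dots> = theta_prod p w * theta_prod q w"
    unfolding prod.distrib theta_prod_upto[of p M, OF max.cobounded1[of "degree p" "degree q", folded M_def]]
      theta_prod_upto[of q M, OF max.cobounded2[of "degree q" "degree p", folded M_def]]
    by (simp only: mult_ac)
  finally show "theta_prod (p + q) w = theta_prod p w * theta_prod q w" .
qed

lemma theta_prod_0: "theta_prod 0 w = 1"
  by (simp add: theta_prod_def)

text \<open>The weight is half of \<open>exp_eta p\<close>, the index half of \<open>exp_sq p\<close>.\<close>

definition exp_eta :: "real poly \<Rightarrow> int" where "exp_eta p = \<lfloor>2 * coeff p 0\<rfloor>"
definition exp_sum :: "real poly \<Rightarrow> int" where "exp_sum p = (\<Sum>l=1..degree p. \<lfloor>coeff p l\<rfloor>)"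
definition exp_sq :: "real poly \<Rightarrow> int" where "exp_sq p = (\<Sum>l=1..degree p. int l ^ 2 * \<lfloor>coeff p l\<rfloor>)"

lemma sum_atMost_split_0: "(\<Sum>l\<le>n::nat. f l) = f 0 + (\<Sum>l=1..n. f l)" for f :: "nat \<Rightarrow> 'a::comm_monoid_add"
proof -
  have "{..n} = insert 0 {1..n}" by auto
  thus ?thesis by simp
qed

lemma pderiv_sum: "pderiv (\<Sum>i\<in>A. f i) = (\<Sum>i\<in>A. pderiv (f i))"
  by (induction A rule: infinite_finite_induct) (auto simp: pderiv_add)

text \<open>For the index: on t^l the functional p'(1) + p''(1) takes the value l + l (l - 1) =
  l^2.\<close>

lemma half_int_polys_poly_values:
  assumes p: "p \<in> half_int_polys"
  shows "poly p 0 = of_int (exp_eta p) / 2"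
    and "2 * poly p 1 = of_int (exp_eta p + 2 * exp_sum p)"
    and "poly (pderiv p) 1 + poly (pderiv (pderiv p)) 1 = of_int (exp_sq p)"
proof -
  have c0: "of_int \<lfloor>2 * coeff p 0\<rfloor> = 2 * coeff p 0" using p by (intro floor_exact) (simp add: half_int_polys_iff)
  have cl: "of_int \<lfloor>coeff p l\<rfloor> = coeff p l" if "l \<ge> 1" for l using p that by (intro floor_exact) (simp add: half_int_polys_iff)
  show "poly p 0 = of_int (exp_eta p) / 2" by (simp add: poly_0_coeff_0 exp_eta_def c0)
  have "poly p 1 = (\<Sum>l\<le>degree p. coeff p l)" by (simp add: poly_altdef)
  also have "\<dots> = coeff p 0 + (\<Sum>l=1..degree p. coeff p l)" by (rule sum_atMost_split_0)
  also have "(\<Sum>l=1..degree p. coeff p l) = of_int (exp_sum p)"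
    unfolding exp_sum_def of_int_sum by (intro sum.cong) (auto simp: cl)
  finally show "2 * poly p 1 = of_int (exp_eta p + 2 * exp_sum p)" by (simp add: exp_eta_def c0)
  define d1 where "d1 = (\<lambda>n. of_nat (Suc n) * coeff p (Suc n))"
  have P: "poly (pderiv p) 1 + poly (pderiv (pderiv p)) 1 = (\<Sum>l\<le>degree p. of_nat l ^ 2 * coeff p l)"
  proof -
    have m: "p = (\<Sum>l\<le>degree p. monom (coeff p l) l)" by (rule poly_as_sum_of_monoms[symmetric])
    have "poly (pderiv (monom c l)) 1 + poly (pderiv (pderiv (monom c l))) 1 = of_nat l ^ 2 * c" for c :: real and l
      by (cases l) (auto simp: pderiv_monom poly_monom algebra_simps power2_eq_square)
    hence "(\<Sum>l\<le>degree p. poly (pderiv (monom (coeff p l) l)) 1 + poly (pderiv (pderiv (monom (coeff p l) l))) 1) =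
       (\<Sum>l\<le>degree p. of_nat l ^ 2 * coeff p l)" by simp
    thus ?thesis by (subst (1 2) m) (simp add: pderiv_sum poly_sum sum.distrib)
  qed
  also have "\<dots> = (\<Sum>l=1..degree p. of_nat l ^ 2 * coeff p l)" by (subst sum_atMost_split_0) simp
  also have "\<dots> = of_int (exp_sq p)"
    unfolding exp_sq_def of_int_sum by (intro sum.cong) (auto simp: cl)
  finally show "poly (pderiv p) 1 + poly (pderiv (pderiv p)) 1 = of_int (exp_sq p)" .
qed

text \<open>The common shape of the modular law and the lattice law: each factor is multiplied by a
  number of its own.\<close>

lemma theta_prod_scale:
  assumes "eta (fst w') = \<alpha> * eta (fst w)"
    and "\<And>l. l \<in> {1..degree p} \<Longrightarrow> theta (fst w') (of_nat l * snd w') / eta (fst w') = \<beta> l * (theta (fst w) (of_nat l * snd w) / eta (fst w))"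
  shows "theta_prod p w' = \<alpha> powi exp_eta p * (\<Prod>l=1..degree p. \<beta> l powi \<lfloor>coeff p l\<rfloor>) * theta_prod p w"
proof -
  have "theta_prod p w' = (\<alpha> * eta (fst w)) powi \<lfloor>2 * coeff p 0\<rfloor> *
     (\<Prod>l=1..degree p. (\<beta> l * (theta (fst w) (of_nat l * snd w) / eta (fst w))) powi \<lfloor>coeff p l\<rfloor>)"
    unfolding theta_prod_def
  proof (intro arg_cong2[of _ _ _ _ "(*)"] prod.cong refl)
    show "eta (fst w') powi \<lfloor>2 * coeff p 0\<rfloor> = (\<alpha> * eta (fst w)) powi \<lfloor>2 * coeff p 0\<rfloor>"
      by (simp only: assms(1))
    fix l assume "l \<in> {1..degree p}"
    thus "(theta (fst w') (of_nat l * snd w') / eta (fst w')) powi \<lfloor>coeff p l\<rfloor> =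
      (\<beta> l * (theta (fst w) (of_nat l * snd w) / eta (fst w))) powi \<lfloor>coeff p l\<rfloor>"
      by (simp only: assms(2))
  qed
  thus ?thesis by (simp only: theta_prod_def exp_eta_def power_int_mult_distrib prod.distrib mult_ac)
qed

lemma prod_power_int:
  fixes b :: "'a :: field"
  assumes "b \<noteq> 0"
  shows "(\<Prod>l\<in>A. b powi f l) = b powi (\<Sum>l\<in>A. f l)"
  by (induction A rule: infinite_finite_induct) (use assms in \<open>auto simp: power_int_add\<close>)

text \<open>All exponents are proportional to l^2, so the product depends on the coefficients only
  through \<open>exp_sum\<close> and \<open>exp_sq\<close>.\<close>

lemma prod_gauss_factor:
  assumes "b \<noteq> 0"
  shows "(\<Prod>l=1..degree p. (b * cexp2pi (of_nat l ^ 2 * X)) powi \<lfloor>coeff p l\<rfloor>) =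
     b powi exp_sum p * cexp2pi (of_int (exp_sq p) * X)"
proof -
  have "(\<Prod>l=1..degree p. cexp2pi (of_nat l ^ 2 * X) powi \<lfloor>coeff p l\<rfloor>) =
     (\<Prod>l=1..degree p. cexp2pi X powi (int l ^ 2 * \<lfloor>coeff p l\<rfloor>))"
    unfolding cexp2pi_powi by (intro prod.cong refl arg_cong[of _ _ cexp2pi]) simp
  also have "\<dots> = cexp2pi X powi exp_sq p" unfolding exp_sq_def by (rule prod_power_int) simp
  finally show ?thesis
    unfolding power_int_mult_distrib prod.distrib exp_sum_def prod_power_int[OF assms] cexp2pi_powi by simp
qed

context modular_matrix
begin

lemma csqrt_J_field_differentiable:
  assumes t: "Im t > 0"
  shows "(\<lambda>t. csqrt (J t)) field_differentiable at t"
proof (cases "c = 0")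
  case True
  hence Jc: "J t = of_int d" for t unfolding J_def by (simp add: True)
  show ?thesis unfolding Jc by (rule field_differentiable_const)
next
  case False
  hence "J t \<notin> \<real>\<^sub>\<le>\<^sub>0" using t by (auto simp: J_def complex_nonpos_Reals_iff)
  from DERIV_chain2[OF has_field_derivative_csqrt[OF this] J_deriv] show ?thesis
    unfolding field_differentiable_def by blast
qed

text \<open>With v = \<open>eta_mult a b c d\<close>, the quotient theta_l / eta has weight 0,
  multiplier v^3 / v = v^2 and index l^2 / 2; hence only the power of \<open>eta\<close> contributes
  to the weight.\<close>

lemma theta_prod_mob:
  assumes t: "Im t > 0"
  shows "theta_prod p (mob t, z / J t) = eta_mult a b c d powi (exp_eta p + 2 * exp_sum p) *
     csqrt (J t) powi exp_eta p * cexp2pi (of_int (exp_sq p) * (of_int c * z\<^sup>2 / (2 * J t))) * theta_prod p (t, z)"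
proof -
  define v where "v = eta_mult a b c d"
  define s where "s = csqrt (J t)"
  have v: "v \<noteq> 0" unfolding v_def by (rule eta_mult_nz)
  have s: "s \<noteq> 0" using J_nz[OF t] by (simp add: s_def)
  define X where "X = of_int c * z\<^sup>2 / (2 * J t)"
  have "theta_prod p (mob t, z / J t) = (v * s) powi exp_eta p *
     (\<Prod>l=1..degree p. (v ^ 2 * cexp2pi (of_nat l ^ 2 * X)) powi \<lfloor>coeff p l\<rfloor>) * theta_prod p (t, z)"
  proof (rule theta_prod_scale)
    show e: "eta (fst (mob t, z / J t)) = v * s * eta (fst (t, z))" using eta_mob[OF t] by (simp add: v_def s_def)
    fix l
    have "theta (mob t) (of_nat l * z / J t) = v ^ 3 * s * cexp2pi (of_int c * (of_nat l * z)\<^sup>2 / (2 * J t)) * theta t (of_nat l * z)"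
      unfolding v_def s_def by (rule theta_mob_eta_mult[OF t])
    also have "of_int c * (of_nat l * z)\<^sup>2 / (2 * J t) = of_nat l ^ 2 * X"
      by (simp add: X_def power_mult_distrib mult_ac)
    finally have th: "theta (mob t) (of_nat l * z / J t) = v ^ 3 * s * cexp2pi (of_nat l ^ 2 * X) * theta t (of_nat l * z)" .
    have e': "eta (mob t) = v * s * eta t" using e by simp
    have "theta (mob t) (of_nat l * (z / J t)) / eta (mob t) = v ^ 3 * s * cexp2pi (of_nat l ^ 2 * X) * theta t (of_nat l * z) / (v * s * eta t)"
      unfolding e' times_divide_eq_right th ..
    also have "\<dots> = v ^ 2 * cexp2pi (of_nat l ^ 2 * X) * (theta t (of_nat l * z) / eta t)"
      using v s eta_nonzero[OF t] by (simp add: field_simps power2_eq_square power3_eq_cube del: norm_exp_eq_Re)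
    finally show "theta (fst (mob t, z / J t)) (of_nat l * snd (mob t, z / J t)) / eta (fst (mob t, z / J t)) =
      v ^ 2 * cexp2pi (of_nat l ^ 2 * X) * (theta (fst (t, z)) (of_nat l * snd (t, z)) / eta (fst (t, z)))" by simp
  qed
  also have "(\<Prod>l=1..degree p. (v ^ 2 * cexp2pi (of_nat l ^ 2 * X)) powi \<lfloor>coeff p l\<rfloor>) =
     (v ^ 2) powi exp_sum p * cexp2pi (of_int (exp_sq p) * X)"
    by (rule prod_gauss_factor) (use v in simp)
  also have "(v ^ 2) powi exp_sum p = v powi (2 * exp_sum p)" by (simp add: power_int_mult)
  also have "(v * s) powi exp_eta p * (v powi (2 * exp_sum p) * cexp2pi (of_int (exp_sq p) * X)) * theta_prod p (t, z) =
     (v powi exp_eta p * v powi (2 * exp_sum p)) * s powi exp_eta p * cexp2pi (of_int (exp_sq p) * X) * theta_prod p (t, z)"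
    by (simp only: power_int_mult_distrib mult_ac)
  also have "v powi exp_eta p * v powi (2 * exp_sum p) = v powi (exp_eta p + 2 * exp_sum p)"
    using v by (simp add: power_int_add)
  finally show ?thesis by (simp only: v_def s_def X_def)
qed

lemma modular_matrix_inverse: "modular_matrix d (-b) (-c) a"
  by unfold_locales (use det in \<open>simp add: mult.commute\<close>)

lemma mob_inverse:
  assumes t: "Im t > 0"
  shows "J (modular_matrix.mob d (-b) (-c) a t) * modular_matrix.J (-c) a t = 1"
    and "mob (modular_matrix.mob d (-b) (-c) a t) = t"
proof -
  interpret I: modular_matrix d "-b" "-c" a by (rule modular_matrix_inverse)
  have nz: "I.J t \<noteq> 0" by (rule I.J_nz[OF t])
  have "J (I.mob t) * I.J t = of_int c * (of_int d * t + of_int (-b)) + of_int d * I.J t"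
    using nz by (simp add: J_def I.mob_def field_simps)
  also have "\<dots> = of_int a * of_int d - of_int b * of_int c" by (simp add: I.J_def algebra_simps)
  finally show 1: "J (I.mob t) * I.J t = 1" unfolding det' .
  have "(of_int a * I.mob t + of_int b) * I.J t = of_int a * (of_int d * t + of_int (-b)) + of_int b * I.J t"
    using nz by (simp add: I.mob_def field_simps)
  also have "\<dots> = (of_int a * of_int d - of_int b * of_int c) * t" by (simp add: I.J_def algebra_simps)
  finally have 2: "(of_int a * I.mob t + of_int b) * I.J t = t" unfolding det' by simp
  have "mob (I.mob t) = (of_int a * I.mob t + of_int b) * I.J t / (J (I.mob t) * I.J t)"
    using nz by (simp add: mob_def)
  thus "mob (I.mob t) = t" unfolding 1 2 by simp
qed

lemma cdiff2_mob: "w \<in> HC \<Longrightarrow> cdiff2 (\<lambda>w. mob (fst w)) w"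
proof (rule cdiff2_compose1[of fst w mob])
  assume "w \<in> HC"
  from mob_deriv[OF HC_fst[OF this]] show "mob field_differentiable at (fst w)"
    unfolding field_differentiable_def by blast
qed simp

lemma cdiff2_J: "cdiff2 (\<lambda>w. J (fst w)) w"
  unfolding J_def by (intro cdiff2_intros)

text \<open>The law of the raw product passes to the normal form by
  \<open>mero_nf_transport\<close>, with \<open>psi\<close> built from the inverse matrix.\<close>

lemma theta_poly_mob:
  assumes t: "Im t > 0"
  shows "theta_poly p (mob t, z / J t) = eta_mult a b c d powi (exp_eta p + 2 * exp_sum p) *
     csqrt (J t) powi exp_eta p * cexp2pi (of_int (exp_sq p) * (of_int c * z\<^sup>2 / (2 * J t))) * theta_poly p (t, z)"
proof -
  interpret I: modular_matrix d "-b" "-c" a by (rule modular_matrix_inverse)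
  define phi where "phi = (\<lambda>w. (mob (fst w), snd w / J (fst w)))"
  define psi where "psi = (\<lambda>w. (I.mob (fst w), snd w / I.J (fst w)))"
  define u where "u = (\<lambda>w. eta_mult a b c d powi (exp_eta p + 2 * exp_sum p) *
     csqrt (J (fst w)) powi exp_eta p * cexp2pi (of_int (exp_sq p) * (of_int c * (snd w)\<^sup>2 / (2 * J (fst w)))))"
  have "mero_nf (theta_prod p) (phi (t, z)) = u (t, z) * mero_nf (theta_prod p) (t, z)"
  proof (rule mero_nf_transport[of phi psi u])
    fix w assume w: "w \<in> HC"
    note fw = HC_fst[OF w]
    show "cdiff2 (\<lambda>w. fst (phi w)) w" unfolding phi_def fst_conv by (rule cdiff2_mob[OF w])
    show "cdiff2 (\<lambda>w. fst (psi w)) w" unfolding psi_def fst_conv by (rule I.cdiff2_mob[OF w])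
    show "cdiff2 (\<lambda>w. snd (phi w)) w" unfolding phi_def snd_conv
      by (intro cdiff2_divide cdiff2_snd cdiff2_J J_nz fw)
    show "cdiff2 (\<lambda>w. snd (psi w)) w" unfolding psi_def snd_conv
      by (intro cdiff2_divide cdiff2_snd I.cdiff2_J I.J_nz fw)
    show "phi w \<in> HC" "psi w \<in> HC" unfolding phi_def psi_def HC_iff by (rule Im_mob_pos[OF fw], rule I.Im_mob_pos[OF fw])
    show "phi (psi w) = w"
      using mob_inverse[OF fw] I.J_nz[OF fw] by (simp add: phi_def psi_def field_simps prod_eq_iff)
    show "psi (phi w) = w"
      using I.mob_inverse[OF fw] J_nz[OF fw] by (simp add: phi_def psi_def field_simps prod_eq_iff)
    have "cdiff2 (\<lambda>w. csqrt (J (fst w))) w"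
      by (rule cdiff2_compose1[of fst w "\<lambda>t. csqrt (J t)"]) (simp_all add: csqrt_J_field_differentiable fw)
    thus "cdiff2 u w"
      unfolding u_def using J_nz[OF fw] by (intro cdiff2_intros cdiff2_J) auto
    show "u w \<noteq> 0" using J_nz[OF fw] eta_mult_nz by (simp add: u_def)
    show "theta_prod p (phi w) = u w * theta_prod p w"
      using theta_prod_mob[OF fw, of p "snd w"] by (simp add: phi_def u_def)
  next
    show "(t, z) \<in> HC" using t by (simp add: HC_iff)
  qed
  thus ?thesis by (simp only: theta_poly_eq phi_def u_def fst_conv snd_conv)
qed

end

lemma csqrt_powi:
  assumes "w \<noteq> 0"
  shows "csqrt w powi n = w powr (of_real (of_int n / 2))"
proof -
  have "csqrt w powi n = exp (Ln w / 2) powi n" using assms by (simp add: csqrt_exp_Ln)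
  also have "\<dots> = exp (of_int n * (Ln w / 2))" by (rule exp_power_int)
  finally show ?thesis using assms by (simp add: powr_def)
qed

lemma theta_prod_translate:
  fixes l u :: int and t z :: complex
  assumes t: "Im t > 0"
  defines "X \<equiv> of_int (l + u) / 2 - (of_int l ^ 2 * t / 2 + of_int l * z)"
  shows "theta_prod p (t, z + of_int l * t + of_int u) = cexp2pi (of_int (exp_sq p) * X) * theta_prod p (t, z)"
proof -
  have "theta_prod p (t, z + of_int l * t + of_int u) = 1 powi exp_eta p *
     (\<Prod>k=1..degree p. (1 * cexp2pi (of_nat k ^ 2 * X)) powi \<lfloor>coeff p k\<rfloor>) * theta_prod p (t, z)"
  proof (rule theta_prod_scale)
    fix k :: nat
    have "of_nat k * (z + of_int l * t + of_int u) = of_nat k * z + of_int (int k * l) * t + of_int (int k * u)"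
      by (simp add: algebra_simps)
    hence "theta t (of_nat k * (z + of_int l * t + of_int u)) = (-1) powi (int k * l + int k * u) *
       cexp2pi (- (of_int (int k * l) ^ 2 * t / 2) - of_int (int k * l) * (of_nat k * z)) * theta t (of_nat k * z)"
      by (simp only: theta_translate)
    \<comment> \<open>As k and k^2 have the same parity, the sign also becomes an exponential that
      is quadratic in k, as \<open>prod_gauss_factor\<close> requires.\<close>
    also have "(-1 :: complex) powi (int k * l + int k * u) = cexp2pi (of_int ((int k)\<^sup>2 * (l + u)) / 2)"
      unfolding cexp2pi_half_int by (simp add: minus_one_powi)
    also have "cexp2pi (of_int ((int k)\<^sup>2 * (l + u)) / 2) *
       cexp2pi (- (of_int (int k * l) ^ 2 * t / 2) - of_int (int k * l) * (of_nat k * z)) = cexp2pi (of_nat k ^ 2 * X)"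
      unfolding cexp2pi_add[symmetric] X_def
      by (rule arg_cong[of _ _ cexp2pi]) (simp add: field_simps power2_eq_square)
    finally show "theta (fst (t, z + of_int l * t + of_int u)) (of_nat k * snd (t, z + of_int l * t + of_int u)) /
        eta (fst (t, z + of_int l * t + of_int u)) =
        1 * cexp2pi (of_nat k ^ 2 * X) * (theta (fst (t, z)) (of_nat k * snd (t, z)) / eta (fst (t, z)))"
      by (simp only: fst_conv snd_conv mult_1_left times_divide_eq_right)
  qed simp
  also have "(\<Prod>k=1..degree p. (1 * cexp2pi (of_nat k ^ 2 * X)) powi \<lfloor>coeff p k\<rfloor>) = 1 powi exp_sum p * cexp2pi (of_int (exp_sq p) * X)"
    by (rule prod_gauss_factor) simp
  finally show ?thesis by simp
qed

lemma theta_poly_translate: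
  fixes l u :: int and t z :: complex
  assumes t: "Im t > 0"
  defines "X \<equiv> (\<lambda>t z. of_int (l + u) / 2 - (of_int l ^ 2 * t / 2 + of_int l * z))"
  shows "theta_poly p (t, z + of_int l * t + of_int u) = cexp2pi (of_int (exp_sq p) * X t z) * theta_poly p (t, z)"
proof -
  define phi where "phi = (\<lambda>w :: complex \<times> complex. (fst w, snd w + of_int l * fst w + of_int u))"
  define psi where "psi = (\<lambda>w :: complex \<times> complex. (fst w, snd w - of_int l * fst w - of_int u))"
  define v where "v = (\<lambda>w. cexp2pi (of_int (exp_sq p) * X (fst w) (snd w)))"
  have "mero_nf (theta_prod p) (phi (t, z)) = v (t, z) * mero_nf (theta_prod p) (t, z)"
  proof (rule mero_nf_transport[of phi psi v])
    fix w assume w: "w \<in> HC"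
    note fw = HC_fst[OF w]
    show "cdiff2 (\<lambda>w. fst (phi w)) w" "cdiff2 (\<lambda>w. snd (phi w)) w"
      "cdiff2 (\<lambda>w. fst (psi w)) w" "cdiff2 (\<lambda>w. snd (psi w)) w"
      unfolding phi_def psi_def fst_conv snd_conv by (intro cdiff2_intros)+
    show "phi w \<in> HC" "psi w \<in> HC" unfolding phi_def psi_def HC_iff by (rule fw)+
    show "phi (psi w) = w" "psi (phi w) = w" by (simp_all add: phi_def psi_def)
    show "cdiff2 v w" unfolding v_def X_def by (intro cdiff2_intros) auto
    show "v w \<noteq> 0" by (simp add: v_def)
    show "theta_prod p (phi w) = v w * theta_prod p w"
      using theta_prod_translate[OF fw, of p "snd w" l u] by (simp add: phi_def v_def X_def)
  next
    show "(t, z) \<in> HC" using t by (simp add: HC_iff)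
  qed
  thus ?thesis by (simp only: theta_poly_eq phi_def v_def fst_conv snd_conv)
qed


section \<open>Jacobi forms and orders at infinity\<close>

text \<open>On the line z = x \<tau> + y a zero of theta_l forces l y to be an integer. Hence the
  rationals serve as the exceptional set of y for all \<open>M\<close> at once.\<close>

lemma line_nondiv:
  assumes "y \<notin> \<rat>" "Im t > 0"
  shows "(t, of_real x * t + of_real y) \<in> nondiv M"
  unfolding nondiv_def
proof safe
  show "(t, of_real x * t + of_real y) \<in> HC" using assms by (simp add: HC_iff)
  fix l assume l: "l \<in> {1..M}"
    and "theta (fst (t, of_real x * t + of_real y)) (of_nat l * snd (t, of_real x * t + of_real y)) = 0"
  then obtain u v :: int where "of_nat l * (of_real x * t + of_real y) = of_int u * t + of_int v"
    using theta_eq_0_iff[OF assms(2)] by auto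
  hence "of_real (of_nat l * x) * t + of_real (of_nat l * y) = of_real (of_int u) * t + of_real (of_int v)"
    by (simp add: algebra_simps)
  hence "of_nat l * y = of_int v" by (rule lattice_unique(2)[OF assms(2)])
  hence "y = of_int v / of_nat l" using l by (simp add: field_simps)
  hence "y \<in> \<rat>" by simp
  thus False using assms by simp
qed

lemma theta_poly_nondiv:
  "w \<in> nondiv (degree p) \<Longrightarrow> theta_poly p w = theta_prod p w"
  unfolding theta_poly_eq by (rule mero_nf_dense_eq[OF dense_open_HC_nondiv cdiff2_theta_prod])

abbreviation ord_term :: "real \<Rightarrow> (complex \<times> complex \<Rightarrow> complex) \<Rightarrow> real \<Rightarrow> real \<Rightarrow> real \<Rightarrow> complex \<Rightarrow> complex" where
  "ord_term m F x y v t \<equiv> cexp2pi (- of_real v * t) *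
     (cexp2pi (of_real (m * x\<^sup>2) * t) * F (t, of_real x * t + of_real y))"

definition ord_formula :: "real poly \<Rightarrow> real \<Rightarrow> real" where
  "ord_formula p x = of_int (exp_eta p) / 24 + (\<Sum>l=1..degree p. of_int \<lfloor>coeff p l\<rfloor> * (theta_B (of_nat l * x) - 1 / 24))"

lemma cexp2pi_sum: "finite A \<Longrightarrow> (\<Prod>l\<in>A. cexp2pi (f l)) = cexp2pi (\<Sum>l\<in>A. f l)"
  by (simp add: exp_sum sum_distrib_left)

text \<open>The normalized factors have nonzero limits by \<open>theta_at_i_inf\<close> and
  \<open>eta_at_i_inf\<close>, so negative exponents do no harm in the limit of the product.\<close>

lemma theta_prod_at_i_inf:
  assumes y: "y \<notin> \<rat>"
  shows "\<exists>L. L \<noteq> 0 \<and> (ord_term (of_int (exp_sq p) / 2) (theta_prod p) x y (ord_formula p x) \<longlongrightarrow> L) at_i_inf"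
proof -
  define A where "A = (\<lambda>l::nat. \<lambda>t. cexp2pi (- of_real (theta_B (of_nat l * x)) * t) *
     (cexp2pi (of_real ((of_nat l * x)\<^sup>2 / 2) * t) * theta t (of_real (of_nat l * x) * t + of_real (of_nat l * y))))"
  define E where "E = (\<lambda>t. cexp2pi (- of_real (1 / 24) * t) * eta t)"
  have "\<exists>L. L \<noteq> 0 \<and> (A l \<longlongrightarrow> L) at_i_inf" if "l \<in> {1..degree p}" for l
  proof -
    have "of_nat l * y \<notin> \<int>"
    proof
      assume "of_nat l * y \<in> \<int>"
      then obtain v :: int where "of_nat l * y = of_int v" by (elim Ints_cases)
      hence "y = of_int v / of_nat l" using that by (simp add: field_simps)
      hence "y \<in> \<rat>" by simp
      thus False using y by simp
    qed
    from theta_at_i_inf[OF this, of "of_nat l * x"] show ?thesis unfolding A_def .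
  qed
  then obtain L where L: "\<And>l. l \<in> {1..degree p} \<Longrightarrow> L l \<noteq> 0 \<and> (A l \<longlongrightarrow> L l) at_i_inf" by metis
  define G where "G = (\<lambda>t. E t powi exp_eta p * (\<Prod>l=1..degree p. (A l t / E t) powi \<lfloor>coeff p l\<rfloor>))"
  have E: "(E \<longlongrightarrow> 1) at_i_inf" unfolding E_def by (rule eta_at_i_inf)
  have lim: "(G \<longlongrightarrow> 1 powi exp_eta p * (\<Prod>l=1..degree p. (L l / 1) powi \<lfloor>coeff p l\<rfloor>)) at_i_inf"
    unfolding G_def using L by (intro tendsto_mult tendsto_power_int tendsto_prod tendsto_divide E) auto
  have G: "G t = ord_term (of_int (exp_sq p) / 2) (theta_prod p) x y (ord_formula p x) t" for t
  proof -
    \<comment> \<open>The exponent separating the normalized quotient from theta_l / eta itself.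
      Summed against the coefficients, the parts l^2 x^2 / 2 give m x^2 and the rest gives minus the
      contribution to the order.\<close>
    define \<gamma> where "\<gamma> = (\<lambda>l::nat. (1 / 24 - theta_B (of_nat l * x)) + of_nat l ^ 2 * (x\<^sup>2 / 2))"
    have A: "A l t / E t = cexp2pi (of_real (\<gamma> l) * t) * (theta t (of_nat l * (of_real x * t + of_real y)) / eta t)" for l
    proof -
      have "of_real (of_nat l * x) * t + of_real (of_nat l * y) = of_nat l * (of_real x * t + of_real y)"
        by (simp add: algebra_simps)
      hence "A l t / E t = (cexp2pi (- of_real (theta_B (of_nat l * x)) * t) * cexp2pi (of_real ((of_nat l * x)\<^sup>2 / 2) * t) *
         inverse (cexp2pi (- of_real (1 / 24) * t))) * (theta t (of_nat l * (of_real x * t + of_real y)) / eta t)"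
        unfolding A_def E_def by (simp only: divide_inverse inverse_mult_distrib mult_ac)
      also have "cexp2pi (- of_real (theta_B (of_nat l * x)) * t) * cexp2pi (of_real ((of_nat l * x)\<^sup>2 / 2) * t) *
         inverse (cexp2pi (- of_real (1 / 24) * t)) = cexp2pi (of_real (\<gamma> l) * t)"
        unfolding cexp2pi_minus[symmetric] cexp2pi_add[symmetric]
        by (rule arg_cong[of _ _ cexp2pi]) (simp add: \<gamma>_def field_simps power_mult_distrib)
      finally show ?thesis .
    qed
    have "G t = cexp2pi (- of_real (1 / 24) * t) powi exp_eta p * (\<Prod>l=1..degree p. cexp2pi (of_real (\<gamma> l) * t) powi \<lfloor>coeff p l\<rfloor>) *
       theta_prod p (t, of_real x * t + of_real y)"
      unfolding G_def A unfolding E_def theta_prod_def fst_conv snd_conv exp_eta_def power_int_mult_distrib prod.distrib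
      by (simp only: mult_ac)
    also have "cexp2pi (- of_real (1 / 24) * t) powi exp_eta p * (\<Prod>l=1..degree p. cexp2pi (of_real (\<gamma> l) * t) powi \<lfloor>coeff p l\<rfloor>) =
       cexp2pi (- of_real (ord_formula p x) * t) * cexp2pi (of_real (of_int (exp_sq p) / 2 * x\<^sup>2) * t)"
      unfolding cexp2pi_powi cexp2pi_sum[OF finite_atLeastAtMost] cexp2pi_add[symmetric]
    proof (rule arg_cong[of _ _ cexp2pi])
      have s: "(\<Sum>l=1..degree p. of_int \<lfloor>coeff p l\<rfloor> * \<gamma> l) =
         - (\<Sum>l=1..degree p. of_int \<lfloor>coeff p l\<rfloor> * (theta_B (of_nat l * x) - 1 / 24)) + of_int (exp_sq p) * (x\<^sup>2 / 2)"
        unfolding exp_sq_def of_int_sum sum_distrib_right sum_negf[symmetric] sum.distrib[symmetric]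
        by (intro sum.cong) (simp_all add: \<gamma>_def algebra_simps)
      have "of_int (exp_eta p) * (- of_real (1 / 24) * t) + (\<Sum>l=1..degree p. of_int \<lfloor>coeff p l\<rfloor> * (of_real (\<gamma> l) * t)) =
        of_real (- (of_int (exp_eta p) / 24) + (\<Sum>l=1..degree p. of_int \<lfloor>coeff p l\<rfloor> * \<gamma> l)) * t"
        by (simp add: sum_distrib_left algebra_simps)
      also have "\<dots> = - of_real (ord_formula p x) * t + of_real (of_int (exp_sq p) / 2 * x\<^sup>2) * t"
        unfolding s ord_formula_def by (simp add: algebra_simps)
      finally show "of_int (exp_eta p) * (- of_real (1 / 24) * t) + (\<Sum>l=1..degree p. of_int \<lfloor>coeff p l\<rfloor> * (of_real (\<gamma> l) * t)) =
        - of_real (ord_formula p x) * t + of_real (of_int (exp_sq p) / 2 * x\<^sup>2) * t" .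
    qed
    finally show ?thesis by (simp only: mult.assoc)
  qed
  have "(ord_term (of_int (exp_sq p) / 2) (theta_prod p) x y (ord_formula p x) \<longlongrightarrow>
       1 powi exp_eta p * (\<Prod>l=1..degree p. (L l / 1) powi \<lfloor>coeff p l\<rfloor>)) at_i_inf"
    using lim unfolding G[abs_def] .
  moreover have "1 powi exp_eta p * (\<Prod>l=1..degree p. (L l / 1) powi \<lfloor>coeff p l\<rfloor>) \<noteq> 0"
    using L by auto
  ultimately show ?thesis by blast
qed


lemma has_ord_theta_poly:
  "has_ord_at_infinity (of_int (exp_sq p) / 2) (theta_poly p) x (ord_formula p x)"
  unfolding has_ord_at_infinity_def
proof (intro exI[of _ \<rat>] conjI allI impI)
  show "countable (\<rat> :: real set)" by (rule countable_rat)
  fix y :: real assume y: "y \<notin> \<rat>"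
  obtain L where L: "L \<noteq> 0" "(ord_term (of_int (exp_sq p) / 2) (theta_prod p) x y (ord_formula p x) \<longlongrightarrow> L) at_i_inf"
    using theta_prod_at_i_inf[OF y] by blast
  have "(ord_term (of_int (exp_sq p) / 2) (theta_poly p) x y (ord_formula p x) \<longlongrightarrow> L) at_i_inf"
  proof (rule Lim_transform_eventually[OF L(2)])
    show "\<forall>\<^sub>F t in at_i_inf. ord_term (of_int (exp_sq p) / 2) (theta_prod p) x y (ord_formula p x) t =
       ord_term (of_int (exp_sq p) / 2) (theta_poly p) x y (ord_formula p x) t"
      using eventually_at_i_inf[of 0]
    proof eventually_elim
      case (elim t)
      from theta_poly_nondiv[OF line_nondiv[OF y elim]] show ?case by (simp only:)
    qed
  qed
  thus "\<exists>L. L \<noteq> 0 \<and> (ord_term (of_int (exp_sq p) / 2) (theta_poly p) x y (ord_formula p x) \<longlongrightarrow> L) at_i_inf"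
    using L(1) by blast
qed

text \<open>If v' exceeded v, the limit for v would be that for v' times the limit 0 of e((v' - v)
  \<tau>). A common y exists because two countable sets do not cover the reals.\<close>

lemma has_ord_le:
  assumes "has_ord_at_infinity m F x v" "has_ord_at_infinity m F x v'"
  shows "v' \<le> v"
proof (rule ccontr)
  assume "\<not> v' \<le> v"
  hence lt: "v' - v > 0" by simp
  obtain Y where Y: "countable Y" "\<And>y. y \<notin> Y \<Longrightarrow> \<exists>L. L \<noteq> 0 \<and>
        (ord_term m F x y v \<longlongrightarrow> L) at_i_inf"
    using assms(1) unfolding has_ord_at_infinity_def by blast
  obtain Y' where Y': "countable Y'" "\<And>y. y \<notin> Y' \<Longrightarrow> \<exists>L. L \<noteq> 0 \<and>
        (ord_term m F x y v' \<longlongrightarrow> L) at_i_inf"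
    using assms(2) unfolding has_ord_at_infinity_def by blast
  have "countable (Y \<union> Y')" using Y Y' by simp
  hence "Y \<union> Y' \<noteq> UNIV" using uncountable_UNIV_real by metis
  then obtain y where y: "y \<notin> Y" "y \<notin> Y'" by blast
  define g where "g = (\<lambda>t. cexp2pi (of_real (m * x\<^sup>2) * t) * F (t, of_real x * t + of_real y))"
  obtain L where L: "L \<noteq> 0" "((\<lambda>t. cexp2pi (- of_real v * t) * g t) \<longlongrightarrow> L) at_i_inf"
    using Y(2)[OF y(1)] unfolding g_def by blast
  obtain L' where L': "((\<lambda>t. cexp2pi (- of_real v' * t) * g t) \<longlongrightarrow> L') at_i_inf"
    using Y'(2)[OF y(2)] unfolding g_def by blast
  have "((\<lambda>t. cexp2pi (of_real (v' - v) * t + 0) * (cexp2pi (- of_real v' * t) * g t)) \<longlongrightarrow> 0 * L') at_i_inf"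
    by (intro tendsto_mult L' cexp2pi_tendsto_0 lt)
  also have "(\<lambda>t. cexp2pi (of_real (v' - v) * t + 0) * (cexp2pi (- of_real v' * t) * g t)) = (\<lambda>t. cexp2pi (- of_real v * t) * g t)"
  proof -
    have e: "cexp2pi (of_real (v' - v) * t + 0) * cexp2pi (- of_real v' * t) = cexp2pi (- of_real v * t)" for t
      unfolding cexp2pi_add[symmetric] by (rule arg_cong[of _ _ cexp2pi]) (simp add: algebra_simps)
    have "cexp2pi (of_real (v' - v) * t + 0) * (cexp2pi (- of_real v' * t) * g t) = cexp2pi (- of_real v * t) * g t" for t
      using e[of t] by (metis mult.assoc)
    thus ?thesis by (rule ext)
  qed
  finally have "L = 0 * L'" using L(2) by (intro tendsto_unique[OF at_i_inf_neq_bot])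
  thus False using L(1) by simp
qed

lemma ord_at_infinity_eqI: "has_ord_at_infinity m F x v \<Longrightarrow> ord_at_infinity m F x = v"
  unfolding ord_at_infinity_def by (intro the_equality) (auto intro: antisym has_ord_le)

text \<open>Supplies the growth clause of \<open>meromorphic_jacobi_form\<close> from the existence
  of an order.\<close>

lemma has_ord_growth:
  assumes "has_ord_at_infinity m F x v"
  shows "\<exists>(N::real) Y. countable Y \<and> (\<forall>y. y \<notin> Y \<longrightarrow>
        (\<lambda>t. F (t, of_real x * t + of_real y)) \<in> O[at_i_inf](\<lambda>t. of_real (exp (N * Im t))))"
proof -
  obtain Y where Y: "countable Y" "\<And>y. y \<notin> Y \<Longrightarrow> \<exists>L. L \<noteq> 0 \<and>
        (ord_term m F x y v \<longlongrightarrow> L) at_i_inf"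
    using assms unfolding has_ord_at_infinity_def by blast
  define N where "N = 2 * pi * (m * x\<^sup>2 - v)"
  have "(\<lambda>t. F (t, of_real x * t + of_real y)) \<in> O[at_i_inf](\<lambda>t. of_real (exp (N * Im t)))" if y: "y \<notin> Y" for y
  proof -
    define f where "f = (\<lambda>t. F (t, of_real x * t + of_real y))"
    obtain L where L: "((\<lambda>t. cexp2pi (- of_real v * t) * (cexp2pi (of_real (m * x\<^sup>2) * t) * f t)) \<longlongrightarrow> L) at_i_inf"
      using Y(2)[OF y] unfolding f_def by blast
    hence "((\<lambda>t. norm (cexp2pi (- of_real v * t) * (cexp2pi (of_real (m * x\<^sup>2) * t) * f t))) \<longlongrightarrow> norm L) at_i_inf"
      by (rule tendsto_norm)
    hence "\<forall>\<^sub>F t in at_i_inf. norm (cexp2pi (- of_real v * t) * (cexp2pi (of_real (m * x\<^sup>2) * t) * f t)) < norm L + 1"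
      by (rule order_tendstoD) simp
    hence "\<forall>\<^sub>F t in at_i_inf. norm (f t) \<le> (norm L + 1) * norm (complex_of_real (exp (N * Im t)))"
    proof eventually_elim
      case (elim t)
      have "norm (cexp2pi (- of_real v * t) * (cexp2pi (of_real (m * x\<^sup>2) * t) * f t)) =
         norm (cexp2pi (- of_real v * t) * cexp2pi (of_real (m * x\<^sup>2) * t)) * norm (f t)"
        by (simp only: norm_mult mult.assoc)
      also have "norm (cexp2pi (- of_real v * t) * cexp2pi (of_real (m * x\<^sup>2) * t)) = exp (- (N * Im t))"
        unfolding cexp2pi_add[symmetric] norm_cexp2pi N_def by (rule arg_cong[of _ _ exp]) (simp add: algebra_simps)
      finally have "exp (- (N * Im t)) * norm (f t) < norm L + 1" using elim by simp
      hence "norm (f t) < (norm L + 1) * exp (N * Im t)" by (simp add: exp_minus field_simps)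
      thus ?case by simp
    qed
    thus ?thesis unfolding f_def by (rule bigoI)
  qed
  thus ?thesis using Y(1) by blast
qed

lemma power_int_split: "x powi n = x ^ nat n / x ^ nat (- n)" for x :: "'a :: field"
  by (simp add: power_int_def divide_inverse power_inverse)

lemma theta_poly_idem: "mero_nf (theta_poly p) = theta_poly p"
proof -
  have "eq_generic (theta_poly p) (theta_prod p)"
    unfolding theta_poly_eq by (rule eq_generic_mero_nf) (rule cdiff2_theta_prod)
  from mero_nf_eq_generic[OF this] show ?thesis by (simp only: theta_poly_eq)
qed

text \<open>Separating positive from negative exponents writes the product as a quotient of two
  functions that are holomorphic on all of \<open>HC\<close>.\<close>

lemma meromorphic_theta_poly: "meromorphic_HC (theta_poly p)"
  unfolding meromorphic_HC_def
proof (intro conjI ballI)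
  show "mero_nf (theta_poly p) = theta_poly p" by (rule theta_poly_idem)
  fix w0 assume w0: "w0 \<in> HC"
  define r where "r = (\<lambda>l w. theta (fst w) (of_nat l * snd w) / eta (fst w))"
  define g where "g = (\<lambda>w. eta (fst w) powi \<lfloor>2 * coeff p 0\<rfloor> * (\<Prod>l=1..degree p. r l w ^ nat \<lfloor>coeff p l\<rfloor>))"
  define h where "h = (\<lambda>w. \<Prod>l=1..degree p. r l w ^ nat (- \<lfloor>coeff p l\<rfloor>))"
  have r: "cdiff2 (r l) w" if "w \<in> HC" for l w
    unfolding r_def using eta_nonzero[OF HC_fst[OF that]] that
    by (intro cdiff2_divide cdiff2_theta_mult cdiff2_eta)
  have g: "cdiff2 g w" if "w \<in> HC" for w
    unfolding g_def using eta_nonzero[OF HC_fst[OF that]] that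
    by (intro cdiff2_mult cdiff2_powi cdiff2_prod cdiff2_power r cdiff2_eta) auto
  have h: "cdiff2 h w" if "w \<in> HC" for w
    unfolding h_def using that by (intro cdiff2_prod cdiff2_power r)
  have eq: "theta_prod p w = g w / h w" for w
  proof -
    have r': "theta (fst w) (of_nat l * snd w) / eta (fst w) = r l w" for l by (simp add: r_def)
    show ?thesis
      unfolding theta_prod_def g_def h_def r' power_int_split[of "r _ _"] prod_dividef
      by (simp only: times_divide_eq_right)
  qed
  define U where "U = {w \<in> HC. h w \<noteq> 0}"
  have U: "open U" unfolding U_def by (rule open_Collect_cdiff2_nonzero[OF open_HC h])
  show "\<exists>U g h. open U \<and> w0 \<in> U \<and> U \<subseteq> HC \<and> holomorphic2_on g U \<and> holomorphic2_on h U \<and>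
        U \<subseteq> closure {y\<in>U. h y \<noteq> 0} \<and> (\<forall>y\<in>U. h y \<noteq> 0 \<longrightarrow> theta_poly p y = g y / h y)"
  proof (rule exI[of _ HC], rule exI[of _ g], rule exI[of _ h], intro conjI ballI impI)
    show "open HC" "w0 \<in> HC" "HC \<subseteq> HC" using open_HC w0 by auto
    show "holomorphic2_on g HC" "holomorphic2_on h HC"
      unfolding holomorphic2_on_open[OF open_HC] using g h by auto
    have "nondiv (degree p) \<subseteq> {y \<in> HC. h y \<noteq> 0}"
    proof
      fix w assume w: "w \<in> nondiv (degree p)"
      hence "r l w \<noteq> 0" if "l \<in> {1..degree p}" for l
        using that eta_nonzero[OF HC_fst[OF nondiv_HC[OF w]]] by (auto simp: r_def nondiv_def)
      thus "w \<in> {y \<in> HC. h y \<noteq> 0}" using nondiv_HC[OF w] by (auto simp: h_def)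
    qed
    hence "closure (nondiv (degree p)) \<subseteq> closure {y \<in> HC. h y \<noteq> 0}" by (rule closure_mono)
    thus "HC \<subseteq> closure {y \<in> HC. h y \<noteq> 0}"
      using dense_open_HC_nondiv[of "degree p"] by (auto simp: dense_open_HC_def)
    fix y assume y: "y \<in> HC" "h y \<noteq> 0"
    \<comment> \<open>The domain \<open>U\<close> may be larger than \<open>nondiv\<close>, since
      factors with positive exponent may vanish on it; the quotient is still holomorphic
      there.\<close>
    have "mero_nf (theta_prod p) y = theta_prod p y"
    proof (rule mero_nf_holo[OF U])
      show "U \<subseteq> HC" "y \<in> U" using y by (auto simp: U_def)
      fix x assume "x \<in> U"
      hence "cdiff2 (\<lambda>w. g w / h w) x" by (intro cdiff2_divide g h) (auto simp: U_def)
      thus "cdiff2 (theta_prod p) x" by (simp add: eq[abs_def])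
    qed
    thus "theta_poly p y = g y / h y" by (simp add: theta_poly_eq eq)
  qed
qed

lemma jacobi_theta_poly:
  assumes p: "p \<in> half_int_polys"
  shows "meromorphic_jacobi_form (poly p 0) ((poly (pderiv p) 1 + poly (pderiv (pderiv p)) 1) / 2)
     \<lfloor>2 * poly p 1\<rfloor> (theta_poly p)"
proof -
  have k: "poly p 0 = of_int (exp_eta p) / 2" by (rule half_int_polys_poly_values(1)[OF p])
  have m: "(poly (pderiv p) 1 + poly (pderiv (pderiv p)) 1) / 2 = of_int (exp_sq p) / 2"
    by (simp only: half_int_polys_poly_values(3)[OF p])
  have h: "\<lfloor>2 * poly p 1\<rfloor> = exp_eta p + 2 * exp_sum p"
    unfolding half_int_polys_poly_values(2)[OF p] by (rule floor_of_int)
  show ?thesis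
    unfolding k m h meromorphic_jacobi_form_def
  proof (intro conjI allI ballI impI)
    show "2 * (real_of_int (exp_eta p) / 2) \<in> \<int>" "2 * (real_of_int (exp_sq p) / 2) \<in> \<int>" by simp_all
    show "meromorphic_HC (theta_poly p)" by (rule meromorphic_theta_poly)
  next
    fix a b c d :: int and t z assume t: "t \<in> upper_half" and det: "a * d - b * c = 1"
    interpret modular_matrix a b c d by unfold_locales (rule det)
    have t: "Im t > 0" using t by (simp add: upper_half_def)
    show "theta_poly p ((of_int a * t + of_int b) / (of_int c * t + of_int d), z / (of_int c * t + of_int d)) =
       eta_mult a b c d powi (exp_eta p + 2 * exp_sum p) *
       (of_int c * t + of_int d) powr of_real (of_int (exp_eta p) / 2) *
       cexp2pi (of_real (of_int (exp_sq p) / 2) * of_int c * z\<^sup>2 / (of_int c * t + of_int d)) * theta_poly p (t, z)"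
      using theta_poly_mob[OF t, of p z] unfolding csqrt_powi[OF J_nz[OF t]]
      unfolding J_def[symmetric] mob_def[symmetric] by (simp add: field_simps)
  next
    fix l u :: int and t z assume t: "t \<in> upper_half"
    have t: "Im t > 0" using t by (simp add: upper_half_def)
    have "cexp2pi (of_int (exp_sq p) * (of_int (l + u) / 2 - ((of_int l)\<^sup>2 * t / 2 + of_int l * z))) =
       cexp2pi (of_real (of_int (exp_sq p) / 2) * of_int (l + u)) *
       cexp2pi (- of_real (of_int (exp_sq p) / 2) * (of_int (l\<^sup>2) * t + 2 * of_int l * z))"
      unfolding cexp2pi_add[symmetric] by (rule arg_cong[of _ _ cexp2pi]) (simp add: field_simps)
    thus "theta_poly p (t, z + of_int l * t + of_int u) =
       cexp2pi (of_real (of_int (exp_sq p) / 2) * of_int (l + u)) *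
       cexp2pi (- of_real (of_int (exp_sq p) / 2) * (of_int (l\<^sup>2) * t + 2 * of_int l * z)) * theta_poly p (t, z)"
      unfolding theta_poly_translate[OF t] by (simp only:)
  next
    fix x :: real
    show "\<exists>(N::real) Y. countable Y \<and> (\<forall>y. y \<notin> Y \<longrightarrow>
        (\<lambda>\<tau>. theta_poly p (\<tau>, of_real x * \<tau> + of_real y)) \<in> O[at_i_inf](\<lambda>\<tau>. of_real (exp (N * Im \<tau>))))"
      by (rule has_ord_growth[OF has_ord_theta_poly])
  qed
qed

lemma has_sum_finite_sum:
  fixes f :: "'a \<Rightarrow> 'b \<Rightarrow> 'c :: topological_comm_monoid_add"
  assumes "finite A" "\<And>l. l \<in> A \<Longrightarrow> (f l has_sum s l) B"
  shows "((\<lambda>n. \<Sum>l\<in>A. f l n) has_sum (\<Sum>l\<in>A. s l)) B"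
  using assms by (induction A rule: finite_induct) (auto intro: has_sum_add)

text \<open>The constant coefficient fits the pattern of the others because \<open>theta_B 0\<close>
  - 1/24 = 1/12, so that c0 / 12 is the order of eta^(2 c0).\<close>

lemma ord_formula_eq:
  assumes p: "p \<in> half_int_polys"
  shows "ord_formula p x = (\<Sum>l\<le>degree p. coeff p l * (theta_B (of_nat l * x) - 1 / 24))"
proof -
  have cl: "of_int \<lfloor>coeff p l\<rfloor> = coeff p l" if "l \<ge> 1" for l using p that by (intro floor_exact) (simp add: half_int_polys_iff)
  have c0: "of_int \<lfloor>2 * coeff p 0\<rfloor> = 2 * coeff p 0" using p by (intro floor_exact) (simp add: half_int_polys_iff)
  have "theta_B 0 = 1 / 8" by (simp add: theta_B_eq power2_eq_square)
  hence "(\<Sum>l\<le>degree p. coeff p l * (theta_B (of_nat l * x) - 1 / 24)) =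
     coeff p 0 / 12 + (\<Sum>l=1..degree p. coeff p l * (theta_B (of_nat l * x) - 1 / 24))"
    by (subst sum_atMost_split_0) simp
  also have "(\<Sum>l=1..degree p. coeff p l * (theta_B (of_nat l * x) - 1 / 24)) =
     (\<Sum>l=1..degree p. of_int \<lfloor>coeff p l\<rfloor> * (theta_B (of_nat l * x) - 1 / 24))"
    by (intro sum.cong) (auto simp: cl)
  finally show ?thesis by (simp add: ord_formula_def exp_eta_def c0)
qed

lemma ord_formula_fourier:
  assumes p: "p \<in> half_int_polys"
  shows "((\<lambda>n::int. poly (map_poly complex_of_real p) (cexp2pi (of_real x * of_int n)) / (of_int n)\<^sup>2) has_sum
     of_real (4 * pi\<^sup>2 * ord_formula p x)) (- {0})"
proof -
  have "((\<lambda>n::int. \<Sum>l\<le>degree p. of_real (coeff p l) * (cexp2pi (of_real (of_nat l * x) * of_int n) / (of_int n)\<^sup>2)) has_sum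
     (\<Sum>l\<le>degree p. of_real (coeff p l) * of_real (4 * pi\<^sup>2 * (theta_B (of_nat l * x) - 1 / 24)))) (- {0})"
    by (intro has_sum_finite_sum has_sum_cmult_right fourier_bernoulli finite_atMost)
  also have "(\<lambda>n::int. \<Sum>l\<le>degree p. of_real (coeff p l) * (cexp2pi (of_real (of_nat l * x) * of_int n) / (of_int n)\<^sup>2)) =
     (\<lambda>n::int. poly (map_poly complex_of_real p) (cexp2pi (of_real x * of_int n)) / (of_int n)\<^sup>2)"
  proof
    fix n :: int
    have "poly (map_poly complex_of_real p) (cexp2pi (of_real x * of_int n)) =
      (\<Sum>l\<le>degree p. of_real (coeff p l) * cexp2pi (of_real x * of_int n) ^ l)"
      by (simp add: poly_altdef coeff_map_poly degree_map_poly)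
    also have "\<dots> = (\<Sum>l\<le>degree p. of_real (coeff p l) * cexp2pi (of_real (of_nat l * x) * of_int n))"
      unfolding cexp2pi_power by (simp add: mult_ac)
    finally show "(\<Sum>l\<le>degree p. of_real (coeff p l) * (cexp2pi (of_real (of_nat l * x) * of_int n) / (of_int n)\<^sup>2)) =
      poly (map_poly complex_of_real p) (cexp2pi (of_real x * of_int n)) / (of_int n)\<^sup>2"
      by (simp add: sum_divide_distrib)
  qed
  also have "(\<Sum>l\<le>degree p. complex_of_real (coeff p l) * of_real (4 * pi\<^sup>2 * (theta_B (of_nat l * x) - 1 / 24))) =
     of_real (4 * pi\<^sup>2 * (\<Sum>l\<le>degree p. coeff p l * (theta_B (of_nat l * x) - 1 / 24)))"
    by (simp add: sum_distrib_left mult_ac)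
  also have "(\<Sum>l\<le>degree p. coeff p l * (theta_B (of_nat l * x) - 1 / 24)) = ord_formula p x"
    by (rule ord_formula_eq[OF p, symmetric])
  finally show ?thesis .
qed


section \<open>Weak holomorphy\<close>

definition div_sum :: "real poly \<Rightarrow> nat \<Rightarrow> int" where
  "div_sum p N = (\<Sum>l\<in>{l\<in>{1..degree p}. N dvd l}. \<lfloor>coeff p l\<rfloor>)"

text \<open>Near a point of exact torsion order \<open>N\<close> every theta factor is a unit times a power of the
  single linear form \<open>N z - u0 \<tau> - v0\<close>, whose total exponent is \<open>div_sum p N\<close>.\<close>

lemma theta_prod_local:
  fixes u0 v0 :: int
  assumes w0: "Im t0 > 0" and N: "N \<ge> 1" and tor: "of_nat N * z0 = of_int u0 * t0 + of_int v0"
    and min: "\<And>l. l \<ge> 1 \<Longrightarrow> theta t0 (of_nat l * z0) = 0 \<Longrightarrow> N dvd l"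
  defines "Lf \<equiv> (\<lambda>w. of_nat N * snd w - of_int u0 * fst w - of_int v0)"
  shows "\<exists>U g. open U \<and> (t0, z0) \<in> U \<and> U \<subseteq> HC \<and> (\<forall>w\<in>U. cdiff2 g w \<and> g w \<noteq> 0) \<and>
    (\<forall>w\<in>U \<inter> nondiv (max (degree p) N). Lf w \<noteq> 0 \<and> theta_prod p w = Lf w powi div_sum p N * g w)"
proof -
  \<comment> \<open>For l = k N one has l z = k Lf + k (u0 \<tau> + v0). Translation by the lattice
    vector gives a nonvanishing factor, and theta at k Lf is k Lf times \<open>theta_cof\<close>,
    which is nonzero at 0.\<close>
  define unit where "unit = (\<lambda>l w. if N dvd l then of_nat (l div N) * ((-1) powi (int (l div N) * u0 + int (l div N) * v0) *
      cexp2pi (- (of_int (int (l div N) * u0) ^ 2 * fst w / 2) - of_int (int (l div N) * u0) * (of_nat (l div N) * Lf w))) *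
      theta_cof (fst w) (of_nat (l div N) * Lf w) else theta (fst w) (of_nat l * snd w))"
  have eq: "theta (fst w) (of_nat l * snd w) = (if N dvd l then Lf w else 1) * unit l w" if w: "w \<in> HC" for l w
  proof (cases "N dvd l")
    case True
    define k where "k = l div N"
    have l: "l = k * N" using True by (simp add: k_def)
    have "of_nat l * snd w = of_nat k * Lf w + of_int (int k * u0) * fst w + of_int (int k * v0)"
      by (simp add: l Lf_def algebra_simps)
    hence "theta (fst w) (of_nat l * snd w) = (-1) powi (int k * u0 + int k * v0) *
      cexp2pi (- (of_int (int k * u0) ^ 2 * fst w / 2) - of_int (int k * u0) * (of_nat k * Lf w)) *
       theta (fst w) (of_nat k * Lf w)"
      by (simp only: theta_translate)
    thus ?thesis using True unfolding theta_eq_cof[OF HC_fst[OF w]] by (simp only: unit_def k_def if_True mult_ac)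
  qed (simp add: unit_def)
  have Lc: "cdiff2 Lf w" for w unfolding Lf_def by (intro cdiff2_intros)
  have uc: "cdiff2 (unit l) w" if w: "w \<in> HC" for l w
  proof (cases "N dvd l")
    case True
    thus ?thesis unfolding unit_def if_P[OF True]
      by (intro cdiff2_intros cdiff2_theta_cof_comp Lc HC_fst w) auto
  next
    case False
    thus ?thesis unfolding unit_def if_not_P[OF False] by (intro cdiff2_theta_mult w)
  qed
  have L0: "Lf (t0, z0) = 0" using tor by (simp add: Lf_def)
  have u0: "unit l (t0, z0) \<noteq> 0" if "l \<in> {1..degree p}" for l
  proof (cases "N dvd l")
    case True
    hence "l div N \<noteq> 0" using that N by (auto elim!: dvdE)
    moreover have "theta_cof t0 0 \<noteq> 0" using theta_cof_nonzero[OF w0, of 0] by simp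
    ultimately show ?thesis using True by (simp add: unit_def L0)
  next
    case False
    thus ?thesis using min[of l] that by (auto simp: unit_def)
  qed
  define U where "U = {w \<in> HC. \<forall>l\<in>{1..degree p}. unit l w \<noteq> 0}"
  define g where "g = (\<lambda>w. eta (fst w) powi \<lfloor>2 * coeff p 0\<rfloor> * (\<Prod>l=1..degree p. (unit l w / eta (fst w)) powi \<lfloor>coeff p l\<rfloor>))"
  show ?thesis
  proof (rule exI[of _ U], rule exI[of _ g], intro conjI ballI)
    show "open U" unfolding U_def by (rule open_Collect_cdiff2_nonzero_finite[OF open_HC _ uc]) auto
    show "(t0, z0) \<in> U" "U \<subseteq> HC" using w0 u0 by (auto simp: U_def HC_iff)
    fix w assume w: "w \<in> U"
    hence wH: "w \<in> HC" and wu: "\<And>l. l \<in> {1..degree p} \<Longrightarrow> unit l w \<noteq> 0" by (auto simp: U_def)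
    have e: "eta (fst w) \<noteq> 0" by (rule eta_nonzero[OF HC_fst[OF wH]])
    show "cdiff2 g w"
      unfolding g_def using e wu by (intro cdiff2_mult cdiff2_powi cdiff2_prod cdiff2_divide uc cdiff2_eta wH) auto
    show "g w \<noteq> 0" using e wu by (auto simp: g_def)
  next
    fix w assume w: "w \<in> U \<inter> nondiv (max (degree p) N)"
    hence wH: "w \<in> HC" by (auto simp: U_def)
    \<comment> \<open>The bound \<open>max (degree p) N\<close> includes the index N, even if N
      exceeds the degree, and theta_N vanishes wherever \<open>Lf\<close> does.\<close>
    show L: "Lf w \<noteq> 0"
    proof
      assume "Lf w = 0"
      hence "of_nat N * snd w = of_int u0 * fst w + of_int v0" by (simp add: Lf_def algebra_simps)
      hence "theta (fst w) (of_nat N * snd w) = 0" using theta_eq_0_iff[OF HC_fst[OF wH]] by blast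
      thus False using w N by (auto simp: nondiv_def)
    qed
    have "(\<Prod>l=1..degree p. (theta (fst w) (of_nat l * snd w) / eta (fst w)) powi \<lfloor>coeff p l\<rfloor>) =
       (\<Prod>l=1..degree p. (if N dvd l then Lf w powi \<lfloor>coeff p l\<rfloor> else 1) * (unit l w / eta (fst w)) powi \<lfloor>coeff p l\<rfloor>)"
      by (intro prod.cong refl) (simp add: eq[OF wH] power_int_mult_distrib flip: times_divide_eq_right)
    also have "\<dots> = (\<Prod>l\<in>{l\<in>{1..degree p}. N dvd l}. Lf w powi \<lfloor>coeff p l\<rfloor>) * (\<Prod>l=1..degree p. (unit l w / eta (fst w)) powi \<lfloor>coeff p l\<rfloor>)"
      by (simp only: prod.distrib prod.inter_filter finite_atLeastAtMost)
    also have "(\<Prod>l\<in>{l\<in>{1..degree p}. N dvd l}. Lf w powi \<lfloor>coeff p l\<rfloor>) = Lf w powi div_sum p N"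
      unfolding div_sum_def by (rule prod_power_int[OF L])
    finally show "theta_prod p w = Lf w powi div_sum p N * g w"
      by (simp only: theta_prod_def g_def mult_ac)
  qed
qed

lemma dense_open_HC_Int_open:
  assumes "dense_open_HC W" "open U" "U \<subseteq> HC"
  shows "U \<subseteq> closure (U \<inter> W)"
  using dense_Int_open[of W U] assms by (auto simp: dense_open_HC_def Int_commute)

text \<open>Only torsion points matter. The least positive N that carries z0 into the lattice
  divides every other such number, by division with remainder, so \<open>theta_prod_local\<close>
  applies; with a nonnegative exponent its local form is a holomorphic extension.\<close>

lemma weakly_holomorphic_if:
  assumes "\<And>N. N \<ge> 1 \<Longrightarrow> div_sum p N \<ge> 0"
  shows "weakly_holomorphic (theta_poly p)"
  unfolding weakly_holomorphic_def holomorphic2_on_open[OF open_HC]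
proof
  fix w0 assume w0: "w0 \<in> HC"
  obtain t0 z0 where tz: "w0 = (t0, z0)" by force
  have t0: "Im t0 > 0" using w0 by (simp add: tz HC_iff)
  show "cdiff2 (theta_poly p) w0"
  proof (cases "\<exists>l\<ge>1. theta t0 (of_nat l * z0) = 0")
    case False
    hence w: "w0 \<in> nondiv (degree p)" using w0 by (auto simp: nondiv_def tz)
    show ?thesis
    proof (rule cdiff2_transform[OF cdiff2_theta_prod[OF w]])
      show "open (nondiv (degree p))" using dense_open_HC_nondiv[of "degree p"] by (simp add: dense_open_HC_def)
    qed (use w theta_poly_nondiv in auto)
  next
    case True
    define P where "P = (\<lambda>l. l \<ge> 1 \<and> theta t0 (of_nat l * z0) = 0)"
    define N where "N = (LEAST l. P l)"
    have "\<exists>l. P l" using True by (auto simp: P_def)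
    hence PN: "P N" unfolding N_def by (rule LeastI_ex)
    have N: "N \<ge> 1" using PN by (simp add: P_def)
    obtain u0 v0 :: int where tor: "of_nat N * z0 = of_int u0 * t0 + of_int v0"
      using PN theta_eq_0_iff[OF t0] by (auto simp: P_def)
    have min: "N dvd l" if l: "l \<ge> 1" "theta t0 (of_nat l * z0) = 0" for l
    proof (rule ccontr)
      assume nd: "\<not> N dvd l"
      obtain u v :: int where uv: "of_nat l * z0 = of_int u * t0 + of_int v"
        using l theta_eq_0_iff[OF t0] by blast
      define r where "r = l mod N"
      define k where "k = l div N"
      have lr: "l = k * N + r" by (simp add: k_def r_def)
      have "of_nat r * z0 = of_nat l * z0 - of_nat k * (of_nat N * z0)" by (simp add: lr algebra_simps)
      also have "\<dots> = of_int (u - int k * u0) * t0 + of_int (v - int k * v0)"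
        unfolding uv tor by (simp add: algebra_simps)
      finally have "theta t0 (of_nat r * z0) = 0" using theta_eq_0_iff[OF t0] by blast
      moreover have "r \<ge> 1" using nd by (simp add: r_def dvd_eq_mod_eq_0)
      ultimately have "P r" by (simp add: P_def)
      hence "N \<le> r" unfolding N_def by (rule Least_le)
      moreover have "r < N" using N by (simp add: r_def)
      ultimately show False by simp
    qed
    define Lf where "Lf = (\<lambda>w. of_nat N * snd w - of_int u0 * fst w - of_int v0 :: complex)"
    obtain U g where U: "open U" "(t0, z0) \<in> U" "U \<subseteq> HC" "\<And>w. w \<in> U \<Longrightarrow> cdiff2 g w" and
      g: "\<And>w. w \<in> U \<inter> nondiv (max (degree p) N) \<Longrightarrow> theta_prod p w = Lf w powi div_sum p N * g w"
      using theta_prod_local[OF t0 N tor min, of p] unfolding Lf_def by blast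
    define h where "h = (\<lambda>w. Lf w powi div_sum p N * g w)"
    have h: "cdiff2 h w" if "w \<in> U" for w
      unfolding h_def Lf_def using assms[OF N] by (intro cdiff2_intros U that) auto
    have "theta_poly p w = h w" if w: "w \<in> U" for w
      unfolding theta_poly_eq
    proof (rule mero_nf_regular[of U w h "U \<inter> nondiv (max (degree p) N)"])
      show "open (U \<inter> nondiv (max (degree p) N))" using dense_open_HC_nondiv U(1) by (auto simp: dense_open_HC_def)
      show "U \<subseteq> closure (U \<inter> nondiv (max (degree p) N))" by (rule dense_open_HC_Int_open[OF dense_open_HC_nondiv U(1,3)])
      show "theta_prod p y = h y" if "y \<in> U \<inter> nondiv (max (degree p) N)" for y
        unfolding h_def by (rule g[OF that])
    qed (use U w h in auto)
    thus ?thesis using cdiff2_transform[OF h[OF U(2)] U(1,2)] by (simp add: tz)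
  qed
qed

text \<open>The test point (i, 1/N) has exact torsion order N. Were the exponent -m < 0, continuity
  would extend Lf^m F = g to this point, where the left side is 0 and \<open>g\<close> is
  not.\<close>

lemma weakly_holomorphic_only_if:
  assumes wh: "weakly_holomorphic (theta_poly p)" and N: "N \<ge> 1"
  shows "div_sum p N \<ge> 0"
proof (rule ccontr)
  assume neg: "\<not> div_sum p N \<ge> 0"
  define z0 :: complex where "z0 = 1 / of_nat N"
  have t0: "Im \<i> > 0" by simp
  have tor: "of_nat N * z0 = of_int 0 * \<i> + of_int 1" using N by (simp add: z0_def)
  have min: "N dvd l" if l: "l \<ge> 1" "theta \<i> (of_nat l * z0) = 0" for l
  proof -
    obtain u v :: int where uv: "of_nat l * z0 = of_int u * \<i> + of_int v"
      using l theta_eq_0_iff[OF t0] by blast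
    hence "of_real 0 * \<i> + of_real (of_nat l / of_nat N) = of_real (of_int u) * \<i> + of_real (of_int v)"
      by (simp add: z0_def)
    hence "real l / real N = of_int v" by (rule lattice_unique(2)[OF t0])
    hence "real_of_int (int l) = real_of_int (int N * v)" using N by (simp add: field_simps)
    hence "int l = int N * v" by (simp only: of_int_eq_iff)
    hence "int N dvd int l" by simp
    thus ?thesis by simp
  qed
  define Lf where "Lf = (\<lambda>w. of_nat N * snd w - of_int 0 * fst w - of_int 1 :: complex)"
  obtain U g where U: "open U" "(\<i>, z0) \<in> U" "U \<subseteq> HC" "\<And>w. w \<in> U \<Longrightarrow> cdiff2 g w" "\<And>w. w \<in> U \<Longrightarrow> g w \<noteq> 0" and
      g: "\<And>w. w \<in> U \<inter> nondiv (max (degree p) N) \<Longrightarrow> Lf w \<noteq> 0 \<and> theta_prod p w = Lf w powi div_sum p N * g w"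
    using theta_prod_local[OF t0 N tor min, of p] unfolding Lf_def by blast
  define m where "m = nat (- div_sum p N)"
  have m: "m > 0" "div_sum p N = - int m" using neg by (auto simp: m_def)
  have F: "cdiff2 (theta_poly p) w" if "w \<in> HC" for w
    using wh that unfolding weakly_holomorphic_def holomorphic2_on_open[OF open_HC] by blast
  have "Lf (\<i>, z0) ^ m * theta_poly p (\<i>, z0) = g (\<i>, z0)"
  proof (rule cont_eq_on_closure[OF U(1) _ _ dense_open_HC_Int_open[OF dense_open_HC_nondiv U(1,3)] _ U(2)])
    have "cdiff2 (\<lambda>w. Lf w ^ m * theta_poly p w) w" if "w \<in> U" for w
      unfolding Lf_def by (intro cdiff2_intros F subsetD[OF U(3) that])
    thus "continuous_on U (\<lambda>w. Lf w ^ m * theta_poly p w)"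
      using cdiff2_isCont continuous_at_imp_continuous_on by blast
    show "continuous_on U g" using U(4) cdiff2_isCont continuous_at_imp_continuous_on by blast
    fix w assume "w \<in> U \<inter> nondiv (max (degree p) N) \<inter> U"
    hence w: "w \<in> U \<inter> nondiv (max (degree p) N)" "w \<in> nondiv (degree p)"
      using nondiv_mono[of "degree p" "max (degree p) N"] by auto
    have "theta_poly p w = inverse (Lf w ^ m) * g w"
      using g[OF w(1)] theta_poly_nondiv[OF w(2)] by (simp add: m(2) power_int_minus)
    thus "Lf w ^ m * theta_poly p w = g w" using g[OF w(1)] by simp
  qed
  moreover have "Lf (\<i>, z0) = 0" using tor by (simp add: Lf_def)
  ultimately have "g (\<i>, z0) = 0" using m(1) by (simp add: power_0_left)
  thus False using U(2,5) by blast
qed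

text \<open>Listing the roots as e(k/N) makes this a geometric sum with ratio e(l/N).\<close>

lemma sum_root_unity_power:
  assumes N: "N > 0"
  shows "(\<Sum>\<zeta> | \<zeta> ^ N = (1::complex). \<zeta> ^ l) = (if N dvd l then of_nat N else 0)"
proof -
  define \<omega> where "\<omega> = cis (2 * pi * real l / real N)"
  have "(\<Sum>\<zeta> | \<zeta> ^ N = (1::complex). \<zeta> ^ l) = (\<Sum>k<N. cis (2 * pi * real k / real N) ^ l)"
    by (rule sum.reindex_bij_betw[OF Complex.bij_betw_roots_unity[OF N], symmetric])
  also have "\<dots> = (\<Sum>k<N. \<omega> ^ k)"
    by (intro sum.cong refl) (simp add: \<omega>_def Complex.DeMoivre mult_ac)
  also have "\<dots> = (if N dvd l then of_nat N else 0)"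
  proof (cases "N dvd l")
    case True
    then obtain k where "l = N * k" by blast
    hence "2 * pi * real l / real N = 2 * pi * real k" using N by simp
    hence "\<omega> = 1" unfolding \<omega>_def by (simp add: complex_eq_iff)
    thus ?thesis using True by simp
  next
    case False
    have "\<omega> \<noteq> 1"
    proof
      assume "\<omega> = 1"
      hence "cexp2pi (of_nat l / of_nat N) = 1" by (simp add: \<omega>_def cis_conv_exp mult_ac)
      then obtain n :: int where "complex_of_nat l / of_nat N = of_int n" using cexp2pi_eq_1_iff by blast
      hence "complex_of_int (int l) = of_int (int N * n)" using N by (simp add: field_simps)
      hence "int l = int N * n" by (simp only: of_int_eq_iff)
      hence "int N dvd int l" by simp
      thus False using False by simp
    qed
    moreover have "\<omega> ^ N = 1"
    proof -
      have "\<omega> ^ N = cis (2 * pi * real l)" using N by (simp add: \<omega>_def Complex.DeMoivre)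
      also have "\<dots> = cexp2pi (of_int (int l))" by (simp add: cis_conv_exp mult_ac)
      finally show ?thesis by (simp only: cexp2pi_int)
    qed
    ultimately show ?thesis using False by (simp add: geometric_sum)
  qed
  finally show ?thesis .
qed

text \<open>The mean over the N-th roots of unity is the real number c0 +
  \<open>div_sum p N\<close>, so the order on complex numbers reduces to that on the
  integers.\<close>

lemma weakly_holomorphic_iff:
  assumes p: "p \<in> half_int_polys"
  shows "weakly_holomorphic (theta_poly p) \<longleftrightarrow>
     (\<forall>N::nat. N > 0 \<longrightarrow> 1 / of_nat N * (\<Sum>\<zeta> | \<zeta> ^ N = 1. poly (map_poly complex_of_real p) \<zeta>) \<ge> of_real (coeff p 0))"
proof -
  have cl: "of_int \<lfloor>coeff p l\<rfloor> = coeff p l" if "l \<ge> 1" for l using p that by (intro floor_exact) (simp add: half_int_polys_iff)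
  have eq: "1 / of_nat N * (\<Sum>\<zeta> | \<zeta> ^ N = 1. poly (map_poly complex_of_real p) \<zeta>) = of_real (coeff p 0 + of_int (div_sum p N))"
    if N: "N > 0" for N :: nat
  proof -
    have "(\<Sum>\<zeta> | \<zeta> ^ N = 1. poly (map_poly complex_of_real p) \<zeta>) =
      (\<Sum>\<zeta> | \<zeta> ^ N = 1. \<Sum>l\<le>degree p. of_real (coeff p l) * \<zeta> ^ l)"
      by (simp add: poly_altdef coeff_map_poly degree_map_poly)
    also have "\<dots> = (\<Sum>l\<le>degree p. of_real (coeff p l) * (\<Sum>\<zeta> | \<zeta> ^ N = 1. \<zeta> ^ l))"
      by (subst sum.swap) (simp add: sum_distrib_left)
    also have "\<dots> = (\<Sum>l\<le>degree p. of_nat N * (if N dvd l then of_real (coeff p l) else 0))"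
      unfolding sum_root_unity_power[OF N] by (intro sum.cong) auto
    also have "\<dots> = of_nat N * (\<Sum>l\<le>degree p. if N dvd l then of_real (coeff p l) else 0)"
      by (simp only: sum_distrib_left)
    also have "(\<Sum>l\<le>degree p. if N dvd l then complex_of_real (coeff p l) else 0) =
       of_real (coeff p 0) + (\<Sum>l=1..degree p. if N dvd l then of_real (coeff p l) else 0)"
      by (subst sum_atMost_split_0) simp
    also have "(\<Sum>l=1..degree p. if N dvd l then complex_of_real (coeff p l) else 0) =
       (\<Sum>l\<in>{l\<in>{1..degree p}. N dvd l}. of_real (coeff p l))"
      by (rule sum.inter_filter[symmetric]) simp
    also have "\<dots> = of_real (of_int (div_sum p N))"
      unfolding div_sum_def of_int_sum of_real_sum by (intro sum.cong) (auto simp: cl)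
    finally show ?thesis using N by simp
  qed
  have "(1 / of_nat N * (\<Sum>\<zeta> | \<zeta> ^ N = 1. poly (map_poly complex_of_real p) \<zeta>) \<ge> of_real (coeff p 0)) \<longleftrightarrow>
      div_sum p N \<ge> 0" if "N > 0" for N
    unfolding eq[OF that] by (simp add: less_eq_complex_def)
  thus ?thesis
    using weakly_holomorphic_if[of p] weakly_holomorphic_only_if[of p] by (metis Suc_leI One_nat_def Suc_le_lessD)
qed


section \<open>The group of theta quotients\<close>

lemma half_int_polys_0: "0 \<in> half_int_polys" and half_int_polys_add: "p \<in> half_int_polys \<Longrightarrow> q \<in> half_int_polys \<Longrightarrow> p + q \<in> half_int_polys"
  and half_int_polys_uminus: "p \<in> half_int_polys \<Longrightarrow> - p \<in> half_int_polys"
  by (auto simp: half_int_polys_iff distrib_left)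

lemma theta_prod_nonzero: "w \<in> nondiv (degree p) \<Longrightarrow> theta_prod p w \<noteq> 0"
proof -
  assume w: "w \<in> nondiv (degree p)"
  have "eta (fst w) \<noteq> 0" by (rule eta_nonzero[OF HC_fst[OF nondiv_HC[OF w]]])
  thus ?thesis using w by (auto simp: theta_prod_def nondiv_def)
qed

text \<open>Carries the sign by which elements of \<open>TQ (- {0})\<close> differ from those of
  \<open>TQ {0<..}\<close>. With \<open>p = 0\<close> it is the constant \<open>s\<close>, so signs
  and quotients obey one multiplication rule.\<close>

definition signed_theta :: "complex \<Rightarrow> real poly \<Rightarrow> complex \<times> complex \<Rightarrow> complex" where
  "signed_theta s p = mero_nf (\<lambda>w. s * theta_prod p w)"

lemma signed_theta_1: "signed_theta 1 p = theta_poly p"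
  by (simp add: signed_theta_def theta_poly_eq)

lemma eq_generic_signed: "eq_generic (signed_theta s p) (\<lambda>w. s * theta_prod p w)"
  unfolding signed_theta_def by (rule eq_generic_mero_nf) (intro cdiff2_mult cdiff2_const cdiff2_theta_prod)

lemma signed_theta_mult:
  assumes "p \<in> half_int_polys" "q \<in> half_int_polys"
  shows "mero_nf (\<lambda>w. signed_theta s p w * signed_theta r q w) = signed_theta (s * r) (p + q)"
  unfolding signed_theta_def[of "s * r"]
proof (rule mero_nf_eq_generic)
  have "eq_generic (\<lambda>w. signed_theta s p w * signed_theta r q w) (\<lambda>w. (s * theta_prod p w) * (r * theta_prod q w))"
    by (intro eq_generic_mult eq_generic_signed)
  also have "(\<lambda>w. (s * theta_prod p w) * (r * theta_prod q w)) = (\<lambda>w. (s * r) * (theta_prod p w * theta_prod q w))"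
    by (simp add: mult_ac)
  finally have 1: "eq_generic (\<lambda>w. signed_theta s p w * signed_theta r q w) (\<lambda>w. (s * r) * (theta_prod p w * theta_prod q w))" .
  have 2: "eq_generic (\<lambda>w. (s * r) * (theta_prod p w * theta_prod q w)) (\<lambda>w. (s * r) * theta_prod (p + q) w)"
    by (intro eq_generic_mult eq_generic_refl eq_generic_sym[OF theta_prod_add] assms)
  show "eq_generic (\<lambda>w. signed_theta s p w * signed_theta r q w) (\<lambda>w. s * r * theta_prod (p + q) w)"
    by (rule eq_generic_trans[OF 1 2])
qed

lemma mero_nf_const: "mero_nf (\<lambda>_. s) = signed_theta s 0"
  by (simp add: signed_theta_def theta_prod_0)

lemma signed_theta_const: "w \<in> HC \<Longrightarrow> signed_theta s 0 w = s"
  unfolding mero_nf_const[symmetric] by (rule mero_nf_holo[OF open_HC]) auto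

section \<open>Constants among the theta quotients, and injectivity\<close>

lemma div_sum_uminus:
  assumes "p \<in> half_int_polys"
  shows "div_sum (- p) N = - div_sum p N"
proof -
  have "\<lfloor>coeff (- p) l\<rfloor> = - \<lfloor>coeff p l\<rfloor>" if "l \<ge> 1" for l
  proof -
    have "coeff p l \<in> \<int>" using assms that by (simp add: half_int_polys_iff)
    thus ?thesis by (auto elim!: Ints_cases)
  qed
  thus ?thesis by (simp add: div_sum_def sum_negf[symmetric])
qed

lemma div_sum_degree:
  assumes "degree p \<ge> 1"
  shows "div_sum p (degree p) = \<lfloor>coeff p (degree p)\<rfloor>"
proof -
  have "{l \<in> {1..degree p}. degree p dvd l} = {degree p}" using assms by (auto dest: dvd_imp_le)
  thus ?thesis by (simp add: div_sum_def)
qed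

lemma theta_poly_const_weakly_holomorphic:
  assumes "theta_poly p = signed_theta s 0"
  shows "weakly_holomorphic (theta_poly p)"
  unfolding weakly_holomorphic_def holomorphic2_on_open[OF open_HC]
proof
  fix w assume w: "w \<in> HC"
  show "cdiff2 (theta_poly p) w"
    by (rule cdiff2_transform[OF cdiff2_const[of s] open_HC w]) (simp add: assms signed_theta_const)
qed

text \<open>If p and -p both give constants, both are weakly holomorphic, so all
  \<open>div_sum p N\<close> vanish. At N = \<open>degree p\<close> this sum is the leading
  coefficient, which forces degree 0; the order at infinity of a nonzero constant then forces c0 =
  0.\<close>

lemma theta_poly_const_imp_0:
  assumes p: "p \<in> half_int_polys" and 1: "theta_poly p = signed_theta s 0" "s \<noteq> 0" and 2: "theta_poly (- p) = signed_theta r 0"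
  shows "p = 0"
proof -
  have d0: "degree p = 0"
  proof (rule ccontr)
    assume "degree p \<noteq> 0"
    hence d: "degree p \<ge> 1" by simp
    have ds: "div_sum p (degree p) \<ge> 0" "div_sum (- p) (degree p) \<ge> 0"
      using weakly_holomorphic_only_if[OF theta_poly_const_weakly_holomorphic[OF 1(1)] d]
        weakly_holomorphic_only_if[OF theta_poly_const_weakly_holomorphic[OF 2] d] .
    have "div_sum p (degree p) = 0" using ds unfolding div_sum_uminus[OF p] by linarith
    hence "\<lfloor>coeff p (degree p)\<rfloor> = 0" unfolding div_sum_degree[OF d] .
    moreover have "of_int \<lfloor>coeff p (degree p)\<rfloor> = coeff p (degree p)"
      using p d by (intro floor_exact) (simp add: half_int_polys_iff)
    ultimately have "coeff p (degree p) = 0" by simp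
    hence "p = 0" by simp
    thus False using d by simp
  qed
  have o1: "has_ord_at_infinity 0 (theta_poly p) 0 (of_int (exp_eta p) / 24)"
    using has_ord_theta_poly[of p 0] d0 by (simp add: exp_sq_def ord_formula_def)
  have o2: "has_ord_at_infinity 0 (theta_poly p) 0 0"
    unfolding has_ord_at_infinity_def
  proof (intro exI[of _ "{}"] conjI allI impI)
    fix y :: real
    have "((\<lambda>t. cexp2pi (- of_real 0 * t) * (cexp2pi (of_real (0 * 0\<^sup>2) * t) * theta_poly p (t, of_real 0 * t + of_real y))) \<longlongrightarrow> s) at_i_inf"
    proof (rule tendsto_eventually)
      show "\<forall>\<^sub>F t in at_i_inf. cexp2pi (- of_real 0 * t) * (cexp2pi (of_real (0 * 0\<^sup>2) * t) * theta_poly p (t, of_real 0 * t + of_real y)) = s"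
        using eventually_at_i_inf[of 0] by eventually_elim (simp add: 1(1) signed_theta_const HC_iff)
    qed
    thus "\<exists>L. L \<noteq> 0 \<and> ((\<lambda>t. cexp2pi (- of_real 0 * t) * (cexp2pi (of_real (0 * 0\<^sup>2) * t) * theta_poly p (t, of_real 0 * t + of_real y))) \<longlongrightarrow> L) at_i_inf"
      using 1(2) by blast
  qed simp
  have "of_int (exp_eta p) / 24 = (0::real)"
    by (rule antisym) (rule has_ord_le[OF o2 o1], rule has_ord_le[OF o1 o2])
  moreover have "of_int \<lfloor>2 * coeff p 0\<rfloor> = 2 * coeff p 0" using p by (intro floor_exact) (simp add: half_int_polys_iff)
  ultimately have "coeff p 0 = 0" by (simp add: exp_eta_def)
  thus "p = 0" using d0 by (metis leading_coeff_0_iff)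
qed

text \<open>Dividing one function by the other leaves a constant, since signs are their own
  inverses; so p - q falls under \<open>theta_poly_const_imp_0\<close>. A single generic point then
  compares the signs.\<close>

lemma signed_theta_inject:
  assumes p: "p \<in> half_int_polys" "q \<in> half_int_polys" and s: "s \<in> {1, -1}" "r \<in> {1, -1}"
    and eq: "signed_theta s p = signed_theta r q"
  shows "p = q" "s = r"
proof -
  have "theta_poly (p - q) = signed_theta (r * s) 0"
  proof -
    have "theta_poly (p - q) = signed_theta (s * s) (p + - q)" using s by (auto simp: signed_theta_1[symmetric])
    also have "\<dots> = mero_nf (\<lambda>w. signed_theta s p w * signed_theta s (- q) w)"
      by (rule signed_theta_mult[symmetric]) (use p half_int_polys_uminus in auto)
    also have "\<dots> = mero_nf (\<lambda>w. signed_theta r q w * signed_theta s (- q) w)" unfolding eq ..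
    also have "\<dots> = signed_theta (r * s) (q + - q)"
      by (rule signed_theta_mult) (use p half_int_polys_uminus in auto)
    finally show ?thesis by simp
  qed
  moreover have "theta_poly (- (p - q)) = signed_theta (s * r) 0"
  proof -
    have "theta_poly (- (p - q)) = signed_theta (r * r) (q + - p)" using s by (auto simp: signed_theta_1[symmetric])
    also have "\<dots> = mero_nf (\<lambda>w. signed_theta r q w * signed_theta r (- p) w)"
      by (rule signed_theta_mult[symmetric]) (use p half_int_polys_uminus in auto)
    also have "\<dots> = mero_nf (\<lambda>w. signed_theta s p w * signed_theta r (- p) w)" unfolding eq ..
    also have "\<dots> = signed_theta (s * r) (p + - p)"
      by (rule signed_theta_mult) (use p half_int_polys_uminus in auto)
    finally show ?thesis by simp
  qed
  moreover have "p - q \<in> half_int_polys" using half_int_polys_add[OF p(1) half_int_polys_uminus[OF p(2)]] by simp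
  moreover have "r * s \<noteq> 0" using s by auto
  ultimately have "p - q = 0" by (intro theta_poly_const_imp_0) auto
  thus pq: "p = q" by simp
  obtain M where M: "\<forall>w\<in>nondiv M. signed_theta s p w = s * theta_prod p w \<and> signed_theta r q w = r * theta_prod q w"
    using eqgen2[OF eq_generic_signed eq_generic_signed] by blast
  define K where "K = max M (degree p)"
  have "(\<rat> :: real set) \<noteq> UNIV" using countable_rat uncountable_UNIV_real by metis
  then obtain y :: real where "y \<notin> \<rat>" by blast
  hence "(\<i>, of_real 0 * \<i> + of_real y) \<in> nondiv K"
    by (rule line_nondiv) simp
  then obtain w where w: "w \<in> nondiv M" "w \<in> nondiv (degree p)"
    using nondiv_mono[of M K] nondiv_mono[of "degree p" K] by (auto simp: K_def)
  hence "s * theta_prod p w = r * theta_prod p w" using M eq pq by metis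
  thus "s = r" using theta_prod_nonzero[OF w(2)] by simp
qed

section \<open>From lists of theta factors to polynomials and back\<close>

definition abs_poly :: "int list \<Rightarrow> real poly" where
  "abs_poly as = (\<Sum>a\<leftarrow>as. monom 1 (nat \<bar>a\<bar>) + [:1 / 2:])"

definition quot_poly :: "int \<Rightarrow> int list \<Rightarrow> int list \<Rightarrow> real poly" where
  "quot_poly n as bs = [:of_int n / 2:] + (abs_poly as - abs_poly bs)"

definition sgn_list :: "int list \<Rightarrow> complex" where
  "sgn_list as = (\<Prod>a\<leftarrow>as. of_int (sgn a))"

lemma half_int_polys_monom: "l \<ge> 1 \<Longrightarrow> monom 1 l + [:1 / 2:] \<in> half_int_polys"
  by (auto simp: half_int_polys_iff coeff_pCons split: nat.split)

lemma half_int_polys_const: "[:of_int n / 2:] \<in> half_int_polys"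
  by (auto simp: half_int_polys_iff coeff_pCons split: nat.split)

lemma half_int_polys_abs_poly: "0 \<notin> set as \<Longrightarrow> abs_poly as \<in> half_int_polys"
  unfolding abs_poly_def by (induction as) (auto intro!: half_int_polys_add half_int_polys_monom half_int_polys_0)

lemma half_int_polys_quot_poly: "0 \<notin> set as \<Longrightarrow> 0 \<notin> set bs \<Longrightarrow> quot_poly n as bs \<in> half_int_polys"
  unfolding quot_poly_def using half_int_polys_add[OF half_int_polys_const half_int_polys_add[OF half_int_polys_abs_poly half_int_polys_uminus[OF half_int_polys_abs_poly]]] by simp

text \<open>The constant 1/2 stands for one factor \<open>eta\<close>, which cancels the denominator
  of theta_l / eta.\<close>

lemma theta_prod_monom:
  assumes l: "l \<ge> 1" and w: "w \<in> HC"
  shows "theta_prod (monom 1 l + [:1 / 2:]) w = theta (fst w) (of_nat l * snd w)"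
proof -
  have e: "eta (fst w) \<noteq> 0" by (rule eta_nonzero[OF HC_fst[OF w]])
  have "degree (monom (1::real) l + [:1 / 2:]) \<le> l" by (rule degree_add_le) (auto simp: degree_monom_eq)
  hence "theta_prod (monom 1 l + [:1 / 2:]) w = eta (fst w) powi \<lfloor>2 * coeff (monom (1::real) l + [:1 / 2:]) 0\<rfloor> *
     (\<Prod>k=1..l. (theta (fst w) (of_nat k * snd w) / eta (fst w)) powi \<lfloor>coeff (monom (1::real) l + [:1 / 2:]) k\<rfloor>)"
    by (rule theta_prod_upto)
  also have "2 * coeff (monom (1::real) l + [:1 / 2:]) 0 = 1" using l by simp
  also have "(\<Prod>k=1..l. (theta (fst w) (of_nat k * snd w) / eta (fst w)) powi \<lfloor>coeff (monom (1::real) l + [:1 / 2:]) k\<rfloor>) =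
     (\<Prod>k=1..l. if k = l then theta (fst w) (of_nat k * snd w) / eta (fst w) else 1)"
    by (intro prod.cong refl) (auto simp: coeff_pCons split: nat.split)
  also have "\<dots> = theta (fst w) (of_nat l * snd w) / eta (fst w)"
    using l by (subst prod.delta) auto
  finally show ?thesis using e by simp
qed

lemma theta_list_prod:
  assumes "0 \<notin> set as"
  shows "eq_generic (\<lambda>w. \<Prod>a\<leftarrow>as. theta (fst w) (of_int a * snd w)) (\<lambda>w. sgn_list as * theta_prod (abs_poly as) w)"
  using assms
proof (induction as)
  case Nil
  show ?case by (simp add: sgn_list_def abs_poly_def theta_prod_0 eq_generic_refl)
next
  case (Cons a as)
  have a: "a \<noteq> 0" and as: "0 \<notin> set as" using Cons.prems by auto
  define l where "l = nat \<bar>a\<bar>"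
  have l: "l \<ge> 1" using a by (simp add: l_def)
  have "eq_generic (\<lambda>w. theta (fst w) (of_int a * snd w)) (\<lambda>w. of_int (sgn a) * theta_prod (monom 1 l + [:1 / 2:]) w)"
  proof (rule eqgenI[of 0])
    fix w assume w: "w \<in> nondiv 0"
    show "theta (fst w) (of_int a * snd w) = of_int (sgn a) * theta_prod (monom 1 l + [:1 / 2:]) w"
    proof (cases "a > 0")
      case True
      hence "of_int a = (of_nat l :: complex)" by (simp add: l_def)
      thus ?thesis unfolding theta_prod_monom[OF l nondiv_HC[OF w]] using True by simp
    next
      case False
      hence "of_int a = - (of_nat l :: complex)" by (simp add: l_def)
      thus ?thesis unfolding theta_prod_monom[OF l nondiv_HC[OF w]] using False a theta_minus[of "fst w" "of_nat l * snd w"] by simp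
    qed
  qed
  from eq_generic_mult[OF this Cons.IH[OF as]]
  have "eq_generic (\<lambda>w. \<Prod>a\<leftarrow>a # as. theta (fst w) (of_int a * snd w))
     (\<lambda>w. (of_int (sgn a) * theta_prod (monom 1 l + [:1 / 2:]) w) * (sgn_list as * theta_prod (abs_poly as) w))" by simp
  also have "(\<lambda>w. (of_int (sgn a) * theta_prod (monom 1 l + [:1 / 2:]) w) * (sgn_list as * theta_prod (abs_poly as) w)) =
     (\<lambda>w. sgn_list (a # as) * (theta_prod (monom 1 l + [:1 / 2:]) w * theta_prod (abs_poly as) w))"
    by (simp add: sgn_list_def mult_ac)
  finally have 1: "eq_generic (\<lambda>w. \<Prod>a\<leftarrow>a # as. theta (fst w) (of_int a * snd w))
     (\<lambda>w. sgn_list (a # as) * (theta_prod (monom 1 l + [:1 / 2:]) w * theta_prod (abs_poly as) w))" .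
  have 2: "eq_generic (\<lambda>w. sgn_list (a # as) * (theta_prod (monom 1 l + [:1 / 2:]) w * theta_prod (abs_poly as) w))
     (\<lambda>w. sgn_list (a # as) * theta_prod ((monom 1 l + [:1 / 2:]) + abs_poly as) w)"
    by (intro eq_generic_mult eq_generic_refl eq_generic_sym[OF theta_prod_add] half_int_polys_monom half_int_polys_abs_poly l as)
  have "abs_poly (a # as) = (monom 1 l + [:1 / 2:]) + abs_poly as" by (simp add: abs_poly_def l_def)
  thus ?case using eq_generic_trans[OF 1 2] by (simp only:)
qed

lemma sgn_list_cases: "0 \<notin> set as \<Longrightarrow> sgn_list as \<in> {1, -1}"
  unfolding sgn_list_def by (induction as) (auto simp: sgn_if)

lemma sgn_list_pos: "set as \<subseteq> {0<..} \<Longrightarrow> sgn_list as = 1"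
  unfolding sgn_list_def by (induction as) auto

text \<open>Generically the inverse of the denominator is the product attached to
  \<open>- abs_poly bs\<close>, because the two polynomials add up to 0; its sign is its own
  inverse.\<close>

lemma theta_quotient_eq:
  assumes as: "0 \<notin> set as" and bs: "0 \<notin> set bs"
  shows "theta_quotient n as bs = signed_theta (sgn_list as * sgn_list bs) (quot_poly n as bs)"
proof -
  have e: "theta_prod [:of_int n / 2:] w = eta (fst w) powi n" for w by (simp add: theta_prod_def)
  let ?A = "\<lambda>w. \<Prod>a\<leftarrow>as. theta (fst w) (of_int a * snd w)"
  let ?B = "\<lambda>w. \<Prod>b\<leftarrow>bs. theta (fst w) (of_int b * snd w)"
  have inv: "eq_generic (\<lambda>w. inverse (?B w)) (\<lambda>w. sgn_list bs * theta_prod (- abs_poly bs) w)"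
  proof -
    have "eq_generic (\<lambda>w. theta_prod (abs_poly bs + - abs_poly bs) w) (\<lambda>w. theta_prod (abs_poly bs) w * theta_prod (- abs_poly bs) w)"
      by (intro theta_prod_add half_int_polys_abs_poly half_int_polys_uminus bs)
    from eqgen2[OF theta_list_prod[OF bs] this]
    obtain M where M: "\<forall>w\<in>nondiv M. ?B w = sgn_list bs * theta_prod (abs_poly bs) w \<and>
        1 = theta_prod (abs_poly bs) w * theta_prod (- abs_poly bs) w"
      by (auto simp: theta_prod_0)
    show ?thesis
    proof (rule eqgenI[of M])
      fix w assume w: "w \<in> nondiv M"
      have B: "?B w = sgn_list bs * theta_prod (abs_poly bs) w" and T: "theta_prod (abs_poly bs) w * theta_prod (- abs_poly bs) w = 1"
        using M w by metis+
      have "?B w * (sgn_list bs * theta_prod (- abs_poly bs) w) = (sgn_list bs * sgn_list bs) * (theta_prod (abs_poly bs) w * theta_prod (- abs_poly bs) w)"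
        unfolding B by (simp only: mult_ac)
      also have "\<dots> = 1" unfolding T using sgn_list_cases[OF bs] by auto
      finally show "inverse (?B w) = sgn_list bs * theta_prod (- abs_poly bs) w" by (rule inverse_unique)
    qed
  qed
  have "eq_generic (\<lambda>w. theta_prod [:of_int n / 2:] w * (?A w * inverse (?B w)))
     (\<lambda>w. theta_prod [:of_int n / 2:] w * ((sgn_list as * theta_prod (abs_poly as) w) * (sgn_list bs * theta_prod (- abs_poly bs) w)))"
    by (intro eq_generic_mult eq_generic_refl theta_list_prod inv as)
  also have "(\<lambda>w. theta_prod [:of_int n / 2:] w * ((sgn_list as * theta_prod (abs_poly as) w) * (sgn_list bs * theta_prod (- abs_poly bs) w))) =
     (\<lambda>w. (sgn_list as * sgn_list bs) * (theta_prod [:of_int n / 2:] w * (theta_prod (abs_poly as) w * theta_prod (- abs_poly bs) w)))"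
    by (simp add: mult_ac)
  finally have 1: "eq_generic (\<lambda>w. theta_prod [:of_int n / 2:] w * (?A w * inverse (?B w)))
     (\<lambda>w. (sgn_list as * sgn_list bs) * (theta_prod [:of_int n / 2:] w * (theta_prod (abs_poly as) w * theta_prod (- abs_poly bs) w)))" .
  have "eq_generic (\<lambda>w. theta_prod [:of_int n / 2:] w * (theta_prod (abs_poly as) w * theta_prod (- abs_poly bs) w))
     (\<lambda>w. theta_prod [:of_int n / 2:] w * theta_prod (abs_poly as + - abs_poly bs) w)"
    by (intro eq_generic_mult eq_generic_refl eq_generic_sym[OF theta_prod_add] half_int_polys_abs_poly half_int_polys_uminus as bs)
  moreover have "eq_generic (\<lambda>w. theta_prod [:of_int n / 2:] w * theta_prod (abs_poly as + - abs_poly bs) w)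
      (theta_prod (quot_poly n as bs))"
    unfolding quot_poly_def diff_conv_add_uminus
    by (rule eq_generic_sym[OF theta_prod_add]) (intro half_int_polys_const half_int_polys_add half_int_polys_abs_poly half_int_polys_uminus as bs)+
  ultimately have "eq_generic (\<lambda>w. theta_prod [:of_int n / 2:] w * (theta_prod (abs_poly as) w * theta_prod (- abs_poly bs) w))
     (theta_prod (quot_poly n as bs))" by (rule eq_generic_trans)
  from eq_generic_trans[OF 1 eq_generic_mult[OF eq_generic_refl this, of "\<lambda>_. sgn_list as * sgn_list bs"]]
  have "mero_nf (\<lambda>w. theta_prod [:of_int n / 2:] w * (?A w * inverse (?B w))) =
      signed_theta (sgn_list as * sgn_list bs) (quot_poly n as bs)"
    unfolding signed_theta_def by (rule mero_nf_eq_generic)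
  moreover have "theta_quotient n as bs = mero_nf (\<lambda>w. theta_prod [:of_int n / 2:] w * (?A w * inverse (?B w)))"
    unfolding theta_quotient_def e by (rule arg_cong[of _ _ mero_nf]) (simp add: fun_eq_iff theta_a_def divide_inverse mult_ac)
  ultimately show ?thesis by simp
qed

text \<open>Serves surjectivity: these polynomials are closed under sums and negation and contain
  the multiples of 1/2 and all t^l with l \<ge> 1, hence the whole group.\<close>

definition quot_polys :: "real poly set" where
  "quot_polys = {quot_poly n as bs | n as bs. set as \<subseteq> {0<..} \<and> set bs \<subseteq> {0<..}}"

lemma quot_polys_add: "p \<in> quot_polys \<Longrightarrow> q \<in> quot_polys \<Longrightarrow> p + q \<in> quot_polys"
proof -
  assume "p \<in> quot_polys" "q \<in> quot_polys"
  then obtain n as bs n' as' bs' where *: "p = quot_poly n as bs" "q = quot_poly n' as' bs'"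
    "set as \<subseteq> {0<..}" "set bs \<subseteq> {0<..}" "set as' \<subseteq> {0<..}" "set bs' \<subseteq> {0<..}"
    unfolding quot_polys_def by blast
  have "p + q = quot_poly (n + n') (as @ as') (bs @ bs')"
    unfolding *(1,2) quot_poly_def abs_poly_def by (simp add: add_divide_distrib)
  thus "p + q \<in> quot_polys" unfolding quot_polys_def using *(3-6) by fastforce
qed

lemma quot_polys_uminus: "p \<in> quot_polys \<Longrightarrow> - p \<in> quot_polys"
proof -
  assume "p \<in> quot_polys"
  then obtain n as bs where *: "p = quot_poly n as bs" "set as \<subseteq> {0<..}" "set bs \<subseteq> {0<..}"
    unfolding quot_polys_def by blast
  have "- p = quot_poly (- n) bs as"
    unfolding *(1) quot_poly_def abs_poly_def by simp
  thus "- p \<in> quot_polys" unfolding quot_polys_def using *(2,3) by blast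
qed

lemma quot_polys_const: "[:of_int n / 2:] \<in> quot_polys"
  unfolding quot_polys_def by (auto intro!: exI[of _ n] exI[of _ "[]"] simp: quot_poly_def abs_poly_def)

lemma quot_polys_monom:
  assumes l: "l \<ge> 1"
  shows "monom (of_int c) l \<in> quot_polys"
proof -
  have 1: "monom 1 l \<in> quot_polys"
  proof -
    \<comment> \<open>This is theta_l / eta: the exponent -1 of \<open>eta\<close> removes the 1/2
      contributed by theta_l.\<close>
    have "monom 1 l = quot_poly (-1) [int l] []" by (simp add: quot_poly_def abs_poly_def)
    thus ?thesis unfolding quot_polys_def using l by fastforce
  qed
  have nat: "monom (of_nat k) l \<in> quot_polys" for k
  proof (induction k)
    case 0
    show ?case using quot_polys_const[of 0] by simp
  next
    case (Suc k)
    have "monom (of_nat (Suc k) :: real) l = monom 1 l + monom (of_nat k) l" by (simp add: add_monom)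
    thus ?case using quot_polys_add[OF 1 Suc] by (simp only:)
  qed
  show ?thesis
  proof (cases "c \<ge> 0")
    case True
    hence "(of_int c :: real) = of_nat (nat c)" by simp
    thus ?thesis using nat[of "nat c"] by (simp only:)
  next
    case False
    hence "monom (of_int c :: real) l = - monom (of_nat (nat (- c))) l" by (simp add: minus_monom)
    thus ?thesis using quot_polys_uminus[OF nat[of "nat (- c)"]] by (simp only:)
  qed
qed

lemma half_int_polys_subset_quot_polys:
  assumes p: "p \<in> half_int_polys"
  shows "p \<in> quot_polys"
proof -
  have "(\<Sum>l\<in>A. monom (coeff p l) l) \<in> quot_polys" if "finite A" "A \<subseteq> {1..}" for A
    using that
  proof (induction A rule: finite_induct)
    case empty
    show ?case using quot_polys_const[of 0] by simp
  next
    case (insert l A)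
    hence l: "l \<ge> 1" by simp
    have e: "of_int \<lfloor>coeff p l\<rfloor> = coeff p l" using p l by (intro floor_exact) (simp add: half_int_polys_iff)
    have "monom (coeff p l) l \<in> quot_polys" using quot_polys_monom[OF l, of "\<lfloor>coeff p l\<rfloor>"] unfolding e .
    thus ?case using insert by (auto intro: quot_polys_add)
  qed
  hence "(\<Sum>l=1..degree p. monom (coeff p l) l) \<in> quot_polys" by auto
  moreover have "monom (coeff p 0) 0 \<in> quot_polys"
  proof -
    have "2 * coeff p 0 \<in> \<int>" using p by (simp add: half_int_polys_iff)
    from floor_exact[OF this] have e: "of_int \<lfloor>2 * coeff p 0\<rfloor> / 2 = coeff p 0" by linarith
    show ?thesis using quot_polys_const[of "\<lfloor>2 * coeff p 0\<rfloor>"] unfolding e monom_0 .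
  qed
  ultimately have "(\<Sum>l\<le>degree p. monom (coeff p l) l) \<in> quot_polys"
    unfolding sum_atMost_split_0 by (intro quot_polys_add)
  thus ?thesis by (simp add: poly_as_sum_of_monoms)
qed

lemma carrier_TQ_pos: "carrier (TQ {0<..}) = theta_poly ` half_int_polys"
proof (intro equalityI subsetI)
  fix F assume "F \<in> carrier (TQ {0<..})"
  then obtain n as bs where F: "F = theta_quotient n as bs" "set as \<subseteq> {0<..}" "set bs \<subseteq> {0<..}"
    unfolding TQ_def by auto
  hence nz: "0 \<notin> set as" "0 \<notin> set bs" by auto
  have "F = theta_poly (quot_poly n as bs)"
    unfolding F(1) theta_quotient_eq[OF nz] by (simp add: sgn_list_pos F signed_theta_1)
  thus "F \<in> theta_poly ` half_int_polys" using half_int_polys_quot_poly[OF nz] by blast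
next
  fix F assume "F \<in> theta_poly ` half_int_polys"
  then obtain p where p: "p \<in> half_int_polys" "F = theta_poly p" by blast
  obtain n as bs where *: "p = quot_poly n as bs" "set as \<subseteq> {0<..}" "set bs \<subseteq> {0<..}"
    using half_int_polys_subset_quot_polys[OF p(1)] unfolding quot_polys_def by blast
  hence nz: "0 \<notin> set as" "0 \<notin> set bs" by auto
  have "F = theta_quotient n as bs"
    unfolding p(2) theta_quotient_eq[OF nz] by (simp add: sgn_list_pos * signed_theta_1)
  thus "F \<in> carrier (TQ {0<..})" unfolding TQ_def using *(2,3) by auto
qed

lemma carrier_TQ_nz: "carrier (TQ (- {0})) = {signed_theta s p | s p. s \<in> {1, -1} \<and> p \<in> half_int_polys}"
proof (intro equalityI subsetI)
  fix F assume "F \<in> carrier (TQ (- {0}))"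
  then obtain n as bs where F: "F = theta_quotient n as bs" "set as \<subseteq> - {0}" "set bs \<subseteq> - {0}"
    unfolding TQ_def by auto
  hence nz: "0 \<notin> set as" "0 \<notin> set bs" by auto
  have "sgn_list as * sgn_list bs \<in> {1, -1}" using sgn_list_cases[OF nz(1)] sgn_list_cases[OF nz(2)] by auto
  thus "F \<in> {signed_theta s p | s p. s \<in> {1, -1} \<and> p \<in> half_int_polys}"
    unfolding F(1) theta_quotient_eq[OF nz] using half_int_polys_quot_poly[OF nz] by blast
next
  fix F assume "F \<in> {signed_theta s p | s p. s \<in> {1, -1} \<and> p \<in> half_int_polys}"
  then obtain s p where p: "p \<in> half_int_polys" "F = signed_theta s p" "s \<in> {1, -1}" by blast
  obtain n as bs where *: "p = quot_poly n as bs" "set as \<subseteq> {0<..}" "set bs \<subseteq> {0<..}"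
    using half_int_polys_subset_quot_polys[OF p(1)] unfolding quot_polys_def by blast
  have nz: "0 \<notin> set as" "0 \<notin> set bs" using *(2,3) by auto
  show "F \<in> carrier (TQ (- {0}))"
  proof (cases "s = 1")
    case True
    have "F = theta_quotient n as bs"
      unfolding p(2) theta_quotient_eq[OF nz] by (simp add: sgn_list_pos * True)
    thus ?thesis unfolding TQ_def using nz by auto
  next
    case False
    hence s: "s = -1" using p(3) by simp
    \<comment> \<open>The extra quotient theta_1 / theta_(-1) is the constant -1 and leaves the
      polynomial unchanged.\<close>
    have nz': "0 \<notin> set (1 # as)" "0 \<notin> set (-1 # bs)" using nz by auto
    have "sgn_list (1 # as) * sgn_list (-1 # bs) = -1" using sgn_list_pos[OF *(2)] sgn_list_pos[OF *(3)] by (simp add: sgn_list_def)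
    moreover have "quot_poly n (1 # as) (-1 # bs) = p" unfolding *(1) by (simp add: quot_poly_def abs_poly_def)
    ultimately have "F = theta_quotient n (1 # as) (-1 # bs)"
      unfolding p(2) theta_quotient_eq[OF nz'] s by simp
    moreover have "set (1 # as) \<subseteq> - {0}" "set (-1 # bs) \<subseteq> - {0}" using nz by auto
    ultimately have "F \<in> {theta_quotient n as bs | n as bs. set as \<subseteq> - {0} \<and> set bs \<subseteq> - {0}}" by blast
    thus ?thesis unfolding TQ_def by simp
  qed
qed

section \<open>Group structures and the two isomorphisms\<close>

lemma mult_TQ: "x \<otimes>\<^bsub>TQ A\<^esub> y = mero_nf (\<lambda>w. x w * y w)"
  by (simp add: TQ_def)

lemma one_TQ: "\<one>\<^bsub>TQ A\<^esub> = signed_theta 1 0"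
  by (simp add: TQ_def mero_nf_const)

lemma comm_group_half_int_poly: "comm_group half_int_poly_group"
proof (rule comm_groupI)
  fix x assume "x \<in> half_int_polys"
  thus "\<exists>y\<in>half_int_polys. y \<otimes>\<^bsub>half_int_poly_group\<^esub> x = \<one>\<^bsub>half_int_poly_group\<^esub>"
    using half_int_polys_uminus[of x] by (intro bexI[of _ "- x"]) (auto simp: half_int_poly_group_def)
next
  fix x y assume "x \<in> half_int_polys" "y \<in> half_int_polys"
  thus "x \<otimes>\<^bsub>half_int_poly_group\<^esub> y \<in> half_int_polys" using half_int_polys_add[of x y] by (simp add: half_int_poly_group_def)
next
  show "\<one>\<^bsub>half_int_poly_group\<^esub> \<in> half_int_polys" using half_int_polys_0 by (simp add: half_int_poly_group_def)
qed (simp_all add: half_int_poly_group_def add_ac)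

lemma comm_group_TQ_nz: "comm_group (TQ (- {0}))"
proof (rule comm_groupI)
  fix x y assume "x \<in> carrier (TQ (- {0}))" "y \<in> carrier (TQ (- {0}))"
  then obtain s p r q where *: "x = signed_theta s p" "y = signed_theta r q" "s \<in> {1, -1}" "r \<in> {1, -1}" "p \<in> half_int_polys" "q \<in> half_int_polys"
    unfolding carrier_TQ_nz by blast
  have "s * r \<in> {1, -1}" using *(3,4) by auto
  thus "x \<otimes>\<^bsub>TQ (- {0})\<^esub> y \<in> carrier (TQ (- {0}))"
    unfolding carrier_TQ_nz mult_TQ *(1,2) signed_theta_mult[OF *(5,6)] using half_int_polys_add[OF *(5,6)] by blast
  show "x \<otimes>\<^bsub>TQ (- {0})\<^esub> y = y \<otimes>\<^bsub>TQ (- {0})\<^esub> x" by (simp add: mult_TQ mult.commute)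
  fix z assume "z \<in> carrier (TQ (- {0}))"
  then obtain t u where z: "z = signed_theta t u" "u \<in> half_int_polys" unfolding carrier_TQ_nz by blast
  show "x \<otimes>\<^bsub>TQ (- {0})\<^esub> y \<otimes>\<^bsub>TQ (- {0})\<^esub> z = x \<otimes>\<^bsub>TQ (- {0})\<^esub> (y \<otimes>\<^bsub>TQ (- {0})\<^esub> z)"
    unfolding mult_TQ *(1,2) z(1)
    by (simp add: signed_theta_mult * z half_int_polys_add add.assoc mult.assoc)
next
  show "\<one>\<^bsub>TQ (- {0})\<^esub> \<in> carrier (TQ (- {0}))" unfolding one_TQ carrier_TQ_nz using half_int_polys_0 by blast
next
  fix x assume "x \<in> carrier (TQ (- {0}))"
  then obtain s p where *: "x = signed_theta s p" "s \<in> {1, -1}" "p \<in> half_int_polys"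
    unfolding carrier_TQ_nz by blast
  show "\<one>\<^bsub>TQ (- {0})\<^esub> \<otimes>\<^bsub>TQ (- {0})\<^esub> x = x"
    unfolding one_TQ mult_TQ *(1) signed_theta_mult[OF half_int_polys_0 *(3)] by simp
  have "signed_theta s (- p) \<otimes>\<^bsub>TQ (- {0})\<^esub> x = \<one>\<^bsub>TQ (- {0})\<^esub>"
    unfolding one_TQ mult_TQ *(1) signed_theta_mult[OF half_int_polys_uminus[OF *(3)] *(3)] using *(2) by auto
  moreover have "signed_theta s (- p) \<in> carrier (TQ (- {0}))"
    unfolding carrier_TQ_nz using *(2) half_int_polys_uminus[OF *(3)] by blast
  ultimately show "\<exists>y\<in>carrier (TQ (- {0})). y \<otimes>\<^bsub>TQ (- {0})\<^esub> x = \<one>\<^bsub>TQ (- {0})\<^esub>" by blast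
qed

lemma theta_poly_mult:
  assumes "p \<in> half_int_polys" "q \<in> half_int_polys"
  shows "theta_poly p \<otimes>\<^bsub>TQ A\<^esub> theta_poly q = theta_poly (p + q)"
  unfolding mult_TQ signed_theta_1[symmetric] signed_theta_mult[OF assms] by simp

lemma comm_group_TQ_pos: "comm_group (TQ {0<..})"
proof (rule comm_groupI)
  fix x y assume "x \<in> carrier (TQ {0<..})" "y \<in> carrier (TQ {0<..})"
  then obtain p q where *: "x = theta_poly p" "y = theta_poly q" "p \<in> half_int_polys" "q \<in> half_int_polys"
    unfolding carrier_TQ_pos by blast
  show "x \<otimes>\<^bsub>TQ {0<..}\<^esub> y \<in> carrier (TQ {0<..})"
    unfolding carrier_TQ_pos *(1,2) theta_poly_mult[OF *(3,4)] using half_int_polys_add[OF *(3,4)] by blast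
  show "x \<otimes>\<^bsub>TQ {0<..}\<^esub> y = y \<otimes>\<^bsub>TQ {0<..}\<^esub> x" by (simp add: mult_TQ mult.commute)
  fix z assume "z \<in> carrier (TQ {0<..})"
  then obtain u where z: "z = theta_poly u" "u \<in> half_int_polys" unfolding carrier_TQ_pos by blast
  show "x \<otimes>\<^bsub>TQ {0<..}\<^esub> y \<otimes>\<^bsub>TQ {0<..}\<^esub> z = x \<otimes>\<^bsub>TQ {0<..}\<^esub> (y \<otimes>\<^bsub>TQ {0<..}\<^esub> z)"
    unfolding *(1,2) z(1) by (simp add: theta_poly_mult * z half_int_polys_add add.assoc)
next
  show "\<one>\<^bsub>TQ {0<..}\<^esub> \<in> carrier (TQ {0<..})" unfolding one_TQ signed_theta_1 carrier_TQ_pos using half_int_polys_0 by blast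
next
  fix x assume "x \<in> carrier (TQ {0<..})"
  then obtain p where *: "x = theta_poly p" "p \<in> half_int_polys"
    unfolding carrier_TQ_pos by blast
  show "\<one>\<^bsub>TQ {0<..}\<^esub> \<otimes>\<^bsub>TQ {0<..}\<^esub> x = x"
    unfolding one_TQ signed_theta_1 *(1) theta_poly_mult[OF half_int_polys_0 *(2)] by simp
  have "theta_poly (- p) \<otimes>\<^bsub>TQ {0<..}\<^esub> x = \<one>\<^bsub>TQ {0<..}\<^esub>"
    unfolding one_TQ signed_theta_1 *(1) theta_poly_mult[OF half_int_polys_uminus[OF *(2)] *(2)] by simp
  moreover have "theta_poly (- p) \<in> carrier (TQ {0<..})"
    unfolding carrier_TQ_pos using half_int_polys_uminus[OF *(2)] by blast
  ultimately show "\<exists>y\<in>carrier (TQ {0<..}). y \<otimes>\<^bsub>TQ {0<..}\<^esub> x = \<one>\<^bsub>TQ {0<..}\<^esub>" by blast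
qed

lemma mult_half_int_poly: "p \<otimes>\<^bsub>half_int_poly_group\<^esub> q = p + q"
  by (simp add: half_int_poly_group_def)

lemma theta_poly_iso: "theta_poly \<in> iso half_int_poly_group (TQ {0<..})"
proof (rule isoI)
  show "theta_poly \<in> hom half_int_poly_group (TQ {0<..})"
    by (rule homI) (auto simp: carrier_TQ_pos mult_half_int_poly theta_poly_mult)
  have "inj_on theta_poly half_int_polys"
    by (rule inj_onI, rule signed_theta_inject(1)[where s = 1 and r = 1]) (auto simp: signed_theta_1)
  thus "bij_betw theta_poly half_int_polys (carrier (TQ {0<..}))" by (simp add: bij_betw_def carrier_TQ_pos)
qed

lemma signs_eq: "signs = {signed_theta s 0 | s. s \<in> {1, -1}}"
  by (auto simp: signs_def mero_nf_const)

lemma signs_normal: "signs \<lhd> TQ (- {0})"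
proof -
  interpret G: comm_group "TQ (- {0})" by (rule comm_group_TQ_nz)
  have "subgroup signs (TQ (- {0}))"
  proof (rule G.subgroupI)
    show sub: "signs \<subseteq> carrier (TQ (- {0}))" unfolding signs_eq carrier_TQ_nz using half_int_polys_0 by blast
    show "signs \<noteq> {}" by (simp add: signs_def)
    have mult: "a \<otimes>\<^bsub>TQ (- {0})\<^esub> b \<in> signs" if "a \<in> signs" "b \<in> signs" for a b
    proof -
      obtain s r where *: "a = signed_theta s 0" "b = signed_theta r 0" "s \<in> {1, -1}" "r \<in> {1, -1}"
        using \<open>a \<in> signs\<close> \<open>b \<in> signs\<close> unfolding signs_eq by blast
      have "s * r \<in> {1, -1}" using *(3,4) by auto
      moreover have "a \<otimes>\<^bsub>TQ (- {0})\<^esub> b = signed_theta (s * r) 0"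
        unfolding mult_TQ *(1,2) signed_theta_mult[OF half_int_polys_0 half_int_polys_0] by simp
      ultimately show ?thesis unfolding signs_eq by blast
    qed
    thus "\<And>a b. a \<in> signs \<Longrightarrow> b \<in> signs \<Longrightarrow> a \<otimes>\<^bsub>TQ (- {0})\<^esub> b \<in> signs" .
    fix a assume a: "a \<in> signs"
    then obtain s where s: "a = signed_theta s 0" "s \<in> {1, -1}" unfolding signs_eq by blast
    have "a \<otimes>\<^bsub>TQ (- {0})\<^esub> a = \<one>\<^bsub>TQ (- {0})\<^esub>"
      unfolding mult_TQ s(1) signed_theta_mult[OF half_int_polys_0 half_int_polys_0] one_TQ using s(2) by auto
    hence "inv\<^bsub>TQ (- {0})\<^esub> a = a" using a sub by (intro G.inv_equality) auto
    thus "inv\<^bsub>TQ (- {0})\<^esub> a \<in> signs" using a by simp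
  qed
  thus ?thesis by (rule G.subgroup_imp_normal)
qed

lemma theta_poly_in_TQ_nz: "p \<in> half_int_polys \<Longrightarrow> theta_poly p \<in> carrier (TQ (- {0}))"
  unfolding carrier_TQ_nz signed_theta_1[symmetric] by blast

lemma in_signs_coset:
  assumes p: "p \<in> half_int_polys"
  shows "F \<in> signs #>\<^bsub>TQ (- {0})\<^esub> theta_poly p \<longleftrightarrow> (\<exists>s\<in>{1, -1}. F = signed_theta s p)"
proof -
  have "signed_theta s 0 \<otimes>\<^bsub>TQ (- {0})\<^esub> theta_poly p = signed_theta s p" for s
    unfolding mult_TQ signed_theta_1[symmetric] signed_theta_mult[OF half_int_polys_0 p] by simp
  thus ?thesis unfolding r_coset_def signs_eq by auto
qed

text \<open>A coset of \<open>signs\<close> consists of the two signed versions of one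
  \<open>theta_poly p\<close>. Injectivity therefore requires \<open>signed_theta_inject\<close>
  with different signs, and surjectivity is \<open>carrier_TQ_nz\<close>.\<close>

lemma theta_poly_coset_iso:
  "(\<lambda>p. signs #>\<^bsub>TQ (- {0})\<^esub> theta_poly p) \<in> iso half_int_poly_group (TQ (- {0}) Mod signs)"
proof -
  interpret N: normal signs "TQ (- {0})" by (rule signs_normal)
  have sg: "subgroup signs (TQ (- {0}))" by (rule N.subgroup_axioms)
  show ?thesis
  proof (rule isoI)
    show "(\<lambda>p. signs #>\<^bsub>TQ (- {0})\<^esub> theta_poly p) \<in> hom half_int_poly_group (TQ (- {0}) Mod signs)"
    proof (rule homI)
      fix p q assume pq: "p \<in> half_int_polys" "q \<in> half_int_polys"
      show "signs #>\<^bsub>TQ (- {0})\<^esub> theta_poly p \<in> carrier (TQ (- {0}) Mod signs)"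
        unfolding FactGroup_def using theta_poly_in_TQ_nz[OF pq(1)] by (auto simp: RCOSETS_def)
      show "signs #>\<^bsub>TQ (- {0})\<^esub> theta_poly (p \<otimes>\<^bsub>half_int_poly_group\<^esub> q) =
          (signs #>\<^bsub>TQ (- {0})\<^esub> theta_poly p) \<otimes>\<^bsub>TQ (- {0}) Mod signs\<^esub> (signs #>\<^bsub>TQ (- {0})\<^esub> theta_poly q)"
        unfolding FactGroup_def mult_half_int_poly
        using N.rcos_sum[OF theta_poly_in_TQ_nz[OF pq(1)] theta_poly_in_TQ_nz[OF pq(2)]]
        by (simp add: theta_poly_mult pq)
    qed
    show "bij_betw (\<lambda>p. signs #>\<^bsub>TQ (- {0})\<^esub> theta_poly p) half_int_polys (carrier (TQ (- {0}) Mod signs))"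
    proof (rule bij_betwI')
      fix p q assume pq: "p \<in> half_int_polys" "q \<in> half_int_polys"
      show "(signs #>\<^bsub>TQ (- {0})\<^esub> theta_poly p = signs #>\<^bsub>TQ (- {0})\<^esub> theta_poly q) = (p = q)"
      proof
        assume eq: "signs #>\<^bsub>TQ (- {0})\<^esub> theta_poly p = signs #>\<^bsub>TQ (- {0})\<^esub> theta_poly q"
        have "signed_theta 1 p \<in> signs #>\<^bsub>TQ (- {0})\<^esub> theta_poly p" using in_signs_coset[OF pq(1)] by blast
        then obtain s where "s \<in> {1, -1}" "signed_theta 1 p = signed_theta s q"
          unfolding eq in_signs_coset[OF pq(2)] by blast
        thus "p = q" using signed_theta_inject(1)[OF pq, of 1 s] by simp
      qed simp
    next
      fix p assume "p \<in> half_int_polys"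
      thus "signs #>\<^bsub>TQ (- {0})\<^esub> theta_poly p \<in> carrier (TQ (- {0}) Mod signs)"
        unfolding FactGroup_def using theta_poly_in_TQ_nz by (auto simp: RCOSETS_def)
    next
      fix X assume "X \<in> carrier (TQ (- {0}) Mod signs)"
      then obtain g where g: "g \<in> carrier (TQ (- {0}))" "X = signs #>\<^bsub>TQ (- {0})\<^esub> g"
        unfolding FactGroup_def by (auto simp: RCOSETS_def)
      then obtain s p where sp: "g = signed_theta s p" "s \<in> {1, -1}" "p \<in> half_int_polys" unfolding carrier_TQ_nz by blast
      have "g \<in> signs #>\<^bsub>TQ (- {0})\<^esub> theta_poly p" using sp in_signs_coset[OF sp(3)] by blast
      hence "signs #>\<^bsub>TQ (- {0})\<^esub> theta_poly p = X"
        unfolding g(2) by (rule N.repr_independence[OF _ theta_poly_in_TQ_nz[OF sp(3)] sg])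
      thus "\<exists>p\<in>half_int_polys. X = signs #>\<^bsub>TQ (- {0})\<^esub> theta_poly p" using sp(3) by blast
    qed
  qed
qed

section \<open>The order of a quotient in terms of its factors\<close>

lemma ord_formula_upto:
  assumes p: "p \<in> half_int_polys" and M: "degree p \<le> M"
  shows "ord_formula p x = (\<Sum>l\<le>M. coeff p l * (theta_B (of_nat l * x) - 1 / 24))"
  unfolding ord_formula_eq[OF p] using M by (intro sum.mono_neutral_left) (auto simp: coeff_eq_0)

lemma ord_formula_add:
  assumes "p \<in> half_int_polys" "q \<in> half_int_polys"
  shows "ord_formula (p + q) x = ord_formula p x + ord_formula q x"
proof -
  define M where "M = max (degree p) (degree q)"
  have "degree (p + q) \<le> M" "degree p \<le> M" "degree q \<le> M" by (auto simp: M_def degree_add_le)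
  thus ?thesis
    by (simp add: ord_formula_upto[of _ M] assms half_int_polys_add sum.distrib[symmetric] distrib_right)
qed

lemma ord_formula_uminus: "p \<in> half_int_polys \<Longrightarrow> ord_formula (- p) x = - ord_formula p x"
  by (simp add: ord_formula_eq half_int_polys_uminus sum_negf)

lemma ord_formula_const: "ord_formula [:of_int n / 2:] x = of_int n / 24"
  by (simp add: ord_formula_def exp_eta_def)

lemma theta_B_0: "theta_B 0 = 1 / 8"
  by (simp add: theta_B_eq power2_eq_square)

text \<open>The constant 1/2 contributes 1/24, which cancels the -1/24 belonging to t^l.\<close>

lemma ord_formula_monom:
  assumes l: "l \<ge> 1"
  shows "ord_formula (monom 1 l + [:1 / 2:]) x = theta_B (of_nat l * x)"
proof -
  have d: "degree (monom (1::real) l + [:1 / 2:]) \<le> l" by (rule degree_add_le) (auto simp: degree_monom_eq)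
  have "ord_formula (monom 1 l + [:1 / 2:]) x =
     (\<Sum>k\<le>l. coeff (monom 1 l + [:1 / 2:]) k * (theta_B (of_nat k * x) - 1 / 24))"
    by (rule ord_formula_upto[OF half_int_polys_monom[OF l] d])
  also have "\<dots> = 1 / 24 + (\<Sum>k=1..l. coeff (monom 1 l + [:1 / 2:]) k * (theta_B (of_nat k * x) - 1 / 24))"
    using l by (subst sum_atMost_split_0) (simp add: theta_B_0)
  also have "(\<Sum>k=1..l. coeff (monom 1 l + [:1 / 2:]) k * (theta_B (of_nat k * x) - 1 / 24)) =
     (\<Sum>k=1..l. if k = l then theta_B (of_nat k * x) - 1 / 24 else 0)"
    by (intro sum.cong refl) (auto simp: coeff_pCons split: nat.split)
  also have "\<dots> = theta_B (of_nat l * x) - 1 / 24" using l by (subst sum.delta) auto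
  finally show ?thesis by simp
qed

lemma ord_formula_abs_poly:
  assumes "0 \<notin> set as"
  shows "ord_formula (abs_poly as) x = (\<Sum>a\<leftarrow>as. theta_B (of_int a * x))"
  using assms
proof (induction as)
  case Nil
  show ?case by (simp add: abs_poly_def ord_formula_def exp_eta_def)
next
  case (Cons a as)
  have a: "nat \<bar>a\<bar> \<ge> 1" and as: "0 \<notin> set as" using Cons.prems by auto
  have "ord_formula (abs_poly (a # as)) x = ord_formula ((monom 1 (nat \<bar>a\<bar>) + [:1 / 2:]) + abs_poly as) x"
    by (simp add: abs_poly_def)
  also have "\<dots> = theta_B (of_nat (nat \<bar>a\<bar>) * x) + (\<Sum>a\<leftarrow>as. theta_B (of_int a * x))"
    by (simp only: ord_formula_add[OF half_int_polys_monom[OF a] half_int_polys_abs_poly[OF as]] ord_formula_monom[OF a] Cons.IH[OF as])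
  also have "theta_B (of_nat (nat \<bar>a\<bar>) * x) = theta_B (of_int a * x)"
    using theta_B_minus[of "of_int a * x"] by (cases "a \<ge> 0") auto
  finally show ?case by simp
qed

lemma ord_formula_quot_poly:
  assumes "0 \<notin> set as" "0 \<notin> set bs"
  shows "ord_formula (quot_poly n as bs) x =
    (\<Sum>a\<leftarrow>as. theta_B (of_int a * x)) - (\<Sum>b\<leftarrow>bs. theta_B (of_int b * x)) + of_int n / 24"
  unfolding quot_poly_def diff_conv_add_uminus
  by (simp only: ord_formula_add[OF half_int_polys_const half_int_polys_add[OF half_int_polys_abs_poly[OF assms(1)] half_int_polys_uminus[OF half_int_polys_abs_poly[OF assms(2)]]]]
      ord_formula_add[OF half_int_polys_abs_poly[OF assms(1)] half_int_polys_uminus[OF half_int_polys_abs_poly[OF assms(2)]]]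
      ord_formula_uminus[OF half_int_polys_abs_poly[OF assms(2)]] ord_formula_const ord_formula_abs_poly[OF assms(1)] ord_formula_abs_poly[OF assms(2)])

theorem theorem3p8:
  shows "comm_group half_int_poly_group \<and>
    comm_group (TQ {0<..}) \<and>
    theta_poly \<in> iso half_int_poly_group (TQ {0<..}) \<and>
    comm_group (TQ (- {0})) \<and> signs \<lhd> TQ (- {0}) \<and>
    (\<lambda>p. signs #>\<^bsub>TQ (- {0})\<^esub> theta_poly p)
       \<in> iso half_int_poly_group (TQ (- {0}) Mod signs) \<and>
    (\<forall>p \<in> carrier half_int_poly_group.
      let k = poly p 0;
          m = (poly (pderiv p) 1 + poly (pderiv (pderiv p)) 1) / 2;
          h = \<lfloor>2 * poly p 1\<rfloor>;
          P = poly (map_poly complex_of_real p)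
      in of_int h = 2 * poly p 1 \<and>
         meromorphic_jacobi_form k m h (theta_poly p) \<and>
         (weakly_holomorphic (theta_poly p) \<longleftrightarrow>
            (\<forall>N::nat. N > 0 \<longrightarrow>
               1 / of_nat N * (\<Sum>\<zeta> | \<zeta> ^ N = 1. P \<zeta>) \<ge> of_real (coeff p 0))) \<and>
         (\<forall>x::real.
            has_ord_at_infinity m (theta_poly p) x (ord_at_infinity m (theta_poly p) x) \<and>
            (\<lambda>n::int. P (cexp2pi (of_real x * of_int n)) / (of_int n)\<^sup>2) summable_on (- {0}) \<and>
            of_real (ord_at_infinity m (theta_poly p) x) =
              1 / (4 * of_real pi ^ 2) *
              (\<Sum>\<^sub>\<infinity>n::int\<in>- {0}. P (cexp2pi (of_real x * of_int n)) / (of_int n)\<^sup>2)) \<and>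
         (\<forall>n as bs. 0 \<notin> set as \<union> set bs \<and> theta_poly p = theta_quotient n as bs \<longrightarrow>
            (\<forall>x. ord_at_infinity m (theta_poly p) x =
               (\<Sum>a\<leftarrow>as. theta_B (of_int a * x)) - (\<Sum>b\<leftarrow>bs. theta_B (of_int b * x)) + of_int n / 24)))"
proof (intro conjI comm_group_half_int_poly comm_group_TQ_pos theta_poly_iso comm_group_TQ_nz
    signs_normal theta_poly_coset_iso ballI, goal_cases)
  case (1 p)
  note p = this
  define m where "m = (poly (pderiv p) 1 + poly (pderiv (pderiv p)) 1) / 2"
  have m: "m = of_int (exp_sq p) / 2" unfolding m_def half_int_polys_poly_values(3)[OF p] ..
  have has_ord: "has_ord_at_infinity m (theta_poly p) x (ord_formula p x)" for x
    unfolding m by (rule has_ord_theta_poly)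
  have ord: "ord_at_infinity m (theta_poly p) x = ord_formula p x" for x
    by (rule ord_at_infinity_eqI[OF has_ord])
  have h: "of_int \<lfloor>2 * poly p 1\<rfloor> = 2 * poly p 1"
    unfolding half_int_polys_poly_values(2)[OF p] by simp
  have jac: "meromorphic_jacobi_form (poly p 0) m \<lfloor>2 * poly p 1\<rfloor> (theta_poly p)"
    unfolding m_def by (rule jacobi_theta_poly[OF p])
  have sm: "(\<lambda>n::int. poly (map_poly complex_of_real p) (cexp2pi (of_real x * of_int n)) / (of_int n)\<^sup>2) summable_on (- {0})"
    and inf: "of_real (ord_formula p x) = 1 / (4 * of_real pi ^ 2) *
      (\<Sum>\<^sub>\<infinity>n::int\<in>- {0}. poly (map_poly complex_of_real p) (cexp2pi (of_real x * of_int n)) / (of_int n)\<^sup>2)" for x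
    using has_sum_imp_summable[OF ord_formula_fourier[OF p]] infsumI[OF ord_formula_fourier[OF p]] by simp_all
  \<comment> \<open>The lists may contain negative indices, so the representation determines p only
    through injectivity modulo sign; the formula is then additivity of
    \<open>ord_formula\<close>.\<close>
  have quot: "ord_formula p x = (\<Sum>a\<leftarrow>as. theta_B (of_int a * x)) - (\<Sum>b\<leftarrow>bs. theta_B (of_int b * x)) + of_int n / 24"
    if "0 \<notin> set as \<union> set bs" "theta_poly p = theta_quotient n as bs" for n as bs x
  proof -
    have nz: "0 \<notin> set as" "0 \<notin> set bs" using that by auto
    have "signed_theta 1 p = signed_theta (sgn_list as * sgn_list bs) (quot_poly n as bs)"
      using that(2) unfolding signed_theta_1 theta_quotient_eq[OF nz] .
    moreover have "sgn_list as * sgn_list bs \<in> {1, -1}" using sgn_list_cases[OF nz(1)] sgn_list_cases[OF nz(2)] by auto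
    ultimately have "p = quot_poly n as bs"
      using signed_theta_inject(1)[OF p half_int_polys_quot_poly[OF nz], of 1 "sgn_list as * sgn_list bs"] by blast
    thus ?thesis using ord_formula_quot_poly[OF nz] by simp
  qed
  show ?case
    unfolding Let_def m_def[symmetric] ord
    by (intro conjI allI impI h jac weakly_holomorphic_iff[OF p] has_ord sm inf) (elim conjE, rule quot)
qed

end
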